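(* Let $U\subset\mathbb{C}$ be a smooth bounded simply connected domain with the blobs $U_1$, $U_{1,n}$ described in the context, and fix $c>0$. There exist $\beta>0$ and $C>0$ depending only on $c$ and $U$ such that for all large enough $n$ and every $*$-connected set $A\subset U_n$ with $\min(\mathrm{diam}(A),d(U_1,A))\ge c$, $$\sup_{x\sim A}\mathbb{P}_x\bigl(\tau(U_{1,n})\le\tau(A)\bigr)\le\frac{C}{n^\beta},$$ where $x\sim A$ means that $x\in U_n\setminus A$ and $x$ is a neighbour in $U_n$ of some $y\in A$.
   Context: $d$ is the Euclidean distance, $B(x,r)$ the open Euclidean ball. A bounded simply connected domain $U\subset\mathbb{C}$ is smooth if $\partial U$ is an analytic curve (equivalently, a conformal map from $U$ onto the unit disc extends conformally across the boundary). Graph: $U_n=U\cap\frac1n\mathbb{Z}^2$, with the nearest-neighbour edges of $\frac1n\mathbb{Z}^2$ between points of $U_n$, except that every edge (segment) intersecting $U^c$ is deleted; for large $n$ this graph is connected. Blob: fix $x_1\in\partial U$, a small enough $\delta>0$ and $y_1\in U$ with $d(x_1,y_1)=\delta$ and $d(y_1,\partial U)>\delta/2$; $U_1=B(y_1,\delta/4)$ and $U_{1,n}=B(z_{1,n},\delta/4)\cap U_n$, where $z_{1,n}$ is the closest point of $\frac1n\mathbb{Z}^2$ to $y_1$. $*$-connected: let $U_n^*$ be the graph $U_n$ together with all diagonals of the lattice squares that are entirely in $U_n$; a subset of $U_n$ is $*$-connected if it is connected in $U_n^*$. Random walk: continuous-time simple random walk on $U_n$ with exponential waiting times of mean $\frac1{2n^2}$;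 $\mathbb{P}_x$ is its law from $x$, and $\tau(S)$ is the hitting time of a set $S\subset U_n$. *)

theory Defs
  imports "HOL-Probability.Probability"
begin

section \<open>Smooth domains and blobs\<close>

text \<open>An analytic (closed Jordan) curve is the image of the unit circle under a map that is
  conformal, i.e. holomorphic and injective, in a neighbourhood of the circle.\<close>

definition analytic_curve :: "complex set \<Rightarrow> bool" where
  "analytic_curve \<Gamma> \<longleftrightarrow>
     (\<exists>W \<phi>. open W \<and> sphere 0 1 \<subseteq> W \<and> \<phi> holomorphic_on W \<and> inj_on \<phi> W \<and> \<phi> ` sphere 0 1 = \<Gamma>)"

definition smooth_domain :: "complex set \<Rightarrow> bool" where
  "smooth_domain U \<longleftrightarrow>
     open U \<and> U \<noteq> {} \<and> bounded U \<and> connected U \<and> simply_connected U \<and> analytic_curve (frontier U)"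

text \<open>The blob attached to \<open>(x\<^sub>1, \<delta>, y\<^sub>1)\<close> is \<open>ball y\<^sub>1 (\<delta> / 4)\<close>. The role of ``\<open>\<delta>\<close> small enough'' is
  to guarantee that a point \<open>y\<^sub>1\<close> as below exists; here the existence of \<open>y\<^sub>1\<close> is part of the data.\<close>

definition blob_data :: "complex set \<Rightarrow> complex \<Rightarrow> real \<Rightarrow> complex \<Rightarrow> bool" where
  "blob_data U x1 \<delta> y1 \<longleftrightarrow>
     x1 \<in> frontier U \<and> \<delta> > 0 \<and> y1 \<in> U \<and> dist x1 y1 = \<delta> \<and> infdist y1 (frontier U) > \<delta> / 2"

section \<open>The discretised domain\<close>

definition grid :: "nat \<Rightarrow> complex set" where
  "grid n = {Complex (of_int i / of_nat n) (of_int j / of_nat n) | i j. True}"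

definition verts :: "complex set \<Rightarrow> nat \<Rightarrow> complex set" where
  "verts U n = U \<inter> grid n"

definition adj :: "complex set \<Rightarrow> nat \<Rightarrow> complex \<Rightarrow> complex \<Rightarrow> bool" where
  "adj U n x y \<longleftrightarrow>
     x \<in> verts U n \<and> y \<in> verts U n \<and> dist x y = 1 / of_nat n \<and> closed_segment x y \<subseteq> U"

text \<open>\<open>x\<close> and \<open>y\<close> are opposite corners of a lattice square all of whose corners and sides belong
  to the graph.\<close>

definition diag :: "complex set \<Rightarrow> nat \<Rightarrow> complex \<Rightarrow> complex \<Rightarrow> bool" where
  "diag U n x y \<longleftrightarrow>
     (let p = Complex (Re x) (Im y); q = Complex (Re y) (Im x)
      in adj U n x p \<and> adj U n p y \<and> adj U n x q \<and> adj U n q y)"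

definition star_adj :: "complex set \<Rightarrow> nat \<Rightarrow> complex \<Rightarrow> complex \<Rightarrow> bool" where
  "star_adj U n x y \<longleftrightarrow> adj U n x y \<or> diag U n x y"

definition star_connected :: "complex set \<Rightarrow> nat \<Rightarrow> complex set \<Rightarrow> bool" where
  "star_connected U n A \<longleftrightarrow>
     A \<subseteq> verts U n \<and>
     (\<forall>a\<in>A. \<forall>b\<in>A. (\<lambda>x y. x \<in> A \<and> y \<in> A \<and> star_adj U n x y)\<^sup>*\<^sup>* a b)"

definition outer_boundary :: "complex set \<Rightarrow> nat \<Rightarrow> complex set \<Rightarrow> complex set" where
  "outer_boundary U n A = {x \<in> verts U n - A. \<exists>y\<in>A. adj U n x y}"

section \<open>The continuous-time simple random walk\<close>

text \<open>An isolated vertex is given itself as its only target. This convention only makes the walk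
  well defined for small \<open>n\<close>; it is void as soon as the graph is connected with at least two
  vertices.\<close>

definition targets :: "complex set \<Rightarrow> nat \<Rightarrow> complex \<Rightarrow> complex set" where
  "targets U n v = (if \<exists>w. adj U n v w then {w. adj U n v w} else {v})"

text \<open>Canonical construction. A sample point \<open>\<omega>\<close> consists of arrows \<open>fst \<omega> (k, v)\<close>, independent and
  uniform on the neighbours of \<open>v\<close>, followed at step \<open>k\<close> if the walk then sits at \<open>v\<close>, and of
  independent holding times \<open>snd \<omega> k\<close>, exponential of rate \<open>2 n\<^sup>2\<close>, that is, of mean \<open>1 / (2 n\<^sup>2)\<close>.
  All starting points share this probability space: the law from \<open>x\<close> is that of the process
  \<open>walk x\<close>.\<close>

definition walk_space :: "complex set \<Rightarrow> nat \<Rightarrow> ((nat \<times> complex \<Rightarrow> complex) \<times> (nat \<Rightarrow> real)) measure" where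
  "walk_space U n =
     (\<Pi>\<^sub>M p\<in>UNIV \<times> verts U n. uniform_count_measure (targets U n (snd p))) \<Otimes>\<^sub>M
     (\<Pi>\<^sub>M k\<in>UNIV. density lborel (exponential_density (2 * (of_nat n)\<^sup>2)))"

primrec jump_chain ::
    "complex \<Rightarrow> nat \<Rightarrow> (nat \<times> complex \<Rightarrow> complex) \<times> (nat \<Rightarrow> real) \<Rightarrow> complex" where
  "jump_chain x 0 \<omega> = x"
| "jump_chain x (Suc k) \<omega> = fst \<omega> (k, jump_chain x k \<omega>)"

definition jump_time :: "nat \<Rightarrow> (nat \<times> complex \<Rightarrow> complex) \<times> (nat \<Rightarrow> real) \<Rightarrow> real" where
  "jump_time k \<omega> = (\<Sum>i<k. snd \<omega> i)"

text \<open>The jump times tend to infinity almost surely, so that the index below exists for every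
  \<open>t \<ge> 0\<close>.\<close>

definition walk ::
    "complex \<Rightarrow> real \<Rightarrow> (nat \<times> complex \<Rightarrow> complex) \<times> (nat \<Rightarrow> real) \<Rightarrow> complex" where
  "walk x t \<omega> = jump_chain x (LEAST k. t < jump_time (Suc k) \<omega>) \<omega>"

definition hitting_time ::
    "complex \<Rightarrow> complex set \<Rightarrow> (nat \<times> complex \<Rightarrow> complex) \<times> (nat \<Rightarrow> real) \<Rightarrow> ereal" where
  "hitting_time x S \<omega> = Inf {ereal t | t. t \<ge> 0 \<and> walk x t \<omega> \<in> S}"

definition hit_before_prob :: "complex set \<Rightarrow> nat \<Rightarrow> complex \<Rightarrow> complex set \<Rightarrow> complex set \<Rightarrow> ennreal" where
  "hit_before_prob U n x S A =
     emeasure (walk_space U n)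
       {\<omega> \<in> space (walk_space U n). hitting_time x S \<omega> \<le> hitting_time x A \<omega>}"

text \<open>Since \<^const>\<open>emeasure\<close> is zero on non-measurable sets, we check that the underlying measure is
  a probability measure and that the event is measurable.\<close>

lemma countable_verts: "countable (verts U n)"
proof -
  have "grid n = (\<lambda>(i, j). Complex (of_int i / of_nat n) (of_int j / of_nat n)) ` UNIV"
    unfolding grid_def by auto
  then have "countable (grid n)" by (metis countable_image countableI_type)
  then show ?thesis unfolding verts_def by blast
qed

lemma targets_subset: "v \<in> verts U n \<Longrightarrow> targets U n v \<subseteq> verts U n"
  by (auto simp: targets_def adj_def)

lemma finite_targets:
  assumes "n > 0"
  shows "finite (targets U n v)"
proof -
  have sq: "a\<^sup>2 + b\<^sup>2 = 1 \<Longrightarrow> a = -1 \<or> a = 0 \<or> a = 1 \<Longrightarrow> b = -1 \<or> b = 0 \<or> b = 1 \<Longrightarrow>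
      (a = -1 \<and> b = 0) \<or> (a = 1 \<and> b = 0) \<or> (a = 0 \<and> b = -1) \<or> (a = 0 \<and> b = 1)" for a b :: int
    by auto
  have "{w. adj U n v w} \<subseteq>
      {v + of_real (1/n), v - of_real (1/n), v + \<i> * of_real (1/n), v - \<i> * of_real (1/n)}"
  proof
    fix w assume "w \<in> {w. adj U n v w}"
    then have vw: "v \<in> grid n" "w \<in> grid n" "dist v w = 1 / n"
      by (auto simp: adj_def verts_def)
    then obtain i j k l where v: "v = Complex (of_int i / n) (of_int j / n)"
      and w: "w = Complex (of_int k / n) (of_int l / n)"
      unfolding grid_def by auto
    have "(dist v w)\<^sup>2 = ((of_int i - of_int k) / n)\<^sup>2 + ((of_int j - of_int l) / n)\<^sup>2"
      by (simp add: v w dist_norm cmod_power2 diff_divide_distrib)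
    then have "((of_int i - of_int k))\<^sup>2 + ((of_int j - of_int l))\<^sup>2 = (1::real)"
      using vw(3) assms by (simp add: power_divide field_simps)
    then have "real_of_int ((i - k)\<^sup>2 + (j - l)\<^sup>2) = 1" by simp
    then have e: "(i - k)\<^sup>2 + (j - l)\<^sup>2 = 1" by linarith
    have "(i - k)\<^sup>2 \<le> 1" "(j - l)\<^sup>2 \<le> 1"
      using e zero_le_power2[of "i - k"] zero_le_power2[of "j - l"] by linarith+
    then have "\<bar>i - k\<bar> \<le> 1" "\<bar>j - l\<bar> \<le> 1"
      using abs_square_le_1 by blast+
    then have "i - k = -1 \<or> i - k = 0 \<or> i - k = 1" "j - l = -1 \<or> j - l = 0 \<or> j - l = 1"
      by linarith+
    then have "(i - k = -1 \<and> j - l = 0) \<or> (i - k = 1 \<and> j - l = 0) \<or>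
        (i - k = 0 \<and> j - l = -1) \<or> (i - k = 0 \<and> j - l = 1)"
      using sq[OF e] by blast
    then have "(k = i + 1 \<and> l = j) \<or> (k = i - 1 \<and> l = j) \<or> (k = i \<and> l = j + 1) \<or> (k = i \<and> l = j - 1)"
      by (elim disjE) linarith+
    then show "w \<in> {v + of_real (1/n), v - of_real (1/n), v + \<i> * of_real (1/n), v - \<i> * of_real (1/n)}"
      by (elim disjE) (simp_all add: v w complex_eq_iff add_divide_distrib diff_divide_distrib)
  qed
  then have "finite {w. adj U n v w}" by (rule finite_subset) simp
  then show ?thesis by (simp add: targets_def)
qed

lemma prob_space_walk_space:
  assumes "n > 0"
  shows "prob_space (walk_space U n)"
  unfolding walk_space_def
proof (intro prob_space_pair prob_space_PiM prob_space_uniform_count_measure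
    prob_space_exponential_density)
  show "targets U n v \<noteq> {}" for v by (auto simp: targets_def)
qed (use assms finite_targets in auto)

lemma measurable_jump_chain:
  assumes "x \<in> verts U n"
  shows "jump_chain x k \<in> measurable (walk_space U n) (count_space (verts U n))"
proof (induction k)
  case 0
  then show ?case using assms by simp
next
  case (Suc k)
  have "(\<lambda>\<omega>. fst \<omega> (k, v)) \<in> measurable (walk_space U n) (count_space (verts U n))"
    if v: "v \<in> verts U n" for v
  proof -
    have "(\<lambda>\<omega>. fst \<omega> (k, v)) \<in> measurable (walk_space U n) (uniform_count_measure (targets U n v))"
      unfolding walk_space_def
      using measurable_component_singleton[of "(k, v)" "UNIV \<times> verts U n"
          "\<lambda>p. uniform_count_measure (targets U n (snd p))"] v
      by (auto intro: measurable_compose[OF measurable_fst])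
    moreover have "(\<lambda>w. w) \<in> measurable (uniform_count_measure (targets U n v)) (count_space (verts U n))"
      using targets_subset[OF v]
      by (auto simp: measurable_def sets_uniform_count_measure space_uniform_count_measure)
    ultimately show ?thesis by (rule measurable_compose)
  qed
  from measurable_compose_countable'[OF this Suc countable_verts]
  show ?case by simp
qed

lemma measurable_jump_time [measurable]: "jump_time k \<in> borel_measurable (walk_space U n)"
proof -
  have "(\<lambda>\<omega>. snd \<omega> i) \<in> borel_measurable (walk_space U n)" for i
  proof -
    have "(\<lambda>f. f i) \<in> measurable
        (\<Pi>\<^sub>M k\<in>UNIV. density lborel (exponential_density (2 * (of_nat n)\<^sup>2))) borel"
      using measurable_component_singleton[of i UNIV
          "\<lambda>_. density lborel (exponential_density (2 * (of_nat n)\<^sup>2))"]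
      by (simp cong: measurable_cong_sets)
    then show ?thesis
      unfolding walk_space_def by (rule measurable_compose[OF measurable_snd])
  qed
  then show ?thesis unfolding jump_time_def[abs_def] by measurable
qed

lemma walk_right_constant: "\<exists>e>0. \<forall>s. t \<le> s \<and> s < t + e \<longrightarrow> walk x s \<omega> = walk x t \<omega>"
proof (cases "\<exists>k. t < jump_time (Suc k) \<omega>")
  case True
  define k where "k = (LEAST k. t < jump_time (Suc k) \<omega>)"
  have k: "t < jump_time (Suc k) \<omega>" using True unfolding k_def by (rule LeastI_ex)
  have "walk x s \<omega> = walk x t \<omega>" if "t \<le> s \<and> s < t + (jump_time (Suc k) \<omega> - t)" for s
  proof -
    have s: "t \<le> s" "s < jump_time (Suc k) \<omega>" using that by simp_all
    have "(LEAST k. s < jump_time (Suc k) \<omega>) = k"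
    proof (rule Least_equality)
      fix j assume "s < jump_time (Suc j) \<omega>"
      then have "t < jump_time (Suc j) \<omega>" using s by simp
      then show "k \<le> j" unfolding k_def by (rule Least_le)
    qed (rule s)
    then show ?thesis unfolding walk_def k_def by simp
  qed
  then have "\<forall>s. t \<le> s \<and> s < t + (jump_time (Suc k) \<omega> - t) \<longrightarrow> walk x s \<omega> = walk x t \<omega>"
    by blast
  moreover have "jump_time (Suc k) \<omega> - t > 0" using k by simp
  ultimately show ?thesis by blast
next
  case False
  have "walk x s \<omega> = walk x t \<omega>" if "t \<le> s" for s
  proof -
    have "(\<lambda>k. s < jump_time (Suc k) \<omega>) = (\<lambda>k. t < jump_time (Suc k) \<omega>)"
      using False order_le_less_trans[OF that] by (intro ext) blast
    then show ?thesis by (simp only: walk_def)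
  qed
  then have "\<forall>s. t \<le> s \<and> s < t + 1 \<longrightarrow> walk x s \<omega> = walk x t \<omega>" by blast
  then show ?thesis using zero_less_one by blast
qed

lemma hitting_time_rational:
  "hitting_time x S \<omega> = (INF q::rat. if 0 \<le> q \<and> walk x (of_rat q) \<omega> \<in> S then ereal (of_rat q) else \<infinity>)"
  (is "_ = (INF q. ?f q)")
proof (rule antisym)
  show "hitting_time x S \<omega> \<le> (INF q. ?f q)"
    unfolding hitting_time_def by (rule INF_greatest) (auto intro!: Inf_lower)
  show "(INF q. ?f q) \<le> hitting_time x S \<omega>"
    unfolding hitting_time_def
  proof (rule Inf_greatest, clarify)
    fix t :: real assume t: "0 \<le> t" "walk x t \<omega> \<in> S"
    obtain e where e: "e > 0" "\<And>s. t \<le> s \<and> s < t + e \<Longrightarrow> walk x s \<omega> = walk x t \<omega>"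
      using walk_right_constant by blast
    show "(INF q. ?f q) \<le> ereal t"
    proof (rule ereal_le_epsilon2)
      fix d :: real assume "0 < d"
      then obtain q where q: "t < of_rat q" "of_rat q < t + min d e"
        using of_rat_dense[of t "t + min d e"] e(1) by auto
      have "(0::real) < of_rat q" using t(1) q(1) by (rule order_le_less_trans)
      then have "0 \<le> q" by simp
      moreover have "walk x (of_rat q) \<omega> \<in> S" using e(2)[of "of_rat q"] q t(2) by auto
      ultimately have f: "?f q = ereal (of_rat q)" by simp
      have "(INF q. ?f q) \<le> ?f q" by (rule INF_lower) simp
      also have "\<dots> \<le> ereal t + ereal d" unfolding f using q(2) by simp
      finally show "(INF q. ?f q) \<le> ereal t + ereal d" .
    qed
  qed
qed

lemma measurable_walk:
  assumes "x \<in> verts U n"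
  shows "walk x t \<in> measurable (walk_space U n) (count_space (verts U n))"
proof -
  have "{\<omega> \<in> space (walk_space U n). t < jump_time (Suc k) \<omega>} \<in> sets (walk_space U n)" for k
    by (rule borel_measurable_less[OF measurable_const measurable_jump_time]) simp
  then have P: "Measurable.pred (walk_space U n) (\<lambda>\<omega>. t < jump_time (Suc k) \<omega>)" for k
    by (simp only: pred_def)
  have L: "(\<lambda>\<omega>. LEAST k. t < jump_time (Suc k) \<omega>) \<in> measurable (walk_space U n) (count_space UNIV)"
    by (rule measurable_Least) (rule P)
  have "(\<lambda>\<omega>. jump_chain x (LEAST k. t < jump_time (Suc k) \<omega>) \<omega>)
      \<in> measurable (walk_space U n) (count_space (verts U n))"
    by (rule measurable_compose_countable'[where I = UNIV and f = "jump_chain x"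
        and g = "\<lambda>\<omega>. LEAST k. t < jump_time (Suc k) \<omega>", OF _ L])
      (use measurable_jump_chain[OF assms] in simp_all)
  also have "(\<lambda>\<omega>. jump_chain x (LEAST k. t < jump_time (Suc k) \<omega>) \<omega>) = walk x t"
    by (rule ext) (simp only: walk_def)
  finally show ?thesis .
qed

lemma measurable_hitting_time:
  assumes "x \<in> verts U n"
  shows "hitting_time x S \<in> borel_measurable (walk_space U n)"
proof -
  have [measurable]: "Measurable.pred (walk_space U n) (\<lambda>\<omega>. walk x t \<omega> \<in> S)" for t
    by (rule measurable_compose[OF measurable_walk[OF assms]]) simp
  show ?thesis unfolding hitting_time_rational[abs_def] by measurable
qed

lemma sets_hit_before:
  assumes "x \<in> verts U n"
  shows "{\<omega> \<in> space (walk_space U n). hitting_time x S \<omega> \<le> hitting_time x A \<omega>} \<in> sets (walk_space U n)"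
  using measurable_hitting_time[OF assms, of S] measurable_hitting_time[OF assms, of A] by measurable

end

theory Submission
  imports Defs "HOL-Complex_Analysis.Complex_Analysis"
begin

text \<open>Let \<open>h\<close> be the decreasing limit, as \<open>k \<rightarrow> \<infinity>\<close>, of the probabilities that the walk, stopped on \<open>A\<close> and on the blob,
  is not in \<open>A\<close> after \<open>k\<close> steps. It dominates the probability in question, vanishes on \<open>A\<close> and is
  harmonic off \<open>A\<close> and the blob; the reflection at the boundary is the natural boundary condition of
  the Dirichlet energy. Its energy \<open>E r\<close> in the disc of radius \<open>r\<close> about \<open>x \<sim> A\<close> (radii in lattice units)
  decays by hole filling. As \<open>A\<close> meets every circle of radius between \<open>r\<close> and \<open>2 r\<close> and \<open>h = 0\<close> there,
  Cauchy--Schwarz along a circle of small energy bounds \<open>h\<^sup>2\<close> on it, and by the maximum principle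
  inside, by a multiple of \<open>E (2 r) - E r\<close>. Caccioppoli's inequality then gives
  \<open>E (r / 4) \<le> C (E (2 r) - E r)\<close>, hence \<open>E r \<le> \<theta> E (8 r)\<close> with \<open>\<theta> < 1\<close>, so that the energy of the edges
  at \<open>x\<close>, one of which ends in \<open>A\<close>, is bounded by a constant times a negative power of \<open>n\<close>.

  Circles are taken in charts mapping \<open>U\<close> near \<open>x\<close> to the unit disc: there each of them meets the disc
  in an arc, and moving along the arc towards the origin only increases the distance to the unit
  circle, so that the arc can be followed by a lattice walk inside \<open>U\<close>.\<close>

section \<open>Walks and energy\<close>

text \<open>The obstacle is the boundary of \<open>U\<close>: \<open>A\<close> may run along it, and
  there the deleted edges leave an irregular graph. The energy copes with this, since deleting an
  edge merely removes a term. What geometry must supply is that the levels of \<rho> are connected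
  by walks of length \<open>O(s)\<close> in bands of bounded width; charts with constants uniform
  over \<open>U\<close> give it, after a bounded number of lattice steps away from the boundary.
  Two-dimensionality enters as scale invariance: a disc of radius \<open>r\<close> has
  \<open>O(r\<^sup>2)\<close> edges while a cutoff has squared slope
  \<open>O(1 / r\<^sup>2)\<close>, and a level has length \<open>O(r)\<close> while the best of
  about \<open>r\<close> levels carries a share \<open>O(1 / r)\<close> of the annulus energy. The
  factors cancel, so one \<theta> serves at all scales. About \<open>log 8 n\<close> scales lie
  between a constant and a multiple of \<open>n\<close>, and passing from the energy to
  \<open>h\<close> costs a square root; hence the exponent
  \<open>\<beta> = - log 8 \<theta> / 2\<close>.\<close>

definition reach :: "('a \<times> 'a) set \<Rightarrow> 'a set \<Rightarrow> nat \<Rightarrow> 'a \<Rightarrow> 'a \<Rightarrow> bool" where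
  "reach P V N u v \<longleftrightarrow> (\<exists>k\<le>N. (u, v) \<in> (P \<inter> V \<times> V) ^^ k)"

lemma reach_refl: "reach P V N u u"
  unfolding reach_def by (intro exI[of _ 0]) auto

lemma reach_edge: "(u, v) \<in> P \<Longrightarrow> u \<in> V \<Longrightarrow> v \<in> V \<Longrightarrow> reach P V 1 u v"
  unfolding reach_def by (intro exI[of _ 1]) auto

lemma reach_trans: "reach P V N u v \<Longrightarrow> reach P V M v w \<Longrightarrow> reach P V (N + M) u w"
  unfolding reach_def by (metis add_mono relpow_trans)

lemma reach_mono: "reach P V N u v \<Longrightarrow> V \<subseteq> V' \<Longrightarrow> N \<le> N' \<Longrightarrow> reach P V' N' u v"
proof -
  assume a: "reach P V N u v" "V \<subseteq> V'" "N \<le> N'"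
  then obtain k where k: "k \<le> N" "(u, v) \<in> (P \<inter> V \<times> V) ^^ k"
    unfolding reach_def by blast
  have "P \<inter> V \<times> V \<subseteq> P \<inter> V' \<times> V'" using a(2) by blast
  then have "(P \<inter> V \<times> V) ^^ k \<subseteq> (P \<inter> V' \<times> V') ^^ k"
  proof (induction k)
    case (Suc k)
    then show ?case by (simp add: relcomp_mono)
  qed simp
  then show ?thesis unfolding reach_def using k a(3) by (meson le_trans subsetD)
qed

lemma reach_sym:
  assumes "sym P" "reach P V N u v"
  shows "reach P V N v u"
proof -
  obtain k where k: "k \<le> N" "(u, v) \<in> (P \<inter> V \<times> V) ^^ k"
    using assms unfolding reach_def by blast
  have "(v, u) \<in> (P \<inter> V \<times> V) ^^ k"
    using k(2)
  proof (induction k arbitrary: v)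
    case (Suc k)
    then obtain w where "(u, w) \<in> (P \<inter> V \<times> V) ^^ k" "(w, v) \<in> P \<inter> V \<times> V" by auto
    moreover have "(v, w) \<in> P \<inter> V \<times> V" using calculation(2) symD[OF assms(1), of w v] by blast
    ultimately show ?case using Suc.IH relpow_Suc_I2 by metis
  qed simp
  then show ?thesis unfolding reach_def using k(1) by blast
qed

text \<open>Ordered pairs are summed, so for symmetric \<open>P\<close> each undirected edge counts
  twice. Only pairs with both ends in \<open>V\<close> count, so disjoint vertex sets contribute
  disjoint sets of terms.\<close>

definition energy :: "('a \<times> 'a) set \<Rightarrow> ('a \<Rightarrow> real) \<Rightarrow> 'a set \<Rightarrow> real" where
  "energy P h V = (\<Sum>(x, y)\<in>P \<inter> V \<times> V. (h x - h y)\<^sup>2)"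

lemma energy_nonneg: "energy P h V \<ge> 0"
  unfolding energy_def by (intro sum_nonneg) auto

text \<open>A shortest walk is injective, so Cauchy--Schwarz along it sees every edge at most once.\<close>

lemma diff_square_le_energy:
  assumes "finite P" "reach P V N u v"
  shows "(h u - h v)\<^sup>2 \<le> real N * energy P h V"
proof -
  define Q where "Q = P \<inter> V \<times> V"
  have finQ: "finite Q" unfolding Q_def using assms(1) by auto
  define k where "k = (LEAST k. (u, v) \<in> Q ^^ k)"
  obtain k0 where k0: "k0 \<le> N" "(u, v) \<in> Q ^^ k0"
    using assms(2) unfolding reach_def Q_def by blast
  have uvk: "(u, v) \<in> Q ^^ k" unfolding k_def using k0(2) by (rule LeastI)
  have "k \<le> k0" unfolding k_def using k0(2) by (rule Least_le)
  then have kN: "k \<le> N" using k0(1) by simp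
  have least: "(u, v) \<in> Q ^^ j \<Longrightarrow> k \<le> j" for j unfolding k_def by (rule Least_le)
  obtain f where f: "f 0 = u" "f k = v" "\<And>i. i < k \<Longrightarrow> (f i, f (Suc i)) \<in> Q"
    using uvk unfolding relpow_fun_conv by blast
  have seg: "(f i, f (i + d)) \<in> Q ^^ d" if "i + d \<le> k" for i d
    using that
  proof (induction d)
    case (Suc d)
    then have "(f i, f (i + d)) \<in> Q ^^ d" by simp
    moreover have "(f (i + d), f (Suc (i + d))) \<in> Q" using f(3)[of "i + d"] Suc.prems by simp
    ultimately show ?case by (metis add_Suc_right relpow_Suc_I)
  qed simp
  have ne: "f i \<noteq> f j" if ij: "i < j" "j \<le> k" for i j
  proof
    assume e: "f i = f j"
    have "(u, f i) \<in> Q ^^ i" using seg[of 0 i] f(1) ij by simp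
    moreover have "(f j, v) \<in> Q ^^ (k - j)" using seg[of j "k - j"] f(2) ij by simp
    ultimately have "(u, v) \<in> Q ^^ (i + (k - j))" using e by (metis relpow_trans)
    then have "k \<le> i + (k - j)" by (rule least)
    then show False using ij by simp
  qed
  have inj: "inj_on (\<lambda>i. (f i, f (Suc i))) {..<k}"
  proof (rule inj_onI)
    fix i j assume a: "i \<in> {..<k}" "j \<in> {..<k}" "(f i, f (Suc i)) = (f j, f (Suc j))"
    then show "i = j" using ne[of i j] ne[of j i] by (cases i j rule: linorder_cases) auto
  qed
  have tel: "h u - h v = (\<Sum>i<k. h (f i) - h (f (Suc i)))"
    using sum_lessThan_telescope'[of "\<lambda>i. h (f i)" k] f(1,2) by simp
  have "(h u - h v)\<^sup>2 \<le> real k * (\<Sum>i<k. (h (f i) - h (f (Suc i)))\<^sup>2)"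
  proof -
    have "(\<Sum>i<k. 1 * (h (f i) - h (f (Suc i))))\<^sup>2 \<le>
        (\<Sum>i<k. 1\<^sup>2) * (\<Sum>i<k. (h (f i) - h (f (Suc i)))\<^sup>2)"
      by (rule Cauchy_Schwarz_ineq_sum)
    then show ?thesis by (simp add: tel)
  qed
  also have "(\<Sum>i<k. (h (f i) - h (f (Suc i)))\<^sup>2) =
      (\<Sum>(x, y)\<in>(\<lambda>i. (f i, f (Suc i))) ` {..<k}. (h x - h y)\<^sup>2)"
    by (simp add: sum.reindex[OF inj])
  also have "real k * \<dots> \<le> real k * energy P h V"
  proof (intro mult_left_mono)
    show "(\<Sum>(x, y)\<in>(\<lambda>i. (f i, f (Suc i))) ` {..<k}. (h x - h y)\<^sup>2) \<le> energy P h V"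
      unfolding energy_def Q_def[symmetric]
      by (intro sum_mono2 finQ) (use f(3) in auto)
  qed simp
  also have "\<dots> \<le> real N * energy P h V"
    using kN by (intro mult_right_mono energy_nonneg) simp
  finally show ?thesis .
qed

text \<open>An edge with both ends in \<open>V i\<close> counts in the energy of \<open>B\<close>
  but not in that of \<open>B'\<close>, and it belongs to only one \<open>i\<close>.\<close>

lemma sum_energy_disjoint_le:
  assumes "finite P" "finite I" "\<And>i. i \<in> I \<Longrightarrow> V i \<subseteq> B - B'" "B' \<subseteq> B"
    and disj: "\<And>i j. i \<in> I \<Longrightarrow> j \<in> I \<Longrightarrow> i \<noteq> j \<Longrightarrow> V i \<inter> V j = {}"
  shows "(\<Sum>i\<in>I. energy P h (V i)) \<le> energy P h B - energy P h B'"
proof -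
  let ?f = "\<lambda>(x, y). (h x - h y)\<^sup>2"
  have "(\<Sum>i\<in>I. energy P h (V i)) = sum ?f (\<Union>i\<in>I. P \<inter> V i \<times> V i)"
    unfolding energy_def by (rule sum.UNION_disjoint[symmetric]) (use assms disj in blast)+
  also have "\<dots> \<le> sum ?f (P \<inter> B \<times> B - P \<inter> B' \<times> B')"
    by (rule sum_mono2) (use assms in auto)
  also have "\<dots> = energy P h B - energy P h B'"
    unfolding energy_def by (rule sum_diff) (use assms in auto)
  finally show ?thesis .
qed

section \<open>Decay of the energy of a harmonic function at a macroscopic zero set\<close>

text \<open>With \<open>q = 192 * K^6\<close> this is \<open>q / (1 + q)\<close>, the factor that
  hole filling draws from \<open>E r \<le> q * (E (8 * r) - E r)\<close>. Here \<open>q\<close> is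
  the product of the constants \<open>16 * K^4\<close> of Caccioppoli's inequality and
  \<open>12 * K\<^sup>2\<close> of the sup bound.\<close>

definition decay_factor :: "real \<Rightarrow> real" where
  "decay_factor K = 192 * K^6 / (1 + 192 * K^6)"

text \<open>\<open>\<rho>\<close> is a distance to the centre, in lattice units. No planar topology enters: it is enough that
  \<open>A\<close> meets every level of \<open>\<rho>\<close>, and that a level is connected by walks of length comparable to its
  radius inside a band of bounded width.\<close>

locale harmonic_zero =
  fixes X :: "'a set" and P :: "('a \<times> 'a) set" and \<rho> h :: "'a \<Rightarrow> real" and A :: "'a set"
    and K b R :: real
  assumes finX: "finite X" and PX: "P \<subseteq> X \<times> X" and symP: "sym P"
    and Kb: "1 \<le> b" "b \<le> K"
    and degree: "x \<in> X \<Longrightarrow> real (card (P `` {x})) \<le> K"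
    and rho_step: "(x, y) \<in> P \<Longrightarrow> \<rho> x \<le> R \<Longrightarrow> \<bar>\<rho> x - \<rho> y\<bar> \<le> b"
    and volume: "1 \<le> r \<Longrightarrow> r \<le> R \<Longrightarrow> real (card {x\<in>X. \<rho> x \<le> r}) \<le> K * r\<^sup>2"
    and level: "1 \<le> s \<Longrightarrow> s \<le> R \<Longrightarrow> u \<in> X \<Longrightarrow> v \<in> X \<Longrightarrow> \<bar>\<rho> u - s\<bar> \<le> b \<Longrightarrow> \<bar>\<rho> v - s\<bar> \<le> b \<Longrightarrow>
      \<exists>N. real N \<le> K * s \<and> reach P {x\<in>X. \<bar>\<rho> x - s\<bar> \<le> K} N u v"
    and AX: "A \<subseteq> X"
    and crossing: "K \<le> s \<Longrightarrow> s \<le> R \<Longrightarrow> \<exists>a\<in>A. \<bar>\<rho> a - s\<bar> \<le> b"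
    and h01: "x \<in> X \<Longrightarrow> 0 \<le> h x" "x \<in> X \<Longrightarrow> h x \<le> 1"
    and hA: "x \<in> A \<Longrightarrow> h x = 0"
    and harmonic: "x \<in> X \<Longrightarrow> x \<notin> A \<Longrightarrow> \<rho> x \<le> R \<Longrightarrow> (\<Sum>y\<in>P `` {x}. h x - h y) = 0"
    and connected: "x \<in> X \<Longrightarrow> h x \<noteq> 0 \<Longrightarrow> \<exists>a\<in>A. (x, a) \<in> P\<^sup>*"
begin

section \<open>Test functions, Caccioppoli's inequality and the sup bound\<close>

lemma finP: "finite P"
  using finite_subset[OF PX] finX by blast

abbreviation disc :: "real \<Rightarrow> 'a set" where
  "disc r \<equiv> {x\<in>X. \<rho> x \<le> r}"

abbreviation E :: "real \<Rightarrow> real" where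
  "E r \<equiv> energy P h (disc r)"

text \<open>Summation by parts: by symmetry of \<open>P\<close> both halves of the sum equal the sum
  of \<open>g x\<close> times the Laplacian of \<open>h\<close> at \<open>x\<close>, and at each
  \<open>x\<close> one of these two factors vanishes.\<close>

lemma energy_test:
  assumes g: "\<And>x. x \<in> X \<Longrightarrow> x \<in> A \<or> \<rho> x > R \<Longrightarrow> g x = 0"
  shows "(\<Sum>(x, y)\<in>P. (h x - h y) * (g x - g y)) = 0"
proof -
  have P: "P = Sigma X (\<lambda>x. P `` {x})" using PX by auto
  have fin: "finite (P `` {x})" for x using finP by (rule finite_Image)
  have "(\<Sum>(x, y)\<in>P. (h x - h y) * g x) = (\<Sum>x\<in>X. \<Sum>y\<in>P `` {x}. (h x - h y) * g x)"
    by (subst P, subst sum.Sigma) (use finX fin in auto)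
  also have "\<dots> = (\<Sum>x\<in>X. (\<Sum>y\<in>P `` {x}. h x - h y) * g x)"
    by (simp add: sum_distrib_right)
  also have "\<dots> = 0"
  proof (rule sum.neutral, safe)
    fix x assume x: "x \<in> X"
    show "(\<Sum>y\<in>P `` {x}. h x - h y) * g x = 0"
      using g[OF x] harmonic[OF x] by (cases "x \<in> A \<or> \<rho> x > R") auto
  qed
  finally have 1: "(\<Sum>(x, y)\<in>P. (h x - h y) * g x) = 0" .
  have "bij_betw prod.swap P P"
  proof (rule bij_betwI[of _ _ _ prod.swap])
    have "prod.swap z \<in> P" if "z \<in> P" for z
      using that symD[OF symP, of "fst z" "snd z"] by (cases z) simp
    then show "prod.swap \<in> P \<rightarrow> P" "prod.swap \<in> P \<rightarrow> P" by blast+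
  qed simp_all
  then have "(\<Sum>(x, y)\<in>P. (h y - h x) * g y) = (\<Sum>(x, y)\<in>P. (h x - h y) * g x)"
    using sum.reindex_bij_betw[of prod.swap P P "\<lambda>(x, y). (h x - h y) * g x"]
    by (simp add: case_prod_unfold)
  then have 2: "(\<Sum>(x, y)\<in>P. (h y - h x) * g y) = 0" using 1 by simp
  have "(\<Sum>(x, y)\<in>P. (h x - h y) * (g x - g y)) =
      (\<Sum>(x, y)\<in>P. (h x - h y) * g x) + (\<Sum>(x, y)\<in>P. (h y - h x) * g y)"
    by (simp add: sum.distrib[symmetric] case_prod_unfold algebra_simps)
  then show ?thesis using 1 2 by simp
qed

lemma card_pairs_le:
  assumes "1 \<le> r" "r \<le> R"
  shows "real (card (P \<inter> disc r \<times> disc r)) \<le> K\<^sup>2 * r\<^sup>2"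
proof -
  have "P \<inter> disc r \<times> disc r \<subseteq> Sigma (disc r) (\<lambda>x. P `` {x})" by auto
  then have "card (P \<inter> disc r \<times> disc r) \<le> card (Sigma (disc r) (\<lambda>x. P `` {x}))"
    by (intro card_mono finite_SigmaI) (use finX finP in auto)
  also have "\<dots> = (\<Sum>x\<in>disc r. card (P `` {x}))"
    using finX finP by (subst card_SigmaI) auto
  finally have "real (card (P \<inter> disc r \<times> disc r)) \<le> real (\<Sum>x\<in>disc r. card (P `` {x}))"
    unfolding of_nat_le_iff .
  also have "\<dots> = (\<Sum>x\<in>disc r. real (card (P `` {x})))" by (rule of_nat_sum)
  also have "\<dots> \<le> (\<Sum>x\<in>disc r. K)" by (rule sum_mono) (use degree in auto)
  also have "\<dots> = real (card (disc r)) * K" by simp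
  also have "\<dots> \<le> (K * r\<^sup>2) * K"
    using volume[OF assms] Kb by (intro mult_right_mono) auto
  finally show ?thesis by (simp add: power2_eq_square algebra_simps)
qed

text \<open>Test harmonicity with \<open>\<eta>\<^sup>2 h\<close> for a cutoff \<open>\<eta>\<close> and use
  \<open>(a - b) (p\<^sup>2 a - q\<^sup>2 b) = (p a - q b)\<^sup>2 - a b (p - q)\<^sup>2\<close>.\<close>

lemma caccioppoli:
  assumes r: "4 * K \<le> r" "r \<le> R" and M: "\<And>x. x \<in> disc r \<Longrightarrow> h x \<le> M" "0 \<le> M"
  shows "E (r / 4) \<le> 16 * K^4 * M\<^sup>2"
proof -
  have r0: "r > 0" using r Kb by linarith
  \<comment> \<open>Cutoff equal to 1 up to radius \<open>r / 4\<close> and to 0 from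
    \<open>r / 2\<close> on, of slope \<open>4 / r\<close>. The gap between \<open>r / 2\<close> and
    \<open>r\<close> exceeds the step \<open>b\<close>, so edges that leave \<open>disc r\<close>
    see only zeros.\<close>
  define \<eta> where "\<eta> x = max 0 (min 1 ((r / 2 - \<rho> x) * (4 / r)))" for x
  have eta0: "\<eta> x = 0" if "\<rho> x \<ge> r / 2" for x
  proof -
    have "(r / 2 - \<rho> x) * (4 / r) \<le> 0" using that r0 by (intro mult_nonpos_nonneg) auto
    then show ?thesis unfolding \<eta>_def by simp
  qed
  have eta1: "\<eta> x = 1" if "\<rho> x \<le> r / 4" for x
  proof -
    have "r / 4 * (4 / r) \<le> (r / 2 - \<rho> x) * (4 / r)"
      using that r0 by (intro mult_right_mono) auto
    then have "1 \<le> (r / 2 - \<rho> x) * (4 / r)" using r0 by simp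
    then show ?thesis unfolding \<eta>_def by simp
  qed
  have clamp: "\<bar>max 0 (min 1 a) - max 0 (min 1 b)\<bar> \<le> \<bar>a - b\<bar>" for a b :: real by linarith
  have lip: "\<bar>\<eta> x - \<eta> y\<bar> \<le> \<bar>\<rho> x - \<rho> y\<bar> * (4 / r)" for x y
  proof -
    have "\<bar>\<eta> x - \<eta> y\<bar> \<le> \<bar>(r / 2 - \<rho> x) * (4 / r) - (r / 2 - \<rho> y) * (4 / r)\<bar>"
      unfolding \<eta>_def by (rule clamp)
    also have "(r / 2 - \<rho> x) * (4 / r) - (r / 2 - \<rho> y) * (4 / r) = (\<rho> y - \<rho> x) * (4 / r)"
      unfolding left_diff_distrib by simp
    also have "\<bar>\<dots>\<bar> = \<bar>\<rho> x - \<rho> y\<bar> * (4 / r)"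
      using r0 unfolding abs_mult by (simp add: abs_minus_commute)
    finally show ?thesis .
  qed
  let ?D = "P \<inter> disc r \<times> disc r"
  have supp: "\<eta> x = 0 \<and> \<eta> y = 0" if "(x, y) \<in> P - ?D" for x y
  proof -
    have xy: "(x, y) \<in> P" "(y, x) \<in> P" "x \<in> X" "y \<in> X" "\<rho> x > r \<or> \<rho> y > r"
      using that PX symD[OF symP, of x y] by auto
    have "\<rho> x \<ge> r / 2" "\<rho> y \<ge> r / 2"
      using rho_step[OF xy(1)] rho_step[OF xy(2)] xy(5) r Kb r0 by linarith+
    then show ?thesis using eta0 by blast
  qed
  have lip2: "(\<eta> x - \<eta> y)\<^sup>2 \<le> (4 * K / r)\<^sup>2" if "(x, y) \<in> ?D" for x y
  proof -
    have "\<bar>\<rho> x - \<rho> y\<bar> \<le> K" using rho_step[of x y] that r Kb by simp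
    then have "\<bar>\<rho> x - \<rho> y\<bar> * (4 / r) \<le> K * (4 / r)" using r0 by (intro mult_right_mono) auto
    also have "\<dots> = 4 * K / r" by simp
    finally have "\<bar>\<eta> x - \<eta> y\<bar> \<le> 4 * K / r" using lip[of x y] by linarith
    then show ?thesis by (metis abs_ge_zero power2_abs power_mono)
  qed
  have "(\<Sum>(x, y)\<in>P. (h x - h y) * ((\<eta> x)\<^sup>2 * h x - (\<eta> y)\<^sup>2 * h y)) = 0"
  proof (rule energy_test)
    fix x assume "x \<in> X" "x \<in> A \<or> \<rho> x > R"
    then show "(\<eta> x)\<^sup>2 * h x = 0" using hA eta0[of x] r r0 by auto
  qed
  moreover have "(h x - h y) * ((\<eta> x)\<^sup>2 * h x - (\<eta> y)\<^sup>2 * h y) =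
      (\<eta> x * h x - \<eta> y * h y)\<^sup>2 - h x * h y * (\<eta> x - \<eta> y)\<^sup>2" for x y
    by (simp add: power2_eq_square algebra_simps)
  ultimately have id: "(\<Sum>(x, y)\<in>P. (\<eta> x * h x - \<eta> y * h y)\<^sup>2) = (\<Sum>(x, y)\<in>P. h x * h y * (\<eta> x - \<eta> y)\<^sup>2)"
    by (simp add: sum_subtractf case_prod_unfold)
  have "E (r / 4) = (\<Sum>(x, y)\<in>P \<inter> disc (r / 4) \<times> disc (r / 4). (\<eta> x * h x - \<eta> y * h y)\<^sup>2)"
    unfolding energy_def by (rule sum.cong) (auto simp: eta1)
  also have "\<dots> \<le> (\<Sum>(x, y)\<in>P. (\<eta> x * h x - \<eta> y * h y)\<^sup>2)"
    by (rule sum_mono2) (use finP in auto)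
  also have "\<dots> = (\<Sum>(x, y)\<in>P. h x * h y * (\<eta> x - \<eta> y)\<^sup>2)" by (rule id)
  also have "\<dots> = (\<Sum>(x, y)\<in>?D. h x * h y * (\<eta> x - \<eta> y)\<^sup>2)"
  proof (rule sum.mono_neutral_right[OF finP])
    show "\<forall>z\<in>P - ?D. (case z of (x, y) \<Rightarrow> h x * h y * (\<eta> x - \<eta> y)\<^sup>2) = 0"
      using supp by fastforce
  qed blast
  also have "\<dots> \<le> (\<Sum>(x, y)\<in>?D. M\<^sup>2 * (4 * K / r)\<^sup>2)"
  proof (rule sum_mono, clarify)
    fix x y assume xy: "(x, y) \<in> P" "x \<in> X" "y \<in> X" "\<rho> x \<le> r" "\<rho> y \<le> r"
    have "h x * h y \<le> M * M"
      by (rule mult_mono) (use xy M(1)[of x] M(1)[of y] M(2) h01(1)[of y] in simp_all)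
    then show "h x * h y * (\<eta> x - \<eta> y)\<^sup>2 \<le> M\<^sup>2 * (4 * K / r)\<^sup>2"
      unfolding power2_eq_square[of M]
    proof (rule mult_mono)
      show "(\<eta> x - \<eta> y)\<^sup>2 \<le> (4 * K / r)\<^sup>2" using xy by (intro lip2) auto
    qed (use \<open>h x * h y \<le> M * M\<close> in simp_all)
  qed
  also have "\<dots> = real (card ?D) * (M\<^sup>2 * (4 * K / r)\<^sup>2)" by (simp add: case_prod_unfold)
  also have "\<dots> \<le> (K\<^sup>2 * r\<^sup>2) * (M\<^sup>2 * (4 * K / r)\<^sup>2)"
    using card_pairs_le[of r] r Kb by (intro mult_right_mono) simp_all
  also have "\<dots> = 16 * K^4 * M\<^sup>2"
  proof -
    have "(4 * K / r)\<^sup>2 * r\<^sup>2 = 16 * K\<^sup>2" using r0 by (simp add: power_divide power_mult_distrib)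
    moreover have "(K\<^sup>2 * r\<^sup>2) * (M\<^sup>2 * q) = K\<^sup>2 * M\<^sup>2 * (q * r\<^sup>2)" for q
      by (simp only: mult_ac)
    moreover have "K\<^sup>2 * M\<^sup>2 * (16 * K\<^sup>2) = 16 * K^4 * M\<^sup>2"
      by (simp add: power4_eq_xxxx power2_eq_square)
    ultimately show ?thesis by (simp only:)
  qed
  finally show ?thesis .
qed

text \<open>If the maximum over \<open>disc s\<close> exceeds \<open>M\<close>, it is attained only
  below the band, so the neighbours of such a point stay in \<open>disc s\<close> and by harmonicity
  share the maximum. It would spread along the path to \<open>A\<close> given by
  \<open>connected\<close>, but \<open>h\<close> vanishes on \<open>A\<close>.\<close>

lemma maximum_principle:
  assumes s: "s \<le> R" and M: "0 \<le> M"
    and band: "\<And>x. x \<in> X \<Longrightarrow> s - b < \<rho> x \<Longrightarrow> \<rho> x \<le> s \<Longrightarrow> h x \<le> M"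
    and x: "x \<in> X" "\<rho> x \<le> s"
  shows "h x \<le> M"
proof (rule ccontr)
  assume "\<not> h x \<le> M"
  then have hx: "h x > M" by simp
  define m where "m = Max (h ` disc s)"
  have fin: "finite (h ` disc s)" using finX by simp
  have ne: "h ` disc s \<noteq> {}" using x by auto
  have le: "h y \<le> m" if "y \<in> disc s" for y
    unfolding m_def using that fin by (intro Max_ge) auto
  have mM: "m > M" using hx le[of x] x by auto
  have "m \<in> h ` disc s" unfolding m_def using Max_in[OF fin ne] .
  then obtain v where v: "v \<in> disc s" "h v = m" by auto
  have step: "z \<in> disc s \<and> h z = m" if y: "y \<in> disc s" "h y = m" and yz: "(y, z) \<in> P" for y z
  proof -
    have yA: "y \<notin> A" using y mM M hA[of y] by auto
    have rho: "\<rho> y \<le> s - b" using band[of y] y mM by (cases "\<rho> y \<le> s - b") auto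
    have nb: "w \<in> disc s" if "(y, w) \<in> P" for w
      using rho_step[OF that] that PX rho s Kb by auto
    have "(\<Sum>w\<in>P `` {y}. h y - h w) = 0" using harmonic[of y] yA y s by auto
    moreover have "h y - h w \<ge> 0" if "w \<in> P `` {y}" for w using nb[of w] that le[of w] y by auto
    moreover have "finite (P `` {y})" using finP by (rule finite_Image)
    ultimately have "\<forall>w\<in>P `` {y}. h y - h w = 0"
      by (subst (asm) sum_nonneg_eq_0_iff) simp_all
    then show ?thesis using yz nb[of z] y by auto
  qed
  obtain a where a: "a \<in> A" "(v, a) \<in> P\<^sup>*" using connected[of v] v mM M by auto
  from a(2) have "a \<in> disc s \<and> h a = m"
    by (induction rule: rtrancl_induct) (use v step in blast)+
  then show False using hA[OF a(1)] mM M by simp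
qed

text \<open>Of the order of \<open>r / K\<close> disjoint levels fit between \<open>r\<close> and \<open>2 r\<close>; the one of least energy carries
  at most an average share.\<close>

lemma sup_le_annulus_energy:
  assumes r: "8 * K \<le> r" "2 * r \<le> R" and x: "x \<in> disc r"
  shows "(h x)\<^sup>2 \<le> 12 * K\<^sup>2 * (E (2 * r) - E r)"
proof -
  have K1: "K \<ge> 1" using Kb by simp
  have r0: "r > 0" using r Kb by linarith
  \<comment> \<open>Number of levels: with centres at spacing \<open>3 * K\<close> and half-width
    \<open>K\<close> the bands are disjoint, start beyond \<open>r\<close> and end by
    \<open>2 * r\<close>. The assumption \<open>8 * K \<le> r\<close> absorbs the rounding and
    leaves at least \<open>r / (6 * K)\<close> of them.\<close>
  define J where "J = nat \<lfloor>(r - K) / (3 * K)\<rfloor>"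
  have Jle: "real J \<le> (r - K) / (3 * K)"
    unfolding J_def using r K1 by (simp add: divide_nonneg_nonneg)
  have Jge: "real J \<ge> (r - K) / (3 * K) - 1"
    unfolding J_def using r K1 by linarith
  have "(r - K) / (3 * K) - 1 - r / (6 * K) = (r - 8 * K) / (6 * K)"
    using K1 by (simp add: field_simps)
  moreover have "(r - 8 * K) / (6 * K) \<ge> 0" using r K1 by simp
  ultimately have J: "real J \<ge> r / (6 * K)" using Jge by linarith
  then have Jpos: "real J > 0" using r0 K1 by (smt (verit) divide_pos_pos)
  then have J0: "J > 0" by simp
  define s where "s i = r + 3 * K * real i" for i :: nat
  define V where "V i = {x\<in>X. \<bar>\<rho> x - s i\<bar> \<le> K}" for i
  have slo: "s i - K > r" if "i \<in> {1..J}" for i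
  proof -
    have "3 * K * 1 \<le> 3 * K * real i" using that K1 by (intro mult_left_mono) auto
    then show ?thesis unfolding s_def using K1 by linarith
  qed
  have shi: "s i + K \<le> 2 * r" if "i \<in> {1..J}" for i
  proof -
    have "3 * K * real i \<le> 3 * K * real J" using that K1 by (intro mult_left_mono) auto
    also have "\<dots> \<le> 3 * K * ((r - K) / (3 * K))" using Jle K1 by (intro mult_left_mono) auto
    also have "\<dots> = r - K" using K1 by simp
    finally show ?thesis unfolding s_def by linarith
  qed
  have disj: "V i \<inter> V j = {}" if "i < j" for i j
  proof -
    have "3 * K * (real i + 1) \<le> 3 * K * real j" using that K1 by (intro mult_left_mono) auto
    then have "s i + 3 * K \<le> s j" unfolding s_def by (simp add: algebra_simps)
    then show ?thesis unfolding V_def using K1 by auto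
  qed
  have "(\<Sum>i\<in>{1..J}. energy P h (V i)) \<le> E (2 * r) - E r"
  proof (rule sum_energy_disjoint_le[OF finP])
    fix i j assume "i \<in> {1..J}" "j \<in> {1..J}" "i \<noteq> j"
    then show "V i \<inter> V j = {}" using disj[of i j] disj[of j i] by (cases i j rule: linorder_cases) auto
  next
    fix i assume i: "i \<in> {1..J}"
    show "V i \<subseteq> disc (2 * r) - disc r"
      using slo[OF i] shi[OF i] unfolding V_def by auto
  qed (use r0 in auto)
  moreover have "\<exists>i\<in>{1..J}. real J * energy P h (V i) \<le> (\<Sum>i\<in>{1..J}. energy P h (V i))"
  proof (rule ccontr)
    assume "\<not> ?thesis"
    then have "\<And>i. i \<in> {1..J} \<Longrightarrow> (\<Sum>i\<in>{1..J}. energy P h (V i)) / real J < energy P h (V i)"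
      using J0 by (simp add: field_simps not_le)
    then have "(\<Sum>i\<in>{1..J}. (\<Sum>i\<in>{1..J}. energy P h (V i)) / real J) < (\<Sum>i\<in>{1..J}. energy P h (V i))"
      using J0 by (intro sum_strict_mono) auto
    then show False using J0 by simp
  qed
  ultimately obtain i where i: "i \<in> {1..J}" "real J * energy P h (V i) \<le> E (2 * r) - E r" by force
  let ?D = "E (2 * r) - E r"
  have "r / (6 * K) * energy P h (V i) \<le> ?D"
    using mult_right_mono[OF J energy_nonneg[of P h "V i"]] i(2) by linarith
  then have EV: "energy P h (V i) \<le> 6 * K / r * ?D" using r0 K1 by (simp add: field_simps)
  have D0: "?D \<ge> 0" using i(2) energy_nonneg[of P h "V i"] Jpos
    by (smt (verit) mult_nonneg_nonneg)
  have sK: "K \<le> s i" "1 \<le> s i" "s i \<le> R" "s i \<le> 2 * r" "r \<le> s i"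
    using slo[OF i(1)] shi[OF i(1)] r K1 by auto
  \<comment> \<open>On the chosen level \<open>A\<close> supplies a point with \<open>h = 0\<close>,
    so a bound on the oscillation is a bound on \<open>h\<close> itself.\<close>
  obtain a where a: "a \<in> A" "\<bar>\<rho> a - s i\<bar> \<le> b" using crossing[OF sK(1,3)] by blast
  have sq: "(h v)\<^sup>2 \<le> 12 * K\<^sup>2 * ?D" if v: "v \<in> X" "\<bar>\<rho> v - s i\<bar> \<le> b" for v
  proof -
    obtain N where N: "real N \<le> K * s i" "reach P (V i) N v a"
      using level[OF sK(2,3) v(1) _ v(2) a(2)] a(1) AX unfolding V_def by blast
    have "(h v - h a)\<^sup>2 \<le> real N * energy P h (V i)"
      by (rule diff_square_le_energy[OF finP N(2)])
    also have "\<dots> \<le> (K * (2 * r)) * (6 * K / r * ?D)"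
    proof (intro mult_mono)
      show "real N \<le> K * (2 * r)" using N(1) sK(4) K1 by (meson order_trans mult_left_mono zero_le_one)
    qed (use EV energy_nonneg r0 K1 in auto)
    also have "\<dots> = 12 * K\<^sup>2 * ?D" using r0 by (simp add: power2_eq_square)
    finally show ?thesis using hA[OF a(1)] by simp
  qed
  have "h x \<le> sqrt (12 * K\<^sup>2 * ?D)"
  proof (rule maximum_principle[OF sK(3)])
    fix v assume v: "v \<in> X" "s i - b < \<rho> v" "\<rho> v \<le> s i"
    then have "(h v)\<^sup>2 \<le> 12 * K\<^sup>2 * ?D" by (intro sq) auto
    then show "h v \<le> sqrt (12 * K\<^sup>2 * ?D)" by (rule real_le_rsqrt)
  qed (use x sK D0 in auto)
  then have "(h x)\<^sup>2 \<le> (sqrt (12 * K\<^sup>2 * ?D))\<^sup>2" using h01[of x] x by (intro power_mono) auto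
  then show ?thesis using D0 by simp
qed

section \<open>Geometric decay over scales\<close>

lemma decay_factor_bounds: "0 < decay_factor K" "decay_factor K < 1"
proof -
  have "K ^ 6 > 0" using Kb by simp
  then show "0 < decay_factor K" "decay_factor K < 1" unfolding decay_factor_def by (auto simp: add_pos_pos)
qed

text \<open>The sup bound at radius \<open>4 * r\<close> uses the annulus up to
  \<open>8 * r\<close>, and Caccioppoli's inequality returns from \<open>4 * r\<close> to
  \<open>r\<close>. Adding a multiple of \<open>E r\<close> to both sides fills the hole of the
  annulus.\<close>

lemma hole_filling:
  assumes r: "2 * K \<le> r" "8 * r \<le> R"
  shows "E r \<le> decay_factor K * E (8 * r)"
proof -
  have r0: "r > 0" using r Kb by linarith
  define D where "D = E (8 * r) - E (4 * r)"
  have D0: "D \<ge> 0"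
  proof -
    have "E (4 * r) \<le> E (8 * r)" unfolding energy_def
      by (rule sum_mono2) (use finP r0 in auto)
    then show ?thesis unfolding D_def by simp
  qed
  have sq: "(h x)\<^sup>2 \<le> 12 * K\<^sup>2 * D" if "x \<in> disc (4 * r)" for x
    using sup_le_annulus_energy[of "4 * r" x] that r unfolding D_def by simp
  have "E (4 * r / 4) \<le> 16 * K^4 * (sqrt (12 * K\<^sup>2 * D))\<^sup>2"
    by (rule caccioppoli) (use r Kb sq D0 in \<open>auto intro: real_le_rsqrt\<close>)
  also have "\<dots> = 192 * K^6 * D" using D0 by (simp add: power2_eq_square eval_nat_numeral)
  also have "\<dots> \<le> 192 * K^6 * (E (8 * r) - E r)"
  proof (rule mult_left_mono)
    have "E r \<le> E (4 * r)" unfolding energy_def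
      by (rule sum_mono2) (use finP r0 in auto)
    then show "D \<le> E (8 * r) - E r" unfolding D_def by simp
  qed (use Kb in simp)
  finally have "(1 + 192 * K^6) * E r \<le> 192 * K^6 * E (8 * r)" by (simp add: algebra_simps)
  moreover have "K^6 > 0" using Kb by simp
  ultimately show ?thesis unfolding decay_factor_def by (simp add: field_simps add_pos_pos)
qed

lemma energy_iterate:
  assumes "2 * K * 8 ^ k \<le> R"
  shows "E (2 * K) \<le> decay_factor K ^ k * E (2 * K * 8 ^ k)"
  using assms
proof (induction k)
  case (Suc k)
  have p: "(1::real) \<le> 8 ^ k" by simp
  have "2 * K * 8 ^ k \<le> 2 * K * 8 ^ Suc k" using Kb by simp
  then have "E (2 * K) \<le> decay_factor K ^ k * E (2 * K * 8 ^ k)" using Suc by linarith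
  also have "\<dots> \<le> decay_factor K ^ k * (decay_factor K * E (8 * (2 * K * 8 ^ k)))"
    using Suc.prems Kb p decay_factor_bounds by (intro mult_left_mono hole_filling) auto
  finally show ?case by (simp add: mult_ac)
qed simp

text \<open>The iteration ends at the largest radius \<open>2 * K * 8 ^ k\<close> not exceeding
  \<open>R / 4\<close>, where Caccioppoli's inequality with \<open>M = 1\<close> bounds the energy
  outright. Rounding down the number \<open>k\<close> of scales costs at most one factor
  \<open>decay_factor K\<close>, whence the division by it.\<close>

lemma energy_decay:
  assumes R: "8 * K \<le> R"
  shows "E (2 * K) \<le> 16 * K^4 / decay_factor K * (R / (8 * K)) powr (log 8 (decay_factor K))"
proof -
  have K1: "K \<ge> 1" using Kb by simp
  define t where "t = log 8 (R / (8 * K))"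
  have t0: "t \<ge> 0" unfolding t_def using R K1 by simp
  have t8: "8 powr t = R / (8 * K)" unfolding t_def using R K1 by simp
  define k where "k = nat \<lfloor>t\<rfloor>"
  have k: "real k \<le> t" "t < real k + 1" unfolding k_def using t0 by linarith+
  have "8 ^ k = (8::real) powr real k" by (simp add: powr_realpow)
  also have "\<dots> \<le> 8 powr t" using k by (intro powr_mono) auto
  finally have k8: "8 ^ k \<le> R / (8 * K)" using t8 by simp
  then have kR: "2 * K * 8 ^ k \<le> R / 4" using K1 by (simp add: field_simps)
  have R0: "R > 0" using R K1 by linarith
  have "E (2 * K) \<le> decay_factor K ^ k * E (2 * K * 8 ^ k)"
    using kR R0 by (intro energy_iterate) linarith
  also have "E (2 * K * 8 ^ k) \<le> E (R / 4)"
    unfolding energy_def by (rule sum_mono2) (use finP kR in auto)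
  also have "E (R / 4) \<le> 16 * K^4 * 1\<^sup>2"
    by (rule caccioppoli) (use R K1 h01 in auto)
  finally have "E (2 * K) \<le> decay_factor K ^ k * (16 * K^4)" using decay_factor_bounds by simp
  also have "decay_factor K ^ k = decay_factor K powr (real k)" using decay_factor_bounds by (simp add: powr_realpow)
  also have "\<dots> \<le> decay_factor K powr (t - 1)" using k decay_factor_bounds by (intro powr_mono') auto
  also have "\<dots> = decay_factor K powr t / decay_factor K" using decay_factor_bounds by (simp add: powr_diff)
  also have "decay_factor K powr t = (8 powr (log 8 (decay_factor K))) powr t" using decay_factor_bounds by simp
  also have "\<dots> = (8 powr t) powr (log 8 (decay_factor K))" by (simp add: powr_powr mult.commute)
  also have "\<dots> = (R / (8 * K)) powr (log 8 (decay_factor K))" by (simp add: t8)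
  finally show ?thesis using K1 by (simp add: mult_ac)
qed

end

section \<open>The walk stopped on a set\<close>

text \<open>Independence of one coordinate from a function of the others, over a possibly infinite
  index set: coordinate \<open>p\<close> is split off as a factor and Tonelli applies.\<close>

lemma nn_integral_PiM_component_mult:
  fixes f :: "'b \<Rightarrow> ennreal" and g :: "('i \<Rightarrow> 'b) \<Rightarrow> ennreal"
  assumes M: "\<And>i. i \<in> I \<Longrightarrow> prob_space (M i)" and p: "p \<in> I"
    and f[measurable]: "f \<in> borel_measurable (M p)"
    and g[measurable]: "g \<in> borel_measurable (\<Pi>\<^sub>M i\<in>I. M i)"
    and indep: "\<And>X x. g (X(p := x)) = g X"
  shows "(\<integral>\<^sup>+\<omega>. f (\<omega> p) * g \<omega> \<partial>(\<Pi>\<^sub>M i\<in>I. M i)) = (\<integral>\<^sup>+x. f x \<partial>M p) * (\<integral>\<^sup>+\<omega>. g \<omega> \<partial>(\<Pi>\<^sub>M i\<in>I. M i))"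
proof -
  let ?J = "I - {p}"
  have I: "insert p ?J = I" using p by auto
  interpret Mp: prob_space "M p" using M p by blast
  interpret J: prob_space "\<Pi>\<^sub>M i\<in>?J. M i" using M by (intro prob_space_PiM) auto
  interpret PI: prob_space "\<Pi>\<^sub>M i\<in>I. M i" using M by (intro prob_space_PiM) auto
  have D: "distr (M p \<Otimes>\<^sub>M (\<Pi>\<^sub>M i\<in>?J. M i)) (\<Pi>\<^sub>M i\<in>I. M i) (\<lambda>(x, X). X(p := x)) = (\<Pi>\<^sub>M i\<in>I. M i)"
    using distr_pair_PiM_eq_PiM[of ?J M p] M p unfolding I by auto
  have upd[measurable]: "(\<lambda>(x, X). X(p := x)) \<in> measurable (M p \<Otimes>\<^sub>M (\<Pi>\<^sub>M i\<in>?J. M i)) (\<Pi>\<^sub>M i\<in>I. M i)"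
  proof -
    have "(\<lambda>(f, y). f(p := y)) \<in> measurable ((\<Pi>\<^sub>M i\<in>?J. M i) \<Otimes>\<^sub>M M p) (\<Pi>\<^sub>M i\<in>I. M i)"
      using measurable_add_dim[of p ?J M] unfolding I .
    from measurable_compose[OF measurable_pair_swap' this]
    show ?thesis by (simp add: case_prod_unfold)
  qed
  have comp[measurable]: "(\<lambda>\<omega>. \<omega> p) \<in> measurable (\<Pi>\<^sub>M i\<in>I. M i) (M p)"
    using p by (rule measurable_component_singleton)
  have gJ: "g \<in> borel_measurable (\<Pi>\<^sub>M i\<in>?J. M i)"
  proof -
    obtain x0 where x0: "x0 \<in> space (M p)" using Mp.not_empty by auto
    have "(\<lambda>X. g ((\<lambda>(x, X). X(p := x)) (x0, X))) \<in> borel_measurable (\<Pi>\<^sub>M i\<in>?J. M i)"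
      by (rule measurable_compose[OF measurable_compose[OF measurable_Pair1'[OF x0] upd] g])
    then show ?thesis by (simp add: indep)
  qed
  have main: "(\<integral>\<^sup>+\<omega>. k (\<omega> p) * g \<omega> \<partial>(\<Pi>\<^sub>M i\<in>I. M i)) = (\<integral>\<^sup>+x. k x \<partial>M p) * (\<integral>\<^sup>+X. g X \<partial>(\<Pi>\<^sub>M i\<in>?J. M i))"
    if k[measurable]: "k \<in> borel_measurable (M p)" for k :: "'b \<Rightarrow> ennreal"
  proof -
    have "(\<integral>\<^sup>+\<omega>. k (\<omega> p) * g \<omega> \<partial>(\<Pi>\<^sub>M i\<in>I. M i)) =
        (\<integral>\<^sup>+\<omega>. k (\<omega> p) * g \<omega> \<partial>distr (M p \<Otimes>\<^sub>M (\<Pi>\<^sub>M i\<in>?J. M i)) (\<Pi>\<^sub>M i\<in>I. M i) (\<lambda>(x, X). X(p := x)))"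
      by (simp only: D)
    also have "\<dots> = (\<integral>\<^sup>+z. k (((\<lambda>(x, X). X(p := x)) z) p) * g ((\<lambda>(x, X). X(p := x)) z) \<partial>(M p \<Otimes>\<^sub>M (\<Pi>\<^sub>M i\<in>?J. M i)))"
      by (rule nn_integral_distr[OF upd]) measurable
    also have "\<dots> = (\<integral>\<^sup>+z. k (fst z) * g (snd z) \<partial>(M p \<Otimes>\<^sub>M (\<Pi>\<^sub>M i\<in>?J. M i)))"
      by (simp add: case_prod_unfold indep)
    also have "\<dots> = (\<integral>\<^sup>+x. \<integral>\<^sup>+X. k (fst (x, X)) * g (snd (x, X)) \<partial>(\<Pi>\<^sub>M i\<in>?J. M i) \<partial>M p)"
      by (intro J.nn_integral_fst[symmetric] borel_measurable_times_ennreal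
        measurable_compose[OF measurable_fst k] measurable_compose[OF measurable_snd gJ])
    also have "\<dots> = (\<integral>\<^sup>+x. k x * (\<integral>\<^sup>+X. g X \<partial>(\<Pi>\<^sub>M i\<in>?J. M i)) \<partial>M p)"
      using gJ by (simp add: nn_integral_cmult)
    also have "\<dots> = (\<integral>\<^sup>+x. k x \<partial>M p) * (\<integral>\<^sup>+X. g X \<partial>(\<Pi>\<^sub>M i\<in>?J. M i))"
      by (rule nn_integral_multc) measurable
    finally show ?thesis .
  qed
  \<comment> \<open>The instance with the constant 1 identifies the integral over the remaining
    coordinates with that of \<open>g\<close> over all of them.\<close>
  show ?thesis using main[of f] main[of "\<lambda>_. 1"] by (simp add: Mp.emeasure_space_1)
qed

text \<open>Transition operator of the jump chain absorbed on \<open>D\<close>, acting on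
  functions.\<close>

definition avg_off :: "complex set \<Rightarrow> nat \<Rightarrow> complex set \<Rightarrow> (complex \<Rightarrow> real) \<Rightarrow> complex \<Rightarrow> real" where
  "avg_off U n D f v =
     (if v \<in> D then f v else (\<Sum>w\<in>targets U n v. f w) / real (card (targets U n v)))"

text \<open>A function of the arrows alone: once the holding times are positive, they have no
  influence on which of \<open>A\<close> and \<open>S\<close> is entered first.\<close>

primrec stopped_chain :: "complex set \<Rightarrow> complex \<Rightarrow> nat \<Rightarrow> (nat \<times> complex \<Rightarrow> complex) \<Rightarrow> complex" where
  "stopped_chain D x 0 a = x"
| "stopped_chain D x (Suc k) a =
     (if stopped_chain D x k a \<in> D then stopped_chain D x k a else a (k, stopped_chain D x k a))"

abbreviation arrow_space :: "complex set \<Rightarrow> nat \<Rightarrow> (nat \<times> complex \<Rightarrow> complex) measure" where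
  "arrow_space U n \<equiv> \<Pi>\<^sub>M p\<in>UNIV \<times> verts U n. uniform_count_measure (targets U n (snd p))"

text \<open>After \<open>k\<close> steps only arrows with time index below \<open>k\<close> have
  been read. This makes the position independent of the arrow followed next.\<close>

lemma stopped_chain_upd: "k \<le> j \<Longrightarrow> stopped_chain D x k (a((j, w) := y)) = stopped_chain D x k a"
  by (induction k) auto

lemma measurable_arrow:
  assumes v: "v \<in> verts U n"
  shows "(\<lambda>a. a (k, v)) \<in> measurable (arrow_space U n) (count_space (verts U n))"
proof -
  have "(\<lambda>a. a (k, v)) \<in> measurable (arrow_space U n) (uniform_count_measure (targets U n v))"
    using measurable_component_singleton[of "(k, v)" "UNIV \<times> verts U n"
        "\<lambda>p. uniform_count_measure (targets U n (snd p))"] v by auto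
  moreover have "(\<lambda>w. w) \<in> measurable (uniform_count_measure (targets U n v)) (count_space (verts U n))"
    using targets_subset[OF v]
    by (auto simp: measurable_def sets_uniform_count_measure space_uniform_count_measure)
  ultimately show ?thesis by (rule measurable_compose)
qed

lemma measurable_stopped_chain:
  assumes "x \<in> verts U n"
  shows "stopped_chain D x k \<in> measurable (arrow_space U n) (count_space (verts U n))"
proof (induction k)
  case 0
  then show ?case using assms by simp
next
  case (Suc k)
  have "(\<lambda>a. if v \<in> D then v else a (k, v)) \<in> measurable (arrow_space U n) (count_space (verts U n))"
    if v: "v \<in> verts U n" for v
    using measurable_arrow[OF v, of k] v by (cases "v \<in> D") simp_all
  from measurable_compose_countable'[OF this Suc countable_verts]
  show ?case by simp
qed

text \<open>Markov property at step \<open>k\<close>: the arrow \<open>(k, w)\<close> is uniform on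
  the targets of \<open>w\<close> and independent of the event that the chain sits at
  \<open>w\<close>.\<close>

lemma nn_integral_stopped_chain_Suc:
  assumes n: "n > 0" and fin: "finite (verts U n)" and x: "x \<in> verts U n"
    and f: "\<And>v. f v \<ge> 0"
  shows "(\<integral>\<^sup>+a. ennreal (f (stopped_chain D x (Suc k) a)) \<partial>arrow_space U n) =
    (\<integral>\<^sup>+a. ennreal (avg_off U n D f (stopped_chain D x k a)) \<partial>arrow_space U n)"
proof -
  let ?N = "arrow_space U n" and ?Y = "\<lambda>k a. stopped_chain D x k a"
  have Y[measurable]: "?Y k \<in> measurable ?N (count_space (verts U n))" for k
    by (rule measurable_stopped_chain[OF x])
  have Yv: "?Y k a \<in> verts U n" if "a \<in> space ?N" for a k
    using measurable_space[OF Y that] by simp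
  have tgt: "finite (targets U n v)" "targets U n v \<noteq> {}" for v
    using finite_targets[OF n] by (auto simp: targets_def)
  define F where "F w a = ennreal (f (if w \<in> D then w else a (k, w)))" for w a
  have indm: "(\<lambda>a. indicator {w} (?Y k a) :: ennreal) \<in> borel_measurable ?N" for w
    by (rule measurable_compose[OF Y]) simp
  have Fm: "F w \<in> borel_measurable ?N" if "w \<in> verts U n" for w
    unfolding F_def using measurable_arrow[OF that, of k]
    by (cases "w \<in> D") (auto intro: measurable_compose)
  \<comment> \<open>Decomposition over the position after \<open>k\<close> steps; it turns the
    random index of the arrow that is followed into a fixed one.\<close>
  have split: "(\<integral>\<^sup>+a. G (?Y k a) a \<partial>?N) = (\<Sum>w\<in>verts U n. \<integral>\<^sup>+a. G w a * indicator {w} (?Y k a) \<partial>?N)"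
    if G: "\<And>w. w \<in> verts U n \<Longrightarrow> G w \<in> borel_measurable ?N" for G :: "complex \<Rightarrow> _ \<Rightarrow> ennreal"
  proof -
    have "(\<integral>\<^sup>+a. G (?Y k a) a \<partial>?N) = (\<integral>\<^sup>+a. (\<Sum>w\<in>verts U n. G w a * indicator {w} (?Y k a)) \<partial>?N)"
    proof (rule nn_integral_cong)
      fix a assume a: "a \<in> space ?N"
      have "(\<Sum>w\<in>verts U n. G w a * indicator {w} (?Y k a)) = (\<Sum>w\<in>{?Y k a}. G w a * indicator {w} (?Y k a))"
        by (rule sum.mono_neutral_right) (use fin Yv[OF a, of k] in \<open>auto simp: indicator_def\<close>)
      then show "G (?Y k a) a = (\<Sum>w\<in>verts U n. G w a * indicator {w} (?Y k a))" by simp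
    qed
    also have "\<dots> = (\<Sum>w\<in>verts U n. \<integral>\<^sup>+a. G w a * indicator {w} (?Y k a) \<partial>?N)"
      by (intro nn_integral_sum borel_measurable_times_ennreal G indm)
    finally show ?thesis .
  qed
  have "(\<integral>\<^sup>+a. ennreal (f (?Y (Suc k) a)) \<partial>?N) = (\<integral>\<^sup>+a. F (?Y k a) a \<partial>?N)"
    by (rule nn_integral_cong) (simp add: F_def)
  also have "\<dots> = (\<Sum>w\<in>verts U n. \<integral>\<^sup>+a. F w a * indicator {w} (?Y k a) \<partial>?N)"
    by (rule split[OF Fm])
  also have "\<dots> = (\<Sum>w\<in>verts U n. \<integral>\<^sup>+a. ennreal (avg_off U n D f w) * indicator {w} (?Y k a) \<partial>?N)"
  proof (rule sum.cong[OF refl])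
    fix w assume w: "w \<in> verts U n"
    show "(\<integral>\<^sup>+a. F w a * indicator {w} (?Y k a) \<partial>?N) =
        (\<integral>\<^sup>+a. ennreal (avg_off U n D f w) * indicator {w} (?Y k a) \<partial>?N)"
    proof (cases "w \<in> D")
      case True
      then show ?thesis by (simp add: F_def avg_off_def)
    next
      case False
      have "(\<integral>\<^sup>+a. F w a * indicator {w} (?Y k a) \<partial>?N) =
          (\<integral>\<^sup>+a. ennreal (f (a (k, w))) * indicator {w} (?Y k a) \<partial>?N)"
        using False by (simp add: F_def)
      also have "\<dots> = (\<integral>\<^sup>+y. ennreal (f y) \<partial>uniform_count_measure (targets U n (snd (k, w)))) *
          (\<integral>\<^sup>+a. indicator {w} (?Y k a) \<partial>?N)"
      proof (rule nn_integral_PiM_component_mult[where M="\<lambda>p. uniform_count_measure (targets U n (snd p))"])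
        show "prob_space (uniform_count_measure (targets U n (snd p)))" for p :: "nat \<times> complex"
          using tgt by (intro prob_space_uniform_count_measure)
        show "indicator {w} (?Y k (X((k, w) := y))) = (indicator {w} (?Y k X) :: ennreal)" for X y
          by (simp only: stopped_chain_upd[OF order_refl])
      qed (use w indm in \<open>auto simp: measurable_def sets_uniform_count_measure space_uniform_count_measure\<close>)
      also have "(\<integral>\<^sup>+y. ennreal (f y) \<partial>uniform_count_measure (targets U n (snd (k, w)))) =
          ennreal (avg_off U n D f w)"
        using False tgt f unfolding uniform_count_measure_def
        by (simp add: nn_integral_point_measure_finite avg_off_def flip: ennreal_mult'' sum_ennreal)
           (simp add: sum_divide_distrib sum_nonneg)
      finally show ?thesis using indm[of w] by (simp add: nn_integral_cmult)
    qed
  qed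
  also have "\<dots> = (\<integral>\<^sup>+a. ennreal (avg_off U n D f (?Y k a)) \<partial>?N)"
    by (rule split[symmetric]) simp
  finally show ?thesis .
qed

lemma avg_off_nonneg: "(\<And>v. f v \<ge> 0) \<Longrightarrow> avg_off U n D f v \<ge> 0"
  unfolding avg_off_def by (simp add: sum_nonneg)

lemma avg_off_mono: "(\<And>v. f v \<le> g v) \<Longrightarrow> avg_off U n D f v \<le> avg_off U n D g v"
  unfolding avg_off_def by (simp add: sum_mono divide_right_mono)

text \<open>The last step is peeled off and absorbed into the test function, hence the induction
  over all \<open>f\<close> at once.\<close>

lemma nn_integral_stopped_chain:
  assumes "n > 0" "finite (verts U n)" "x \<in> verts U n" "\<And>v. f v \<ge> 0"
  shows "(\<integral>\<^sup>+a. ennreal (f (stopped_chain D x k a)) \<partial>arrow_space U n) = ennreal ((avg_off U n D ^^ k) f x)"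
  using assms(4)
proof (induction k arbitrary: f)
  case 0
  interpret prob_space "arrow_space U n"
    by (intro prob_space_PiM prob_space_uniform_count_measure finite_targets assms)
      (auto simp: targets_def)
  show ?case by (simp add: emeasure_space_1)
next
  case (Suc k)
  have "(\<integral>\<^sup>+a. ennreal (f (stopped_chain D x (Suc k) a)) \<partial>arrow_space U n) =
      (\<integral>\<^sup>+a. ennreal (avg_off U n D f (stopped_chain D x k a)) \<partial>arrow_space U n)"
    by (rule nn_integral_stopped_chain_Suc[OF assms(1-3) Suc.prems])
  also have "\<dots> = ennreal ((avg_off U n D ^^ k) (avg_off U n D f) x)"
    by (rule Suc.IH) (use Suc.prems avg_off_nonneg in blast)
  finally show ?case by (simp only: funpow_swap1 funpow.simps comp_def)
qed

section \<open>Comparison with the walk in continuous time\<close>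

lemma emeasure_stopped_chain:
  assumes n: "n > 0" and fin: "finite (verts U n)" and x: "x \<in> verts U n"
  shows "emeasure (walk_space U n) {\<omega> \<in> space (walk_space U n). stopped_chain D x k (fst \<omega>) \<notin> A} =
    ennreal ((avg_off U n D ^^ k) (\<lambda>v. if v \<in> A then 0 else 1) x)"
proof -
  let ?N = "arrow_space U n" and ?H = "\<Pi>\<^sub>M k\<in>(UNIV::nat set). density lborel (exponential_density (2 * (of_nat n)\<^sup>2))"
  interpret H: prob_space ?H
    by (intro prob_space_PiM prob_space_exponential_density) (use n in simp)
  have W: "walk_space U n = ?N \<Otimes>\<^sub>M ?H" by (simp add: walk_space_def)
  let ?S = "{a \<in> space ?N. stopped_chain D x k a \<notin> A}"
  have S: "?S \<in> sets ?N"
  proof -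
    have "?S = stopped_chain D x k -` (verts U n - A) \<inter> space ?N"
      using measurable_space[OF measurable_stopped_chain[OF x]] by auto
    then show ?thesis using measurable_sets[OF measurable_stopped_chain[OF x], of "verts U n - A"] by simp
  qed
  have "emeasure (walk_space U n) {\<omega> \<in> space (walk_space U n). stopped_chain D x k (fst \<omega>) \<notin> A} =
      emeasure (?N \<Otimes>\<^sub>M ?H) (?S \<times> space ?H)"
    unfolding W by (rule arg_cong2[where f=emeasure]) (auto simp: space_pair_measure)
  also have "\<dots> = emeasure ?N ?S"
    using S by (simp add: H.emeasure_pair_measure_Times H.emeasure_space_1)
  also have "\<dots> = (\<integral>\<^sup>+a. indicator ?S a \<partial>?N)" using S by simp
  also have "\<dots> = (\<integral>\<^sup>+a. ennreal ((\<lambda>v. if v \<in> A then 0 else 1) (stopped_chain D x k a)) \<partial>?N)"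
    by (rule nn_integral_cong) (auto simp: indicator_def)
  also have "\<dots> = ennreal ((avg_off U n D ^^ k) (\<lambda>v. if v \<in> A then 0 else 1) x)"
    by (rule nn_integral_stopped_chain[OF n fin x]) auto
  finally show ?thesis .
qed

text \<open>A holding time 0 would let the walk skip a vertex of the jump chain; positivity ties the
  hitting times to the order of the visits.\<close>

lemma AE_holding_times_pos:
  assumes "n > 0"
  shows "AE \<omega> in walk_space U n. \<forall>i. snd \<omega> i > 0"
proof -
  let ?e = "density lborel (exponential_density (2 * (of_nat n)\<^sup>2))"
  let ?N = "arrow_space U n" and ?H = "\<Pi>\<^sub>M k\<in>(UNIV::nat set). ?e"
  have pe: "prob_space ?e" by (rule prob_space_exponential_density) (use assms in simp)
  interpret H: prob_space ?H by (intro prob_space_PiM pe)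
  interpret N: prob_space ?N
    by (intro prob_space_PiM prob_space_uniform_count_measure finite_targets assms)
      (auto simp: targets_def)
  interpret pair_prob_space ?N ?H ..
  have "AE t in lborel. t \<noteq> (0::real)" by (rule AE_lborel_singleton)
  then have "AE t in ?e. t > 0"
    by (subst AE_density) (auto simp: exponential_density_def elim!: eventually_mono)
  then have "AE h in ?H. h i > 0" for i
    using pe by (intro AE_PiM_component) auto
  then have "AE h in ?H. \<forall>i. h i > 0" by (simp add: AE_all_countable)
  moreover have "distr (?N \<Otimes>\<^sub>M ?H) ?H snd = ?H"
  proof (rule measure_eqI)
    fix B assume "B \<in> sets (distr (?N \<Otimes>\<^sub>M ?H) ?H snd)"
    then have B: "B \<in> sets ?H" by simp
    have "snd -` B \<inter> space (?N \<Otimes>\<^sub>M ?H) = space ?N \<times> B"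
      using sets.sets_into_space[OF B] by (auto simp: space_pair_measure)
    then show "emeasure (distr (?N \<Otimes>\<^sub>M ?H) ?H snd) B = emeasure ?H B"
      using B by (simp add: emeasure_distr H.emeasure_pair_measure_Times N.emeasure_space_1)
  qed simp
  ultimately have "AE h in distr (?N \<Otimes>\<^sub>M ?H) ?H snd. \<forall>i. h i > 0" by (simp only:)
  then show ?thesis unfolding walk_space_def by (rule AE_distrD[OF measurable_snd])
qed

text \<open>If the stopped chain sits in \<open>A\<close>, the walk is there at the jump time of its arrival and stays until
  the next jump, hence does not enter \<open>S\<close> before a strictly later time.\<close>

lemma hitting_time_less:
  assumes pos: "\<And>i. snd \<omega> i > 0" and AS: "A \<inter> S = {}" and Y: "stopped_chain (A \<union> S) x k (fst \<omega>) \<in> A"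
  shows "hitting_time x A \<omega> < hitting_time x S \<omega>"
proof -
  let ?D = "A \<union> S" and ?Z = "\<lambda>i. jump_chain x i \<omega>" and ?Y = "\<lambda>i. stopped_chain (A \<union> S) x i (fst \<omega>)"
  have "\<exists>i\<le>k. ?Z i \<in> A \<and> (\<forall>l<i. ?Z l \<notin> ?D)"
  proof -
    \<comment> \<open>Invariant of the induction: either the chain is frozen at its first entrance
      into \<open>A \<union> S\<close>, or it has not entered yet and still follows the jump
      chain.\<close>
    have "(\<exists>i\<le>k. ?Z i = ?Y k \<and> ?Y k \<in> ?D \<and> (\<forall>l<i. ?Z l \<notin> ?D)) \<or> (?Y k = ?Z k \<and> (\<forall>l\<le>k. ?Z l \<notin> ?D))"
      (is "?stopped k \<or> ?running k") for k
    proof (induction k)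
      case 0
      show ?case by (cases "x \<in> ?D") simp_all
    next
      case (Suc k)
      then show ?case
      proof
        assume a: "?stopped k"
        then have "?Y k \<in> ?D" by blast
        then have e: "?Y (Suc k) = ?Y k" by simp
        show ?thesis unfolding e using a le_SucI by blast
      next
        assume a: "?running k"
        then have "?Z k \<notin> ?D" by blast
        then have e: "?Y (Suc k) = ?Z (Suc k)" using a by simp
        show ?thesis
        proof (cases "?Z (Suc k) \<in> ?D")
          case True
          have "\<forall>l<Suc k. ?Z l \<notin> ?D" using a less_Suc_eq_le by blast
          then have "?stopped (Suc k)" unfolding e using True by blast
          then show ?thesis by blast
        next
          case False
          have "\<forall>l\<le>Suc k. ?Z l \<notin> ?D" using a False le_Suc_eq by metis
          then show ?thesis using e by blast
        qed
      qed
    qed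
    from this[of k] show ?thesis
    proof
      assume "?running k"
      then have "?Y k \<notin> ?D" by force
      then show ?thesis using Y by blast
    qed (use Y in force)
  qed
  then obtain i where i: "?Z i \<in> A" "\<And>l. l < i \<Longrightarrow> ?Z l \<notin> ?D" by blast
  have mono: "jump_time a \<omega> < jump_time b \<omega>" if "a < b" for a b
    using that
  proof (induction rule: strict_inc_induct)
    case (base i)
    then show ?case using pos[of i] by (simp add: jump_time_def)
  next
    case (step i)
    then show ?case using pos[of i] by (simp add: jump_time_def)
  qed
  have nonneg: "jump_time i \<omega> \<ge> 0" unfolding jump_time_def using pos by (intro sum_nonneg less_imp_le)
  have "(LEAST k. jump_time i \<omega> < jump_time (Suc k) \<omega>) = i"
  proof (rule Least_equality)
    show "jump_time i \<omega> < jump_time (Suc i) \<omega>" by (rule mono) simp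
    fix j assume "jump_time i \<omega> < jump_time (Suc j) \<omega>"
    then have "\<not> Suc j < i" "Suc j \<noteq> i" using mono[of "Suc j" i] by force+
    then show "i \<le> j" by linarith
  qed
  then have "walk x (jump_time i \<omega>) \<omega> \<in> A" unfolding walk_def using i(1) by simp
  then have "hitting_time x A \<omega> \<le> ereal (jump_time i \<omega>)"
    unfolding hitting_time_def using nonneg by (intro Inf_lower) blast
  also have "\<dots> < ereal (jump_time (Suc i) \<omega>)" using mono[of i "Suc i"] by simp
  also have "\<dots> \<le> hitting_time x S \<omega>"
    unfolding hitting_time_def
  proof (rule Inf_greatest, clarify)
    fix t assume t: "0 \<le> t" "walk x t \<omega> \<in> S"
    show "ereal (jump_time (Suc i) \<omega>) \<le> ereal t"
    proof (rule ccontr)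
      assume "\<not> ?thesis"
      then have "t < jump_time (Suc i) \<omega>" by simp
      then have "(LEAST k. t < jump_time (Suc k) \<omega>) \<le> i" by (rule Least_le)
      then have "walk x t \<omega> \<notin> S"
        unfolding walk_def using i AS le_neq_implies_less by blast
      then show False using t(2) by simp
    qed
  qed
  finally show ?thesis .
qed

text \<open>By \<open>hitting_time_less\<close>, almost surely a walk that reaches \<open>S\<close>
  no later than \<open>A\<close> has its stopped chain outside \<open>A\<close> at every step. The
  bound for each \<open>k\<close> permits the limit later.\<close>

lemma hit_before_prob_le:
  assumes n: "n > 0" and fin: "finite (verts U n)" and x: "x \<in> verts U n" and AS: "A \<inter> S = {}"
  shows "hit_before_prob U n x S A \<le> ennreal ((avg_off U n (A \<union> S) ^^ k) (\<lambda>v. if v \<in> A then 0 else 1) x)"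
proof -
  let ?W = "walk_space U n"
  let ?B = "{\<omega> \<in> space ?W. stopped_chain (A \<union> S) x k (fst \<omega>) \<notin> A}"
  have "?B = (\<lambda>\<omega>. stopped_chain (A \<union> S) x k (fst \<omega>)) -` (verts U n - A) \<inter> space ?W"
    using measurable_space[OF measurable_stopped_chain[OF x]]
    by (auto simp: walk_space_def space_pair_measure)
  moreover have "(\<lambda>\<omega>. stopped_chain (A \<union> S) x k (fst \<omega>)) \<in> measurable ?W (count_space (verts U n))"
    unfolding walk_space_def
    by (rule measurable_compose[OF measurable_fst measurable_stopped_chain[OF x]])
  ultimately have B: "?B \<in> sets ?W"
    using measurable_sets[of _ ?W "count_space (verts U n)" "verts U n - A"] by simp
  have "hit_before_prob U n x S A \<le> emeasure ?W ?B"
    unfolding hit_before_prob_def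
  proof (rule emeasure_mono_AE[OF _ B])
    show "AE \<omega> in ?W. \<omega> \<in> {\<omega> \<in> space ?W. hitting_time x S \<omega> \<le> hitting_time x A \<omega>} \<longrightarrow> \<omega> \<in> ?B"
      using AE_holding_times_pos[OF n, of U]
      by (rule eventually_mono) (use hitting_time_less[OF _ AS] in \<open>force simp: not_less[symmetric]\<close>)
  qed
  also have "\<dots> = ennreal ((avg_off U n (A \<union> S) ^^ k) (\<lambda>v. if v \<in> A then 0 else 1) x)"
    by (rule emeasure_stopped_chain[OF n fin x])
  finally show ?thesis .
qed

text \<open>Never hitting \<open>A \<union> S\<close> counts as hitting \<open>S\<close> here, so that recurrence of the walk is not needed.\<close>

lemma harmonic_majorant:
  assumes n: "n > 0" and fin: "finite (verts U n)" and AS: "A \<inter> S = {}"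
  obtains h where "\<forall>v. 0 \<le> h v" "\<forall>v. h v \<le> 1" "\<forall>v\<in>A. h v = 0"
    "\<forall>v. v \<notin> A \<longrightarrow> v \<notin> S \<longrightarrow> (\<Sum>w | adj U n v w. h v - h w) = 0"
    "\<forall>x\<in>verts U n. hit_before_prob U n x S A \<le> ennreal (h x)"
proof -
  define T where "T = avg_off U n (A \<union> S)"
  define u0 :: "complex \<Rightarrow> real" where "u0 = (\<lambda>v. if v \<in> A then 0 else 1)"
  define u where "u k = (T ^^ k) u0" for k
  have uSuc: "u (Suc k) = T (u k)" for k unfolding u_def by simp
  have tgt: "finite (targets U n v)" "targets U n v \<noteq> {}" for v
    using finite_targets[OF n] by (auto simp: targets_def)
  have card: "real (card (targets U n v)) > 0" for v using tgt[of v] by (simp add: card_gt_0_iff)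
  have u_0: "u 0 = u0" unfolding u_def by simp
  have T_on: "T f v = f v" if "v \<in> A \<union> S" for f v using that by (simp add: T_def avg_off_def)
  have T_off: "T f v = (\<Sum>w\<in>targets U n v. f w) / real (card (targets U n v))"
    if "v \<notin> A" "v \<notin> S" for f v using that by (simp add: T_def avg_off_def)
  have uA: "u k v = 0" if "v \<in> A" for k v
  proof (induction k)
    case 0
    show ?case using that by (simp add: u_0 u0_def)
  next
    case (Suc k)
    then show ?case using that by (simp add: uSuc T_on)
  qed
  have u01: "0 \<le> u k v" for k v
  proof (induction k arbitrary: v)
    case 0
    show ?case by (simp add: u_0 u0_def)
  next
    case (Suc k)
    then show ?case unfolding uSuc T_def by (rule avg_off_nonneg)
  qed
  \<comment> \<open>The start \<open>u0\<close> is 0 on \<open>A\<close> and maximal elsewhere, so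
    the first averaging cannot increase it; monotonicity of the operator propagates this.\<close>
  have dec: "u (Suc k) v \<le> u k v" for k v
  proof (induction k arbitrary: v)
    case 0
    show ?case
    proof (cases "v \<in> A \<union> S")
      case False
      have "(\<Sum>w\<in>targets U n v. u0 w) \<le> (\<Sum>w\<in>targets U n v. 1)"
        by (rule sum_mono) (simp add: u0_def)
      then show ?thesis using False card[of v] by (simp add: u_0 uSuc T_off) (simp add: u0_def)
    qed (simp add: uSuc T_on)
  next
    case (Suc k)
    show ?case unfolding uSuc[of "Suc k"] uSuc[of k, THEN fun_cong, of v] T_def
      by (rule avg_off_mono) (rule Suc)
  qed
  have le1: "u k v \<le> 1" for k v
  proof (induction k)
    case 0
    show ?case by (simp add: u_0 u0_def)
  next
    case (Suc k)
    then show ?case using dec[of k v] by linarith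
  qed
  define h where "h v = lim (\<lambda>k. u k v)" for v
  have lim: "(\<lambda>k. u k v) \<longlonglongrightarrow> h v" for v
  proof -
    have "decseq (\<lambda>k. u k v)" by (intro decseq_SucI dec)
    then obtain l where "(\<lambda>k. u k v) \<longlonglongrightarrow> l"
      by (rule decseq_convergent[where B=0]) (simp add: u01)
    then have "convergent (\<lambda>k. u k v)" by (rule convergentI)
    then show ?thesis unfolding h_def by (simp add: convergent_LIMSEQ_iff)
  qed
  show ?thesis
  proof (rule that[of h]; intro allI ballI impI)
    show "0 \<le> h v" for v by (rule LIMSEQ_le_const[OF lim]) (simp add: u01)
    show "h v \<le> 1" for v by (rule LIMSEQ_le_const2[OF lim]) (simp add: le1)
    show "h v = 0" if "v \<in> A" for v
      using LIMSEQ_unique[OF lim[of v, unfolded uA[OF that]] tendsto_const] .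
    show "(\<Sum>w | adj U n v w. h v - h w) = 0" if v: "v \<notin> A" "v \<notin> S" for v
    proof (cases "\<exists>w. adj U n v w")
      case True
      then have t: "targets U n v = {w. adj U n v w}" by (simp add: targets_def)
      \<comment> \<open>A vertex has finitely many targets, so averaging passes to the limit and
        turns the recursion into harmonicity.\<close>
      have "(\<lambda>k. T (u k) v) \<longlonglongrightarrow> (\<Sum>w\<in>targets U n v. h w) / real (card (targets U n v))"
        unfolding T_off[OF v] by (intro tendsto_divide tendsto_sum lim tendsto_const) (use card[of v] in simp)
      moreover have "(\<lambda>k. T (u k) v) \<longlonglongrightarrow> h v" using LIMSEQ_Suc[OF lim[of v]] by (simp add: uSuc)
      ultimately have "h v = (\<Sum>w\<in>targets U n v. h w) / real (card (targets U n v))"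
        by (rule LIMSEQ_unique[rotated])
      then have "h v * real (card {w. adj U n v w}) = (\<Sum>w | adj U n v w. h w)"
        using card[of v] unfolding t by (simp add: nonzero_eq_divide_eq)
      then show ?thesis by (simp add: sum_subtractf mult.commute)
    qed simp
    show "hit_before_prob U n x S A \<le> ennreal (h x)" if x: "x \<in> verts U n" for x
    proof (rule LIMSEQ_le_const)
      show "(\<lambda>k. ennreal (u k x)) \<longlonglongrightarrow> ennreal (h x)" by (intro tendsto_ennrealI lim)
      have "hit_before_prob U n x S A \<le> ennreal (u k x)" for k
        unfolding u_def T_def u0_def by (rule hit_before_prob_le[OF n fin x AS])
      then show "\<exists>N. \<forall>k\<ge>N. hit_before_prob U n x S A \<le> ennreal (u k x)" by simp
    qed
  qed
qed

section \<open>Charts of a smooth domain\<close>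

text \<open>The analytic parametrisation lives on an annulus around the unit circle. Each half of
  the annulus has a connected image that avoids the frontier, hence lies entirely inside or entirely
  outside \<open>U\<close>, and exactly one lies inside. The inverse of the parametrisation serves
  as \<open>f\<close>, followed by \<open>inverse\<close> if it is the outer half.\<close>

lemma smooth_domain_collar:
  assumes "smooth_domain U"
  obtains W f where "open W" "frontier U \<subseteq> W" "f holomorphic_on W" "inj_on f W"
    "\<forall>z\<in>W. z \<in> U \<longleftrightarrow> cmod (f z) < 1"
proof -
  have U: "open U" "U \<noteq> {}" "bounded U" "analytic_curve (frontier U)"
    using assms by (auto simp: smooth_domain_def)
  obtain W0 \<phi> where W0: "open W0" "sphere 0 1 \<subseteq> W0" "\<phi> holomorphic_on W0" "inj_on \<phi> W0"
    and \<phi>: "\<phi> ` sphere 0 1 = frontier U"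
    using U(4) unfolding analytic_curve_def by blast
  obtain e0 where e0: "e0 > 0" "(\<Union>x\<in>sphere 0 1. cball x e0) \<subseteq> W0"
    using compact_subset_open_imp_cball_epsilon_subset[OF compact_sphere W0(1,2)] by blast
  define e where "e = min e0 (1/2)"
  have e: "0 < e" "e \<le> e0" "e < 1" unfolding e_def using e0 by auto
  define Ann where "Ann = {w::complex. 1 - e < cmod w \<and> cmod w < 1 + e}"
  define Am where "Am = {w::complex. 1 - e < cmod w \<and> cmod w < 1}"
  define Ap where "Ap = {w::complex. 1 < cmod w \<and> cmod w < 1 + e}"
  have AnnW: "Ann \<subseteq> W0"
  proof
    fix w assume w: "w \<in> Ann"
    then have nz: "cmod w > 0" unfolding Ann_def using e by auto
    have sgnw: "of_real (cmod w) * sgn w = w" using nz by (simp add: sgn_eq)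
    have "sgn w - w = (1 - of_real (cmod w)) * sgn w" by (simp only: left_diff_distrib mult_1 sgnw)
    then have "dist (sgn w) w = cmod ((1 - of_real (cmod w)) * sgn w)" by (simp only: dist_norm)
    also have "\<dots> = \<bar>1 - cmod w\<bar>"
    proof -
      have "cmod (1 - of_real (cmod w)) = \<bar>1 - cmod w\<bar>" by (metis norm_of_real of_real_1 of_real_diff)
      then show ?thesis using nz by (simp add: norm_mult norm_sgn)
    qed
    also have "\<dots> \<le> e0" using w e unfolding Ann_def by auto
    finally have "w \<in> cball (sgn w) e0" by (simp only: mem_cball)
    moreover have "sgn w \<in> sphere 0 1" using nz by (simp add: norm_sgn)
    ultimately show "w \<in> W0" using e0(2) by blast
  qed
  have openAnn: "open Ann"
  proof -
    have "Ann = norm -` {1 - e<..<1 + e}" unfolding Ann_def by auto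
    then show ?thesis
      using open_vimage[OF open_greaterThanLessThan continuous_on_norm[OF continuous_on_id]] by simp
  qed
  have conn: "connected Am" "connected Ap"
    unfolding Am_def Ap_def
    using connected_annulus(1)[of "1 - e" "0::complex" 1] connected_annulus(1)[of 1 "0::complex" "1 + e"]
    by simp_all
  have sub: "Am \<subseteq> Ann" "Ap \<subseteq> Ann" "sphere 0 1 \<subseteq> Ann"
    unfolding Am_def Ap_def Ann_def using e by auto
  have cover: "Ann = Am \<union> sphere 0 1 \<union> Ap"
    unfolding Am_def Ap_def Ann_def using e by auto
  have \<phi>Ann: "\<phi> holomorphic_on Ann" "inj_on \<phi> Ann"
    using W0 AnnW holomorphic_on_subset inj_on_subset by blast+
  define W where "W = \<phi> ` Ann"
  have openW: "open W" unfolding W_def by (rule open_mapping_thm3[OF \<phi>Ann(1) openAnn \<phi>Ann(2)])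
  obtain g where g: "g holomorphic_on W" "\<And>z. z \<in> Ann \<Longrightarrow> g (\<phi> z) = z"
    using holomorphic_has_inverse[OF \<phi>Ann(1) openAnn \<phi>Ann(2)] unfolding W_def by metis
  have FW: "frontier U \<subseteq> W" using \<phi> sub(3) unfolding W_def by blast
  have side: "\<phi> ` B \<subseteq> U \<or> \<phi> ` B \<inter> U = {}" if B: "connected B" "B \<subseteq> Ann" "B \<inter> sphere 0 1 = {}" for B
  proof -
    have "connected (\<phi> ` B)"
      by (meson B(1,2) \<phi>Ann(1) connected_continuous_image continuous_on_subset holomorphic_on_imp_continuous_on)
    moreover have "\<phi> ` B \<inter> frontier U = {}"
      using inj_on_image_Int[OF \<phi>Ann(2) B(2) sub(3)] B(3) \<phi> by auto
    ultimately show ?thesis using connected_Int_frontier[of "\<phi> ` B" U] by blast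
  qed
  have sideAm: "\<phi> ` Am \<subseteq> U \<or> \<phi> ` Am \<inter> U = {}"
    by (rule side[OF conn(1) sub(1)]) (auto simp: Am_def)
  have sideAp: "\<phi> ` Ap \<subseteq> U \<or> \<phi> ` Ap \<inter> U = {}"
    by (rule side[OF conn(2) sub(2)]) (auto simp: Ap_def)
  have FU: "frontier U \<inter> U = {}" using U(1) frontier_disjoint_eq by blast
  \<comment> \<open>Otherwise the closure of \<open>U\<close> would be open, hence the whole plane,
    against boundedness.\<close>
  have not_both: "\<not> (\<phi> ` Am \<subseteq> U \<and> \<phi> ` Ap \<subseteq> U)"
  proof
    assume "\<phi> ` Am \<subseteq> U \<and> \<phi> ` Ap \<subseteq> U"
    then have "W \<subseteq> U \<union> frontier U" unfolding W_def cover using \<phi> by blast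
    then have "closure U = U \<union> W" using FW by (auto simp: closure_Un_frontier)
    then have "open (closure U)" using U(1) openW by (simp add: open_Un)
    then have "closure U = UNIV" using clopen[of "closure U"] U(2) closure_subset by auto
    then show False using bounded_closure[OF U(3)] not_bounded_UNIV by metis
  qed
  \<comment> \<open>Otherwise a neighbourhood of a frontier point would miss
    \<open>U\<close>.\<close>
  have not_none: "\<not> (\<phi> ` Am \<inter> U = {} \<and> \<phi> ` Ap \<inter> U = {})"
  proof
    assume a: "\<phi> ` Am \<inter> U = {} \<and> \<phi> ` Ap \<inter> U = {}"
    have "\<phi> 1 \<in> frontier U" using \<phi> by auto
    then have "\<phi> 1 \<in> W" "\<phi> 1 \<in> closure U" using FW by (auto simp: frontier_def)
    then have "W \<inter> U \<noteq> {}" using open_Int_closure_eq_empty[OF openW] by blast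
    moreover have "W \<inter> U = {}" unfolding W_def cover using a \<phi> FU by (auto simp: image_Un)
    ultimately show False by blast
  qed
  have injg: "inj_on g W" unfolding W_def by (rule inj_on_inverseI[where g=\<phi>]) (use g(2) in auto)
  have onsphere: "\<phi> w \<notin> U" if "cmod w = 1" for w using that \<phi> FU by auto
  show ?thesis
  proof (cases "\<phi> ` Am \<subseteq> U")
    case True
    then have Ap: "\<phi> ` Ap \<inter> U = {}" using sideAp not_both by blast
    show ?thesis
    proof (rule that[OF openW FW g(1) injg ballI])
      fix z assume "z \<in> W"
      then obtain w where w: "w \<in> Ann" "z = \<phi> w" unfolding W_def by blast
      have "\<phi> w \<in> U \<longleftrightarrow> cmod w < 1"
      proof (cases "cmod w" "1::real" rule: linorder_cases)
        case less
        then have "w \<in> Am" using w(1) unfolding Am_def Ann_def by simp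
        then show ?thesis using True less by blast
      next
        case greater
        then have "w \<in> Ap" using w(1) unfolding Ap_def Ann_def by simp
        then show ?thesis using Ap greater by auto
      qed (use onsphere in auto)
      then show "z \<in> U \<longleftrightarrow> cmod (g z) < 1" using w g(2) by simp
    qed
  next
    case False
    then have Am: "\<phi> ` Am \<inter> U = {}" and Ap: "\<phi> ` Ap \<subseteq> U" using sideAm sideAp not_none by blast+
    have g0: "g z \<noteq> 0" if "z \<in> W" for z
      using that g(2) e unfolding W_def Ann_def by auto
    show ?thesis
    proof (rule that[OF openW FW _ _ ballI])
      show "(\<lambda>z. inverse (g z)) holomorphic_on W" using g(1) g0 by (intro holomorphic_intros) auto
      show "inj_on (\<lambda>z. inverse (g z)) W" using injg by (simp add: inj_on_def)
      fix z assume "z \<in> W"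
      then obtain w where w: "w \<in> Ann" "z = \<phi> w" unfolding W_def by blast
      have w0: "cmod w > 0" using w(1) e unfolding Ann_def by auto
      have "\<phi> w \<in> U \<longleftrightarrow> cmod w > 1"
      proof (cases "cmod w" "1::real" rule: linorder_cases)
        case less
        then have "w \<in> Am" using w(1) unfolding Am_def Ann_def by simp
        then show ?thesis using Am less by auto
      next
        case greater
        then have "w \<in> Ap" using w(1) unfolding Ap_def Ann_def by simp
        then show ?thesis using Ap greater by blast
      qed (use onsphere in auto)
      also have "cmod w > 1 \<longleftrightarrow> cmod (inverse w) < 1" using w0 by (simp only: norm_inverse inverse_less_1_iff) simp
      finally show "z \<in> U \<longleftrightarrow> cmod (inverse (g z)) < 1" using w g(2) by simp
    qed
  qed
qed

text \<open>Injectivity makes \<open>deriv f\<close> zero-free, and compactness of a closed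
  neighbourhood of \<open>K\<close> makes its bounds and its modulus of continuity uniform. The last
  estimate is the mean value inequality for \<open>f\<close> minus its linear part at
  \<open>z\<close>.\<close>

lemma injective_holomorphic_uniform_linearization:
  assumes W: "open W" and K: "compact K" "K \<noteq> {}" "K \<subseteq> W" and f: "f holomorphic_on W" "inj_on f W"
  obtains r m M where "0 < r" "0 < m" "m \<le> M" "\<forall>x\<in>K. ball x r \<subseteq> W"
    "\<forall>x\<in>K. \<forall>z\<in>ball x r. m \<le> cmod (deriv f z) \<and> cmod (deriv f z) \<le> M"
    "\<forall>x\<in>K. \<forall>z\<in>ball x r. \<forall>z'\<in>ball x r.
      cmod (f z' - f z - deriv f z * (z' - z)) \<le> m / 4 * cmod (z' - z)"
proof -
  obtain e where e: "e > 0" "(\<Union>x\<in>K. cball x e) \<subseteq> W"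
    using compact_subset_open_imp_cball_epsilon_subset[OF K(1) W K(3)] by blast
  define K2 where "K2 = (\<lambda>(x, y). x + y) ` (K \<times> cball 0 e)"
  have K2: "compact K2" unfolding K2_def case_prod_unfold
    by (intro compact_continuous_image compact_Times K compact_cball continuous_intros)
  have ball: "ball x r \<subseteq> K2" if "x \<in> K" "r \<le> e" for x r
  proof
    fix z assume "z \<in> ball x r"
    then have "z = x + (z - x)" "z - x \<in> cball 0 e" using that by (auto simp: dist_norm norm_minus_commute)
    then show "z \<in> K2" unfolding K2_def using that(1) by force
  qed
  have K2W: "K2 \<subseteq> W"
  proof
    fix z assume "z \<in> K2"
    then obtain x y where "x \<in> K" "y \<in> cball 0 e" "z = x + y" unfolding K2_def by auto
    then have "z \<in> cball x e" by (simp add: dist_norm)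
    then show "z \<in> W" using e(2) \<open>x \<in> K\<close> by blast
  qed
  have K2ne: "K2 \<noteq> {}" using K(2) e(1) unfolding K2_def by auto
  have cont: "continuous_on K2 (deriv f)"
    using holomorphic_on_imp_continuous_on[OF holomorphic_deriv[OF f(1) W]] K2W continuous_on_subset by blast
  then have contn: "continuous_on K2 (\<lambda>z. cmod (deriv f z))" by (intro continuous_intros)
  obtain z0 where z0: "z0 \<in> K2" "\<And>z. z \<in> K2 \<Longrightarrow> cmod (deriv f z0) \<le> cmod (deriv f z)"
    using continuous_attains_inf[OF K2 K2ne contn] by blast
  obtain z1 where z1: "z1 \<in> K2" "\<And>z. z \<in> K2 \<Longrightarrow> cmod (deriv f z) \<le> cmod (deriv f z1)"
    using continuous_attains_sup[OF K2 K2ne contn] by blast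
  define m where "m = cmod (deriv f z0)"
  define M where "M = cmod (deriv f z1)"
  have "deriv f z0 \<noteq> 0"
    using holomorphic_injective_imp_regular[OF f(1) W f(2)] z0(1) K2W by blast
  then have m0: "m > 0" unfolding m_def by simp
  obtain d where d: "d > 0" "\<And>z z'. z \<in> K2 \<Longrightarrow> z' \<in> K2 \<Longrightarrow> dist z' z < d \<Longrightarrow> dist (deriv f z') (deriv f z) < m / 4"
    using compact_uniformly_continuous[OF cont K2] m0 unfolding uniformly_continuous_on_def
    by (metis divide_pos_pos zero_less_numeral)
  define r where "r = min e (d / 2)"
  have r: "r > 0" "r \<le> e" "2 * r \<le> d" unfolding r_def using e d by auto
  show ?thesis
  proof (rule that[of r m M]; (intro ballI)?)
    show "m \<le> M" unfolding m_def M_def using z0(2) z1(1) by blast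
    show "ball x r \<subseteq> W" if "x \<in> K" for x using ball[OF that r(2)] K2W by blast
    show "m \<le> cmod (deriv f z) \<and> cmod (deriv f z) \<le> M" if "x \<in> K" "z \<in> ball x r" for x z
      using ball[OF that(1) r(2)] that(2) z0(2) z1(2) unfolding m_def M_def by blast
    show "cmod (f z' - f z - deriv f z * (z' - z)) \<le> m / 4 * cmod (z' - z)"
      if x: "x \<in> K" and z: "z \<in> ball x r" "z' \<in> ball x r" for x z z'
    proof -
      have sub: "ball x r \<subseteq> K2" using ball[OF x r(2)] .
      define g where "g w = f w - deriv f z * w" for w
      have "norm (g z' - g z) \<le> m / 4 * norm (z' - z)"
      proof (rule field_differentiable_bound[of "ball x r" g "\<lambda>w. deriv f w - deriv f z"])
        fix w assume w: "w \<in> ball x r"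
        have "(f has_field_derivative deriv f w) (at w)"
          using holomorphic_derivI[OF f(1) W] w sub K2W by blast
        then have "(f has_field_derivative deriv f w) (at w within ball x r)"
          by (rule DERIV_subset) simp
        then show "(g has_field_derivative deriv f w - deriv f z) (at w within ball x r)"
          unfolding g_def by (auto intro!: derivative_eq_intros)
        have "dist w z < d"
          using w z(1) r(3) dist_triangle2[of w z x] by (simp add: dist_commute)
        then have "dist (deriv f w) (deriv f z) < m / 4" using d(2)[of z w] w z(1) sub by blast
        then show "norm (deriv f w - deriv f z) \<le> m / 4" by (simp only: dist_norm less_imp_le)
      qed (use z in auto)
      then show ?thesis unfolding g_def by (simp add: algebra_simps)
    qed
  qed (use r m0 in auto)
qed

text \<open>The last condition, a lattice direction that points into \<open>U\<close> at a linear rate, lets lattice paths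
  leave the boundary layer in which an edge may cross the boundary.\<close>

definition chart :: "real \<Rightarrow> real \<Rightarrow> real \<Rightarrow> complex set \<Rightarrow> complex \<Rightarrow> (complex \<Rightarrow> complex) \<Rightarrow> bool" where
  "chart r L \<kappa> U x f \<longleftrightarrow>
     (\<forall>z\<in>ball x (2 * r). \<forall>w\<in>ball x (2 * r).
        cmod (z - w) \<le> L * cmod (f z - f w) \<and> cmod (f z - f w) \<le> L * cmod (z - w)) \<and>
     ball (f x) (r / L) \<subseteq> f ` ball x r \<and>
     (\<forall>z\<in>ball x (2 * r). z \<in> U \<longleftrightarrow> cmod (f z) < 1) \<and>
     (\<forall>z\<in>U \<inter> ball x r. \<exists>d\<in>{1, -1, \<i>, -\<i>}. \<forall>t. 0 \<le> t \<and> t \<le> r \<longrightarrow>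
        z + of_real t * d \<in> U \<and> \<kappa> * t \<le> 1 - cmod (f (z + of_real t * d)))"

text \<open>One of the two coordinates of \<open>a\<close> carries at least half of the modulus. For
  \<open>a = cnj (f z) * deriv f z\<close>, the number \<open>Re (a * d)\<close> is half the
  derivative of the squared modulus of \<open>f\<close> at \<open>z\<close> in direction
  \<open>d\<close>.\<close>

lemma lattice_direction:
  fixes a :: complex
  obtains d where "d \<in> {1, -1, \<i>, -\<i>}" "Re (a * d) \<le> - cmod a / 2"
proof -
  have "cmod a \<le> \<bar>Re a\<bar> + \<bar>Im a\<bar>" by (rule cmod_le)
  then consider "Re a \<le> - cmod a / 2" | "- Re a \<le> - cmod a / 2" | "Im a \<le> - cmod a / 2" | "- Im a \<le> - cmod a / 2"
    by linarith
  then show ?thesis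
  proof cases
    case 1
    then show ?thesis using that[of 1] by simp
  next
    case 2
    then show ?thesis using that[of "-1"] by simp
  next
    case 3
    then show ?thesis using that[of "-\<i>"] by simp
  next
    case 4
    then show ?thesis using that[of "\<i>"] by simp
  qed
qed

text \<open>In the expansion of the squared modulus the linear term is at most
  \<open>- t * m * cmod w\<close>. The quadratic one, at most \<open>t\<^sup>2 * M\<^sup>2\<close>,
  uses up no more than a quarter of it, as \<open>t\<close> is small and \<open>cmod w\<close> at
  least 1/2. So the modulus drops by \<open>3 / 8 * m * t\<close>, and the error \<open>e\<close>
  gives back at most \<open>m / 4 * t\<close>.\<close>

lemma norm_push_le:
  fixes w a d e :: complex and t m M :: real
  assumes w: "1 / 2 \<le> cmod w" and a: "m \<le> cmod a" "cmod a \<le> M" and m: "0 < m"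
    and d: "cmod d = 1" "Re (cnj w * a * d) \<le> - cmod (cnj w * a) / 2"
    and t: "0 \<le> t" "t \<le> m / (8 * M\<^sup>2)" and e: "cmod e \<le> m / 4 * t"
  shows "cmod (w + of_real t * a * d + e) \<le> cmod w - m / 8 * t"
proof -
  have M: "M > 0" "m \<le> M" using a m by linarith+
  have tM: "8 * t * M\<^sup>2 \<le> m" using t(2) M by (simp add: field_simps)
  have tm: "8 * t * m \<le> 1"
  proof -
    have "m * m \<le> M\<^sup>2" unfolding power2_eq_square using M m by (intro mult_mono) auto
    then have "8 * t * (m * m) \<le> 8 * t * M\<^sup>2" using t by (intro mult_left_mono) auto
    then have "(8 * t * m) * m \<le> 1 * m" using tM by (simp add: mult_ac)
    then show ?thesis using m by simp
  qed
  have "(cmod (w + of_real t * a * d))\<^sup>2 = (cmod w)\<^sup>2 + 2 * t * Re (cnj w * a * d) + t\<^sup>2 * (cmod a)\<^sup>2"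
  proof -
    have "(cmod (w + v))\<^sup>2 = (cmod w)\<^sup>2 + 2 * Re (cnj w * v) + (cmod v)\<^sup>2" for v
      unfolding cmod_power2 by (simp add: power2_eq_square algebra_simps)
    note expand = this[of "of_real t * a * d"]
    have "Re (of_real t * q) = t * Re q" for q by simp
    from this[of "cnj w * a * d"] have 1: "Re (cnj w * (of_real t * a * d)) = t * Re (cnj w * a * d)"
      by (simp only: mult_ac)
    have 2: "(cmod (of_real t * a * d))\<^sup>2 = t\<^sup>2 * (cmod a)\<^sup>2"
      using d(1) by (simp add: norm_mult power_mult_distrib)
    show ?thesis unfolding expand 1 2 by (simp only: mult.assoc)
  qed
  also have "\<dots> \<le> (cmod w)\<^sup>2 + 2 * t * (- (cmod w * m) / 2) + t\<^sup>2 * M\<^sup>2"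
  proof -
    have "cmod w * m \<le> cmod (cnj w * a)" using a(1) by (simp add: norm_mult mult_left_mono)
    then have "Re (cnj w * a * d) \<le> - (cmod w * m) / 2" using d(2) by linarith
    then have "2 * t * Re (cnj w * a * d) \<le> 2 * t * (- (cmod w * m) / 2)"
      using t(1) by (intro mult_left_mono) auto
    moreover have "t\<^sup>2 * (cmod a)\<^sup>2 \<le> t\<^sup>2 * M\<^sup>2"
      using a(2) by (intro mult_left_mono power_mono) auto
    ultimately show ?thesis by linarith
  qed
  also have "\<dots> \<le> (cmod w - 3 / 8 * m * t)\<^sup>2"
  proof -
    have "t * (t * M\<^sup>2) \<le> t * (m / 4 * cmod w)"
    proof (rule mult_left_mono)
      have "t * M\<^sup>2 \<le> m / 8" using tM by simp
      also have "\<dots> \<le> m / 4 * cmod w" using mult_left_mono[OF w, of "m / 4"] m by simp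
      finally show "t * M\<^sup>2 \<le> m / 4 * cmod w" .
    qed (rule t(1))
    moreover have "(3 / 8 * m * t)\<^sup>2 \<ge> 0" by simp
    ultimately show ?thesis by (simp add: power2_eq_square algebra_simps)
  qed
  finally have "cmod (w + of_real t * a * d) \<le> cmod w - 3 / 8 * m * t"
    by (rule power2_le_imp_le) (use tm w in \<open>simp add: mult_ac\<close>)
  then show ?thesis using norm_triangle_ineq[of "w + of_real t * a * d" e] e by (simp add: mult_ac)
qed

text \<open>The collar map itself is the chart. Its linearisation error is a quarter of the lower
  derivative bound, which yields both Lipschitz estimates; the inward push follows
  \<open>lattice_direction\<close>, with the linearisation error as \<open>e\<close> in
  \<open>norm_push_le\<close>.\<close>

lemma boundary_chart:
  assumes f: "f holomorphic_on W" and WU: "\<And>z. z \<in> W \<Longrightarrow> z \<in> U \<longleftrightarrow> cmod (f z) < 1"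
    and W: "open W" "ball x (4 * r) \<subseteq> W" and r: "0 < r" "r \<le> m / (8 * M\<^sup>2)" "r * L \<le> 1 / 4"
    and m: "0 < m" "m \<le> M" and L: "2 * M \<le> L" "2 \<le> m * L" and \<kappa>: "\<kappa> \<le> m / 8" "\<kappa> * r \<le> 1 / 4" "0 < \<kappa>"
    and der: "\<And>z. z \<in> ball x (4 * r) \<Longrightarrow> m \<le> cmod (deriv f z) \<and> cmod (deriv f z) \<le> M"
    and lin: "\<And>z z'. z \<in> ball x (4 * r) \<Longrightarrow> z' \<in> ball x (4 * r) \<Longrightarrow>
      cmod (f z' - f z - deriv f z * (z' - z)) \<le> m / 4 * cmod (z' - z)"
  shows "chart r L \<kappa> U x f"
proof -
  let ?B = "ball x (4 * r)"
  have L0: "L > 0" using L m by linarith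
  have sub: "ball x (2 * r) \<subseteq> ?B" "cball x r \<subseteq> ?B" "ball x r \<subseteq> ?B" using r(1) by (auto simp: subset_ball)
  have bilip: "cmod (z - w) \<le> L * cmod (f z - f w) \<and> cmod (f z - f w) \<le> L * cmod (z - w)"
    if zw: "z \<in> ?B" "w \<in> ?B" for z w
  proof -
    let ?D = "deriv f w * (z - w)"
    have D: "m * cmod (z - w) \<le> cmod ?D" "cmod ?D \<le> M * cmod (z - w)"
      using der[OF zw(2)] by (auto simp: norm_mult mult_right_mono)
    have 1: "cmod (f z - f w - ?D) \<le> m / 4 * cmod (z - w)" by (rule lin[OF zw(2,1)])
    have 2: "m / 4 * cmod (z - w) \<le> M * cmod (z - w)" using m by (intro mult_right_mono) auto
    have "cmod (f z - f w) \<le> cmod ?D + cmod (f z - f w - ?D)"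
      using norm_triangle_ineq[of ?D "f z - f w - ?D"] by simp
    also have "\<dots> \<le> 2 * M * cmod (z - w)" using D(2) 1 2 by linarith
    also have "\<dots> \<le> L * cmod (z - w)" using L(1) by (intro mult_right_mono) auto
    finally have up: "cmod (f z - f w) \<le> L * cmod (z - w)" .
    have "cmod ?D \<le> cmod (f z - f w) + cmod (f z - f w - ?D)"
      using norm_triangle_ineq4[of "f z - f w" "f z - f w - ?D"] by simp
    then have "m * cmod (z - w) - m / 4 * cmod (z - w) \<le> cmod (f z - f w)" using D(1) 1 by linarith
    moreover have "m / 4 * cmod (z - w) \<ge> 0" using m by simp
    ultimately have "m / 2 * cmod (z - w) \<le> cmod (f z - f w)" by (simp add: field_simps)
    then have "L * (m / 2 * cmod (z - w)) \<le> L * cmod (f z - f w)" using L0 by (intro mult_left_mono) auto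
    moreover have "1 * cmod (z - w) \<le> (m * L / 2) * cmod (z - w)" using L(2) by (intro mult_right_mono) auto
    ultimately have "cmod (z - w) \<le> L * cmod (f z - f w)" by (simp add: mult_ac)
    then show ?thesis using up by blast
  qed
  have holB: "f holomorphic_on ?B" using f W(2) holomorphic_on_subset by blast
  have inj: "inj_on f (ball x r)"
  proof (rule inj_onI)
    fix z w assume "z \<in> ball x r" "w \<in> ball x r" "f z = f w"
    then have "cmod (z - w) \<le> L * cmod (f z - f w)" using bilip sub(3) by blast
    then show "z = w" using \<open>f z = f w\<close> by simp
  qed
  \<comment> \<open>An open map whose values on the bounding circle keep distance
    \<open>r / L\<close> from \<open>f x\<close> covers the disc of that radius.\<close>
  have surj: "ball (f x) (r / L) \<subseteq> f ` ball x r"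
  proof (rule ball_subset_open_map_image)
    show "continuous_on (closure (ball x r)) f"
      using holomorphic_on_imp_continuous_on[OF holB] sub(2) r(1) by (simp add: continuous_on_subset)
    show "open (f ` interior (ball x r))"
      using open_mapping_thm3[OF holomorphic_on_subset[OF holB sub(3)] open_ball inj] by (simp add: interior_open)
    fix z assume "z \<in> frontier (ball x r)"
    then have z: "dist x z = r" using r(1) by simp
    then have "z \<in> ?B" "x \<in> ?B" using r(1) by auto
    then have "cmod (z - x) \<le> L * cmod (f z - f x)" using bilip by blast
    then show "r / L \<le> norm (f z - f x)" using z L0 by (simp add: dist_norm norm_minus_commute field_simps)
  qed (use r L0 in auto)
  have inU: "z \<in> U \<longleftrightarrow> cmod (f z) < 1" if "z \<in> ?B" for z using WU W(2) that by blast
  have push: "\<exists>d\<in>{1, -1, \<i>, -\<i>}. \<forall>t. 0 \<le> t \<and> t \<le> r \<longrightarrow>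
        z + of_real t * d \<in> U \<and> \<kappa> * t \<le> 1 - cmod (f (z + of_real t * d))" if z: "z \<in> U" "z \<in> ball x r" for z
  proof -
    obtain d where d: "d \<in> {1, -1, \<i>, -\<i>}" "Re (cnj (f z) * deriv f z * d) \<le> - cmod (cnj (f z) * deriv f z) / 2"
      using lattice_direction[of "cnj (f z) * deriv f z"] by (metis (no_types))
    have d1: "cmod d = 1" using d(1) by auto
    have zB: "z \<in> ?B" using z(2) sub by blast
    have fz: "cmod (f z) < 1" using inU[OF zB] z(1) by blast
    have "z + of_real t * d \<in> U \<and> \<kappa> * t \<le> 1 - cmod (f (z + of_real t * d))" if t: "0 \<le> t" "t \<le> r" for t
    proof -
      let ?q = "z + of_real t * d"
      have dq: "cmod (?q - z) = t" using t(1) d1 by (simp add: norm_mult)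
      have qB: "?q \<in> ?B"
      proof -
        have "dist x ?q \<le> dist x z + dist z ?q" by (rule dist_triangle)
        also have "dist z ?q = t" using dq by (simp add: dist_norm norm_minus_commute norm_mult)
        finally show ?thesis using z(2) t r(1) by simp
      qed
      have \<kappa>t: "\<kappa> * t \<le> m / 8 * t" "\<kappa> * t \<le> 1 / 4"
        using \<kappa> t mult_right_mono[of \<kappa> "m / 8" t] mult_left_mono[of t r \<kappa>] by linarith+
      have main: "\<kappa> * t \<le> 1 - cmod (f ?q) \<and> cmod (f ?q) < 1"
      proof (cases "1 / 2 \<le> cmod (f z)")
        case True
        define e where "e = f ?q - f z - deriv f z * (of_real t * d)"
        have "cmod e \<le> m / 4 * t" using lin[OF zB qB] dq unfolding e_def by simp
        note norm_push_le[OF True conjunct1[OF der[OF zB]] conjunct2[OF der[OF zB]] m(1) d1 d(2)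
            t(1) order_trans[OF t(2) r(2)] this]
        also have "f z + of_real t * deriv f z * d + e = f ?q"
        proof -
          have "w + s * a * d + (v - w - a * (s * d)) = v" for w s a v :: complex
            by (simp add: algebra_simps)
          then show ?thesis unfolding e_def .
        qed
        finally have "cmod (f ?q) \<le> cmod (f z) - m / 8 * t" .
        moreover have "m / 8 * t \<ge> 0" using m t by simp
        ultimately show ?thesis using \<kappa>t(1) fz by linarith
      next
        \<comment> \<open>Far from the boundary no descent is required: the push moves
          \<open>f z\<close> by at most 1/4, and \<open>\<kappa> * t\<close> is at most 1/4 as
          well.\<close>
        case False
        have "cmod (f ?q - f z) \<le> L * t" using bilip[OF qB zB] dq by simp
        also have "\<dots> \<le> 1 / 4" using r(3) mult_left_mono[OF t(2) less_imp_le[OF L0]] by (simp add: mult_ac)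
        finally have "cmod (f ?q) < 3 / 4" using False norm_triangle_ineq2[of "f ?q" "f z"] by linarith
        then show ?thesis using \<kappa>t(2) by linarith
      qed
      then show ?thesis using inU[OF qB] by blast
    qed
    then show ?thesis using d(1) by blast
  qed
  show ?thesis unfolding chart_def using bilip sub(1) surj inU push by blast
qed

text \<open>Deep inside \<open>U\<close> a scaling is enough: \<open>4 * r \<le> R\<close> keeps its
  values below 1/2 on the chart, so both sides of the membership condition hold, and the direction
  \<open>1\<close> can always be used.\<close>

lemma interior_chart:
  assumes R: "0 < R" "ball x R \<subseteq> U" and r: "0 < r" "4 * r \<le> R" and L: "R \<le> L" "1 \<le> R * L"
    and \<kappa>: "\<kappa> * r \<le> 1 / 4" "0 < \<kappa>"
  shows "chart r L \<kappa> U x (\<lambda>z. (z - x) / of_real R)"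
proof -
  let ?f = "\<lambda>z. (z - x) / of_real R"
  have L0: "L > 0" using R L by linarith
  have sub: "ball x (2 * r) \<subseteq> U" using R(2) r by (auto simp: subset_eq)
  have diff: "cmod (?f z - ?f w) = cmod (z - w) / R" for z w
    using R(1) by (simp add: norm_divide flip: diff_divide_distrib)
  have bilip: "cmod (z - w) \<le> L * cmod (?f z - ?f w) \<and> cmod (?f z - ?f w) \<le> L * cmod (z - w)" for z w
  proof -
    have "R * cmod (z - w) \<le> L * cmod (z - w)" "1 * cmod (z - w) \<le> (R * L) * cmod (z - w)"
      using L by (intro mult_right_mono; simp)+
    then show ?thesis unfolding diff using R(1) by (simp add: field_simps)
  qed
  have "ball (?f x) (r / L) \<subseteq> ?f ` ball x r"
  proof
    fix w assume "w \<in> ball (?f x) (r / L)"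
    then have "cmod w < r / L" by simp
    then have "R * cmod w < R * (r / L)" using R(1) by (rule mult_strict_left_mono)
    also have "\<dots> \<le> r" using mult_right_mono[OF L(1), of r] L0 r(1) by (simp add: field_simps)
    finally have "x + of_real R * w \<in> ball x r" using R(1) by (simp add: dist_norm norm_mult)
    moreover have "?f (x + of_real R * w) = w" using R(1) by simp
    ultimately show "w \<in> ?f ` ball x r" by (metis image_eqI)
  qed
  moreover have half: "cmod (?f z) < 1 / 2" if "z \<in> ball x (2 * r)" for z
    using that R(1) r by (simp add: norm_divide dist_norm norm_minus_commute field_simps)
  moreover have "\<forall>t. 0 \<le> t \<and> t \<le> r \<longrightarrow>
        z + of_real t * 1 \<in> U \<and> \<kappa> * t \<le> 1 - cmod (?f (z + of_real t * 1))" if z: "z \<in> ball x r" for z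
  proof (intro allI impI)
    fix t assume t: "0 \<le> t \<and> t \<le> r"
    have "dist x (z + of_real t) \<le> dist x z + dist z (z + of_real t)" by (rule dist_triangle)
    also have "dist z (z + of_real t) = t" using t by (simp add: dist_norm)
    finally have q: "z + of_real t \<in> ball x (2 * r)" using z t by simp
    have "\<kappa> * t \<le> 1 / 4" using \<kappa>(1) mult_left_mono[OF conjunct2[OF t] less_imp_le[OF \<kappa>(2)]] by simp
    then show "z + of_real t * 1 \<in> U \<and> \<kappa> * t \<le> 1 - cmod (?f (z + of_real t * 1))"
      using half[OF q] q sub by auto
  qed
  moreover have "z \<in> U \<longleftrightarrow> cmod (?f z) < 1" if "z \<in> ball x (2 * r)" for z
    using half[OF that] sub that by auto
  ultimately show ?thesis unfolding chart_def using bilip by blast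
qed

text \<open>The constants must not depend on \<open>x\<close>, since \<beta> and \<open>C\<close>
  may depend on \<open>c\<close> and \<open>U\<close> only. Compactness of the frontier achieves
  this near it, and all other points keep a fixed distance from it.\<close>

lemma smooth_domain_charts:
  assumes U: "smooth_domain U"
  obtains r L \<kappa> where "0 < r" "1 \<le> L" "0 < \<kappa>" "\<forall>x\<in>U. \<exists>f. chart r L \<kappa> U x f"
proof -
  have U': "open U" "U \<noteq> {}" "bounded U" using U by (auto simp: smooth_domain_def)
  have "U \<noteq> UNIV" using U'(3) not_bounded_UNIV by auto
  then have F: "compact (frontier U)" "frontier U \<noteq> {}"
    using U' by (auto simp: compact_frontier_bounded frontier_eq_empty)
  obtain W f where W: "open W" "frontier U \<subseteq> W" "f holomorphic_on W" "inj_on f W"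
    "\<forall>z\<in>W. z \<in> U \<longleftrightarrow> cmod (f z) < 1"
    by (rule smooth_domain_collar[OF U])
  obtain s m M where s: "0 < s" "0 < m" "m \<le> M" "\<forall>x\<in>frontier U. ball x s \<subseteq> W"
    "\<forall>x\<in>frontier U. \<forall>z\<in>ball x s. m \<le> cmod (deriv f z) \<and> cmod (deriv f z) \<le> M"
    "\<forall>x\<in>frontier U. \<forall>z\<in>ball x s. \<forall>z'\<in>ball x s.
      cmod (f z' - f z - deriv f z * (z' - z)) \<le> m / 4 * cmod (z' - z)"
    by (rule injective_holomorphic_uniform_linearization[OF W(1) F W(2-4)])
  \<comment> \<open>A point closer than \<open>s / 2\<close> to the frontier has
    \<open>ball x (4 * r)\<close> inside a linearised ball, since \<open>4 * r \<le> s / 2\<close>;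
    any other point of \<open>U\<close> has \<open>ball x R\<close> inside \<open>U\<close>.\<close>
  define R where "R = s / 2"
  define L where "L = 1 + 2 * M + 2 / m + R + 1 / R"
  define r where "r = min (s / 8) (min (m / (8 * M\<^sup>2)) (1 / (4 * L)))"
  define \<kappa> where "\<kappa> = min (m / 8) (1 / (4 * r))"
  have R: "R > 0" unfolding R_def using s by simp
  have M: "M > 0" using s by linarith
  have pos: "2 / m > 0" "1 / R > 0" using s R by simp_all
  have L: "L \<ge> 1" "2 * M \<le> L" "R \<le> L" "2 / m \<le> L" "1 / R \<le> L"
    unfolding L_def using M R pos by linarith+
  have L2: "2 \<le> m * L" "1 \<le> R * L" using L(4,5) s R by (simp_all add: field_simps)
  have r: "r > 0" "r \<le> s / 8" "r \<le> m / (8 * M\<^sup>2)" "r \<le> 1 / (4 * L)"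
    unfolding r_def using s M L by auto
  have rL: "r * L \<le> 1 / 4" using r(4) L(1) by (simp add: field_simps)
  have \<kappa>: "\<kappa> > 0" "\<kappa> \<le> m / 8" "\<kappa> \<le> 1 / (4 * r)" unfolding \<kappa>_def using s r by auto
  have \<kappa>r: "\<kappa> * r \<le> 1 / 4" using \<kappa>(3) r(1) by (simp add: field_simps)
  show ?thesis
  proof (rule that[OF r(1) L(1) \<kappa>(1) ballI])
    fix x assume x: "x \<in> U"
    show "\<exists>f. chart r L \<kappa> U x f"
    proof (cases "\<exists>\<xi>\<in>frontier U. dist \<xi> x < R")
      case True
      then obtain \<xi> where \<xi>: "\<xi> \<in> frontier U" "dist \<xi> x < R" by blast
      have sub: "ball x (4 * r) \<subseteq> ball \<xi> s"
      proof
        fix z assume "z \<in> ball x (4 * r)"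
        then show "z \<in> ball \<xi> s" using dist_triangle[of \<xi> z x] \<xi>(2) r(2) unfolding R_def by simp
      qed
      have "chart r L \<kappa> U x f"
      proof (rule boundary_chart[OF W(3) bspec[OF W(5)] W(1) _ r(1,3) rL s(2,3) L(2) L2(1) \<kappa>(2) \<kappa>r \<kappa>(1)])
        show "ball x (4 * r) \<subseteq> W" using sub s(4) \<xi>(1) by blast
        show "m \<le> cmod (deriv f z) \<and> cmod (deriv f z) \<le> M" if "z \<in> ball x (4 * r)" for z
          using s(5) \<xi>(1) sub that by blast
        show "cmod (f z' - f z - deriv f z * (z' - z)) \<le> m / 4 * cmod (z' - z)"
          if "z \<in> ball x (4 * r)" "z' \<in> ball x (4 * r)" for z z'
          using s(6) \<xi>(1) sub that by blast
      qed
      from exI[of "\<lambda>f. chart r L \<kappa> U x f", OF this] show ?thesis .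
    next
      case False
      have "ball x R \<subseteq> U"
      proof (rule ccontr)
        assume a: "\<not> ball x R \<subseteq> U"
        have "x \<in> ball x R" using R by simp
        then have "ball x R \<inter> U \<noteq> {}" "ball x R - U \<noteq> {}" using x a by blast+
        then have "ball x R \<inter> frontier U \<noteq> {}" by (rule connected_Int_frontier[OF connected_ball])
        then show False using False by (auto simp: dist_commute)
      qed
      then have "chart r L \<kappa> U x (\<lambda>z. (z - x) / of_real R)"
        by (intro interior_chart) (use R r L L2 \<kappa> \<kappa>r in \<open>auto simp: R_def\<close>)
      from exI[of "\<lambda>f. chart r L \<kappa> U x f", OF this] show ?thesis .
    qed
  qed
qed

section \<open>The lattice near a point of the domain\<close>

definition rd :: "nat \<Rightarrow> complex \<Rightarrow> complex" where
  "rd n z = Complex (of_int \<lfloor>real n * Re z\<rfloor> / real n) (of_int \<lfloor>real n * Im z\<rfloor> / real n)"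

lemma gridI: "Complex (of_int i / of_nat n) (of_int j / of_nat n) \<in> grid n"
  unfolding grid_def by blast

lemma gridE:
  assumes "z \<in> grid n"
  obtains i j where "z = Complex (of_int i / of_nat n) (of_int j / of_nat n)"
  using assms unfolding grid_def by blast

lemma rd_in_grid: "rd n z \<in> grid n"
  unfolding rd_def by (rule gridI)

lemma rd_grid: "n > 0 \<Longrightarrow> z \<in> grid n \<Longrightarrow> rd n z = z"
  by (auto simp: rd_def elim!: gridE)

lemma grid_translate:
  assumes n: "n > 0" and z: "z \<in> grid n" and d: "d \<in> {1, -1, \<i>, -\<i>}"
  shows "z + of_real (real m / real n) * d \<in> grid n"
proof -
  obtain i j where ij: "z = Complex (of_int i / of_nat n) (of_int j / of_nat n)" using z by (rule gridE)
  have "\<exists>k l. z + of_real (real m / real n) * d = Complex (of_int (i + k) / of_nat n) (of_int (j + l) / of_nat n)"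
  proof -
    consider "d = 1" | "d = -1" | "d = \<i>" | "d = -\<i>" using d by blast
    then show ?thesis
    proof cases
      case 1
      then show ?thesis
        by (intro exI[of _ "int m"] exI[of _ 0]) (simp add: ij complex_eq_iff add_divide_distrib)
    next
      case 2
      then show ?thesis
        by (intro exI[of _ "- int m"] exI[of _ 0]) (simp add: ij complex_eq_iff add_divide_distrib diff_divide_distrib)
    next
      case 3
      then show ?thesis
        by (intro exI[of _ 0] exI[of _ "int m"]) (simp add: ij complex_eq_iff add_divide_distrib)
    next
      case 4
      then show ?thesis
        by (intro exI[of _ 0] exI[of _ "- int m"]) (simp add: ij complex_eq_iff add_divide_distrib diff_divide_distrib)
    qed
  qed
  then show ?thesis using gridI by metis
qed

lemma rd_close:
  assumes n: "n > 0"
  shows "\<bar>Re (rd n z) - Re z\<bar> \<le> 1 / real n" "\<bar>Im (rd n z) - Im z\<bar> \<le> 1 / real n"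
proof -
  have "\<bar>of_int \<lfloor>real n * y\<rfloor> / real n - y\<bar> \<le> 1 / real n" for y :: real
  proof -
    have "\<bar>of_int \<lfloor>real n * y\<rfloor> - real n * y\<bar> \<le> 1" by linarith
    moreover have "of_int \<lfloor>real n * y\<rfloor> / real n - y = (of_int \<lfloor>real n * y\<rfloor> - real n * y) / real n"
      using n by (simp add: field_simps)
    ultimately show ?thesis using n by (simp add: divide_right_mono)
  qed
  then show "\<bar>Re (rd n z) - Re z\<bar> \<le> 1 / real n" "\<bar>Im (rd n z) - Im z\<bar> \<le> 1 / real n"
    unfolding rd_def by simp_all
qed

lemma norm_le_Re_Im: "\<bar>Re (z - w)\<bar> \<le> a \<Longrightarrow> \<bar>Im (z - w)\<bar> \<le> b \<Longrightarrow> dist z w \<le> a + b"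
  using cmod_le[of "z - w"] by (simp add: dist_norm)

lemma dist_rd: "n > 0 \<Longrightarrow> dist (rd n z) z \<le> 2 / real n"
  using norm_le_Re_Im[of "rd n z" z "1 / real n" "1 / real n"] rd_close[of n z] by simp

lemma card_grid_ball:
  assumes n: "n > 0" and a: "a \<ge> 0"
  shows "finite (grid n \<inter> cball c (a / real n))"
    "real (card (grid n \<inter> cball c (a / real n))) \<le> (2 * a + 2)\<^sup>2"
proof -
  define I where "I y = {\<lfloor>real n * y - a\<rfloor>..\<lfloor>real n * y + a\<rfloor>}" for y :: real
  have cardI: "real (card (I y)) \<le> 2 * a + 2" for y
  proof -
    have "real (card (I y)) = real_of_int (\<lfloor>real n * y + a\<rfloor> - \<lfloor>real n * y - a\<rfloor> + 1)"
      unfolding I_def using a by (simp add: floor_mono)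
    also have "\<dots> \<le> 2 * a + 2" by linarith
    finally show ?thesis .
  qed
  define F where "F v = (\<lfloor>real n * Re v\<rfloor>, \<lfloor>real n * Im v\<rfloor>)" for v
  have inj: "inj_on F (grid n)"
  proof (rule inj_onI)
    fix u v assume uv: "u \<in> grid n" "v \<in> grid n" "F u = F v"
    then have "rd n u = rd n v" unfolding F_def rd_def by simp
    then show "u = v" using rd_grid[OF n] uv by metis
  qed
  have sub: "F ` (grid n \<inter> cball c (a / real n)) \<subseteq> I (Re c) \<times> I (Im c)"
  proof (rule image_subsetI)
    fix v assume v: "v \<in> grid n \<inter> cball c (a / real n)"
    have "\<bar>Re v - Re c\<bar> \<le> a / real n" "\<bar>Im v - Im c\<bar> \<le> a / real n"
      using v abs_Re_le_cmod[of "v - c"] abs_Im_le_cmod[of "v - c"]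
      by (auto simp: dist_norm norm_minus_commute)
    then have "real n * \<bar>Re v - Re c\<bar> \<le> a" "real n * \<bar>Im v - Im c\<bar> \<le> a"
      using n by (simp_all add: field_simps)
    then have "\<bar>real n * Re v - real n * Re c\<bar> \<le> a" "\<bar>real n * Im v - real n * Im c\<bar> \<le> a"
      by (simp_all add: abs_mult flip: right_diff_distrib)
    then show "F v \<in> I (Re c) \<times> I (Im c)"
      unfolding F_def I_def by (auto intro!: floor_mono)
  qed
  have finI: "finite (I (Re c) \<times> I (Im c))" unfolding I_def by simp
  have inj': "inj_on F (grid n \<inter> cball c (a / real n))" using inj by (rule inj_on_subset) simp
  show "finite (grid n \<inter> cball c (a / real n))"
    using finite_subset[OF sub finI] inj' finite_image_iff by blast
  have "card (grid n \<inter> cball c (a / real n)) \<le> card (I (Re c) \<times> I (Im c))"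
    using card_inj_on_le[OF inj' sub finI] .
  then have "real (card (grid n \<inter> cball c (a / real n))) \<le> real (card (I (Re c)) * card (I (Im c)))"
    by (simp only: card_cartesian_product of_nat_le_iff)
  also have "\<dots> = real (card (I (Re c))) * real (card (I (Im c)))" by (rule of_nat_mult)
  also have "\<dots> \<le> (2 * a + 2) * (2 * a + 2)"
    using cardI a by (intro mult_mono) auto
  finally show "real (card (grid n \<inter> cball c (a / real n))) \<le> (2 * a + 2)\<^sup>2"
    by (simp add: power2_eq_square)
qed

lemma finite_verts:
  assumes "bounded U" "n > 0"
  shows "finite (verts U n)"
proof -
  obtain B where B: "\<And>z. z \<in> U \<Longrightarrow> cmod z \<le> B" using assms(1) unfolding bounded_iff by blast
  have "cmod z \<le> real n * \<bar>B\<bar> / real n" if "z \<in> U" for z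
    using B[OF that] assms(2) by simp
  then have "verts U n \<subseteq> grid n \<inter> cball 0 (real n * \<bar>B\<bar> / real n)"
    unfolding verts_def by auto
  then show ?thesis by (rule finite_subset) (rule card_grid_ball(1)[OF assms(2)], simp)
qed

definition edges :: "complex set \<Rightarrow> nat \<Rightarrow> (complex \<times> complex) set" where
  "edges U n = {(u, v). adj U n u v}"

lemma sym_edges: "sym (edges U n)"
  unfolding edges_def sym_def adj_def by (simp add: dist_commute closed_segment_commute)

lemma edges_verts: "edges U n \<subseteq> verts U n \<times> verts U n"
  unfolding edges_def adj_def by auto

lemma edges_dist: "(u, v) \<in> edges U n \<Longrightarrow> dist u v = 1 / real n"
  unfolding edges_def adj_def by simp

lemma degree_le:
  assumes "n > 0"
  shows "real (card (edges U n `` {v})) \<le> 16"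
proof -
  have "edges U n `` {v} \<subseteq> grid n \<inter> cball v (1 / real n)"
    unfolding edges_def adj_def verts_def by auto
  then have "card (edges U n `` {v}) \<le> card (grid n \<inter> cball v (1 / real n))"
    using card_grid_ball(1)[OF assms, of 1 v] by (intro card_mono) auto
  then show ?thesis using card_grid_ball(2)[OF assms, of 1 v] by simp
qed

lemma norm_cis_diff_le: "cmod (cis a - cis b) \<le> \<bar>a - b\<bar>"
proof -
  have "cis a = cis b * cis (a - b)" by (simp add: cis_mult)
  then have "cis a - cis b = cis b * (exp (\<i> * of_real (a - b)) - 1)"
    by (simp only: right_diff_distrib cis_conv_exp[symmetric] mult_1_right)
  then have "cmod (cis a - cis b) = 2 * \<bar>sin ((a - b) / 2)\<bar>"
    by (simp only: norm_mult norm_cis dist_exp_i_1 mult_1)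
  also have "\<dots> \<le> 2 * \<bar>(a - b) / 2\<bar>" using abs_sin_x_le_abs_x[of "(a - b) / 2"] by linarith
  finally show ?thesis by simp
qed

text \<open>By the law of cosines, with \<open>u\<close> pointing from \<open>p\<close> towards the
  origin, the squared modulus depends on the angle \<open>t\<close> only through
  \<open>- 2 * cmod p * s * cos t\<close>, which decreases as the angle closes.\<close>

lemma norm_rotate_le:
  assumes u: "cmod u = 1" "p = - of_real (cmod p) * u" and s: "0 \<le> s"
    and ab: "\<bar>b\<bar> \<le> \<bar>a\<bar>" "\<bar>a\<bar> \<le> pi"
  shows "cmod (p + of_real s * cis b * u) \<le> cmod (p + of_real s * cis a * u)"
proof -
  have e: "(cmod (p + of_real s * cis t * u))\<^sup>2 = (cmod p)\<^sup>2 + s\<^sup>2 - 2 * cmod p * s * cos t" for t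
  proof -
    have "p + of_real s * cis t * u = (of_real s * cis t - of_real (cmod p)) * u"
      by (subst u(2)) (simp add: algebra_simps)
    then have "(cmod (p + of_real s * cis t * u))\<^sup>2 = (cmod (of_real s * cis t - of_real (cmod p)))\<^sup>2"
      using u(1) by (simp add: norm_mult)
    also have "\<dots> = (s * cos t - cmod p)\<^sup>2 + (s * sin t)\<^sup>2" by (simp add: cmod_power2)
    also have "(s * x - q)\<^sup>2 + (s * y)\<^sup>2 = q\<^sup>2 + s\<^sup>2 * (x\<^sup>2 + y\<^sup>2) - 2 * q * s * x" for q x y :: real
      by (simp add: power2_eq_square algebra_simps)
    finally show ?thesis by simp
  qed
  have "cos a \<le> cos b" using cos_monotone_0_pi_le[of "\<bar>b\<bar>" "\<bar>a\<bar>"] ab by simp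
  then have "2 * cmod p * s * cos a \<le> 2 * cmod p * s * cos b" using s by (intro mult_left_mono) auto
  then have "(cmod (p + of_real s * cis b * u))\<^sup>2 \<le> (cmod (p + of_real s * cis a * u))\<^sup>2"
    unfolding e by linarith
  then show ?thesis by (rule power2_le_imp_le) simp
qed

lemma nat_ceiling_Suc_bounds:
  assumes "0 \<le> (y::real)"
  shows "y \<le> real (nat \<lceil>y\<rceil> + 1)" "real (nat \<lceil>y\<rceil> + 1) \<le> y + 2"
  using assms by linarith+

text \<open>Collects the demands on the constant \<open>K\<close> of \<open>harmonic_zero\<close>:
  the walk lengths in \<open>level_connected\<close>, the volume bound
  \<open>16 * L\<^sup>2\<close>, and \<open>20\<close> to cover a leftover constant 12 there as well
  as the degree bound 16.\<close>

definition band_width :: "real \<Rightarrow> nat \<Rightarrow> real" where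
  "band_width L K1 = 2 * real K1 + 16 * L + 20 * L * (L * (real K1 + 2)) + 20 + 16 * L\<^sup>2"

section \<open>Connectivity of the levels\<close>

text \<open>\<open>\<rho>\<close> is the distance to \<open>x\<close> in the chart, in lattice units; outside the domain of the chart it is
  just some large number. \<open>K\<^sub>1\<close> lattice steps push a vertex far enough from the boundary.\<close>

locale lattice_chart =
  fixes U :: "complex set" and n :: nat and r L \<kappa> :: real and x :: complex and f :: "complex \<Rightarrow> complex"
    and K1 :: nat and R :: real
  assumes n: "n > 0" and chart: "chart r L \<kappa> U x f" and r: "0 < r" and L: "1 \<le> L"
    and K1: "3 \<le> K1" "4 * L \<le> \<kappa> * real K1"
    and R: "L * (real K1 + 2) \<le> R" "4 * L * R \<le> r * real n"
begin

definition \<rho> :: "complex \<Rightarrow> real" where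
  "\<rho> v = real n * (if v \<in> ball x (2 * r) then cmod (f v - f x) else r)"

abbreviation B :: real where "B \<equiv> L * (real K1 + 2)"

lemma bilip:
  assumes "z \<in> ball x (2 * r)" "w \<in> ball x (2 * r)"
  shows "cmod (z - w) \<le> L * cmod (f z - f w)" "cmod (f z - f w) \<le> L * cmod (z - w)"
  using chart assms unfolding chart_def by blast+

lemma in_U: "z \<in> ball x (2 * r) \<Longrightarrow> z \<in> U \<longleftrightarrow> cmod (f z) < 1"
  using chart unfolding chart_def by blast

lemma n_pos: "0 < real n" using n by simp

lemma R_pos: "0 < R"
proof -
  have "0 < L * (real K1 + 2)" using L by simp
  then show ?thesis using R(1) by linarith
qed

lemma R_le: "2 * R < real n * r"
proof -
  have "1 * R \<le> L * R" by (rule mult_right_mono[OF L less_imp_le[OF R_pos]])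
  moreover have "4 * (L * R) \<le> r * real n" using R(2) by (simp add: mult.assoc)
  ultimately have "2 * R < r * real n" using R_pos by linarith
  then show ?thesis by (simp add: mult.commute)
qed

lemma K1_le: "real K1 / real n \<le> r / 4" "3 / real n \<le> r / 4"
proof -
  have "1 * (real K1 + 2) \<le> R" by (rule order_trans[OF mult_right_mono[OF L] R(1)]) simp
  then have "real K1 \<le> 1 * R" by simp
  also have "\<dots> \<le> L * R" by (rule mult_right_mono[OF L less_imp_le[OF R_pos]])
  finally have "4 * real K1 \<le> 4 * (L * R)" by simp
  also have "\<dots> \<le> r * real n" using R(2) by (simp add: mult.assoc)
  finally have "4 * real K1 \<le> r * real n" .
  then show 1: "real K1 / real n \<le> r / 4" using n_pos by (simp add: field_simps)
  have "3 / real n \<le> real K1 / real n" using K1(1) n_pos by (simp add: divide_right_mono)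
  then show "3 / real n \<le> r / 4" using 1 by linarith
qed

lemma rho_nonneg: "0 \<le> \<rho> v"
  unfolding \<rho>_def using r n_pos by simp

lemma rho_centre: "\<rho> x = 0"
  unfolding \<rho>_def using r by simp

lemma rho_in: "v \<in> ball x (2 * r) \<Longrightarrow> \<rho> v = real n * cmod (f v - f x)"
  unfolding \<rho>_def by simp

text \<open>Values up to \<open>2 * R\<close> are below the default \<open>real n * r\<close>, so
  they come from the chart, whose Lipschitz bound turns them into Euclidean distances.\<close>

lemma rho_small:
  assumes "\<rho> v \<le> t" "t \<le> 2 * R"
  shows "v \<in> ball x (2 * r)" "dist x v \<le> L * t / real n" "dist x v \<le> r / 2"
proof -
  have lt: "\<rho> v < real n * r" using assms R_le by linarith
  show v: "v \<in> ball x (2 * r)"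
  proof (rule ccontr)
    assume "v \<notin> ball x (2 * r)"
    then show False using lt unfolding \<rho>_def by simp
  qed
  have "x \<in> ball x (2 * r)" using r by simp
  then have "dist x v \<le> L * cmod (f v - f x)"
    using bilip(1)[OF v, of x] by (simp add: dist_norm norm_minus_commute)
  also have "cmod (f v - f x) = \<rho> v / real n" using rho_in[OF v] n_pos by simp
  also have "L * \<dots> \<le> L * (t / real n)"
    using assms(1) L n_pos by (intro mult_left_mono divide_right_mono) auto
  finally show 1: "dist x v \<le> L * t / real n" by simp
  have "L * t \<le> L * (2 * R)" using assms(2) L by (intro mult_left_mono) auto
  also have "\<dots> \<le> r / 2 * real n" using R(2) by simp
  finally have "L * t / real n \<le> r / 2" using n_pos by (simp add: field_simps)
  then show "dist x v \<le> r / 2" using 1 by linarith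
qed

lemma rho_lipschitz:
  assumes "u \<in> ball x (2 * r)" "v \<in> ball x (2 * r)"
  shows "\<bar>\<rho> u - \<rho> v\<bar> \<le> L * (real n * dist u v)"
proof -
  have "\<rho> u - \<rho> v = real n * (cmod (f u - f x) - cmod (f v - f x))"
    unfolding rho_in[OF assms(1)] rho_in[OF assms(2)] by (simp add: right_diff_distrib)
  then have "\<bar>\<rho> u - \<rho> v\<bar> = real n * \<bar>cmod (f u - f x) - cmod (f v - f x)\<bar>"
    by (simp add: abs_mult)
  also have "\<dots> \<le> real n * cmod (f u - f v)"
    using norm_triangle_ineq3[of "f u - f x" "f v - f x"] by (intro mult_left_mono) auto
  also have "\<dots> \<le> real n * (L * dist u v)"
    using bilip(2)[OF assms] by (intro mult_left_mono) (auto simp: dist_norm)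
  finally show ?thesis by (simp add: mult_ac)
qed

lemma rho_near:
  assumes "\<rho> u \<le> 2 * R" "real n * dist u v \<le> 3"
  shows "v \<in> ball x (2 * r)" "\<bar>\<rho> u - \<rho> v\<bar> \<le> L * (real n * dist u v)"
proof -
  have u: "u \<in> ball x (2 * r)" "dist x u \<le> r / 2" using rho_small[OF assms(1)] by auto
  have "dist u v \<le> 3 / real n" using assms(2) n_pos by (simp add: field_simps)
  then have "dist u v \<le> r / 4" using K1_le(2) by linarith
  then show v: "v \<in> ball x (2 * r)" using dist_triangle[of x v u] u(2) r by simp
  show "\<bar>\<rho> u - \<rho> v\<bar> \<le> L * (real n * dist u v)" by (rule rho_lipschitz[OF u(1) v])
qed

text \<open>Rounding to the lattice and the edges between rounded points stay within \<open>3 / n\<close>, hence within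
  \<open>3 L / n\<close> in the chart.\<close>

definition safe :: "complex set" where
  "safe = {w \<in> ball (f x) (r / L). cmod w \<le> 1 - 4 * L / real n}"

lemma near_safe:
  assumes z: "z \<in> ball x r" "f z \<in> safe" and y: "dist z y \<le> 3 / real n"
    and s: "\<bar>real n * cmod (f z - f x) - s\<bar> \<le> b"
  shows "y \<in> U" "\<bar>\<rho> y - s\<bar> \<le> b + 3 * L"
proof -
  have z2: "z \<in> ball x (2 * r)" using z(1) r by simp
  have "dist x y < 2 * r"
    using dist_triangle[of x y z] z(1) y K1_le(2) r by simp
  then have y2: "y \<in> ball x (2 * r)" by simp
  have "cmod (f y - f z) \<le> L * dist z y" using bilip(2)[OF y2 z2] by (simp add: dist_norm norm_minus_commute)
  also have "\<dots> \<le> L * (3 / real n)" using y L by (intro mult_left_mono) auto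
  also have "\<dots> = 3 * L / real n" by simp
  finally have 1: "cmod (f y) \<le> cmod (f z) + 3 * L / real n"
    using norm_triangle_ineq2[of "f y" "f z"] by linarith
  have "cmod (f z) \<le> 1 - 4 * L / real n" using z(2) unfolding safe_def by simp
  moreover have "3 * L / real n < 4 * L / real n" using L n_pos by (simp add: divide_strict_right_mono)
  ultimately have "cmod (f y) < 1" using 1 by linarith
  then show "y \<in> U" using in_U[OF y2] by blast
  have "\<bar>\<rho> z - \<rho> y\<bar> \<le> L * (real n * dist z y)" by (rule rho_lipschitz[OF z2 y2])
  also have "\<dots> \<le> L * 3" using y L n_pos by (intro mult_left_mono) (auto simp: field_simps)
  finally show "\<bar>\<rho> y - s\<bar> \<le> b + 3 * L" using s rho_in[OF z2] by linarith
qed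

lemma reach_near_safe:
  assumes z: "z \<in> ball x r" "f z \<in> safe" and s: "\<bar>real n * cmod (f z - f x) - s\<bar> \<le> b"
    and p: "p \<in> grid n" "dist z p \<le> 3 / real n" and q: "q \<in> grid n" "dist z q \<le> 3 / real n"
    and pq: "p = q \<or> dist p q = 1 / real n"
  shows "reach (edges U n) {v \<in> verts U n. \<bar>\<rho> v - s\<bar> \<le> b + 3 * L} 1 p q"
proof (cases "p = q")
  case True
  then show ?thesis by (simp add: reach_refl)
next
  case False
  have V: "y \<in> {v \<in> verts U n. \<bar>\<rho> v - s\<bar> \<le> b + 3 * L}" if "y \<in> grid n" "dist z y \<le> 3 / real n" for y
    using near_safe[OF z that(2) s] that(1) unfolding verts_def by blast
  have "closed_segment p q \<subseteq> cball z (3 / real n)"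
    by (rule closed_segment_subset) (use p q in auto)
  then have "closed_segment p q \<subseteq> U" using near_safe(1)[OF z _ s] by auto
  then have "(p, q) \<in> edges U n"
    using V[OF p] V[OF q] pq False unfolding edges_def adj_def by blast
  then show ?thesis using V[OF p] V[OF q] by (rule reach_edge)
qed

text \<open>Each coordinate changes by at most one lattice unit under rounding of the two points.
  The corner \<open>q\<close> separates the change of the real part from that of the imaginary part,
  hence two steps.\<close>

lemma reach_rd:
  assumes z: "z \<in> ball x r" "f z \<in> safe" "\<bar>real n * cmod (f z - f x) - s\<bar> \<le> b"
    and z': "z' \<in> ball x r" "f z' \<in> safe" "\<bar>real n * cmod (f z' - f x) - s\<bar> \<le> b"
    and zz': "dist z z' \<le> 1 / real n"
  shows "reach (edges U n) {v \<in> verts U n. \<bar>\<rho> v - s\<bar> \<le> b + 3 * L} 2 (rd n z) (rd n z')"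
proof -
  define q where "q = Complex (Re (rd n z')) (Im (rd n z))"
  have step: "a = b \<or> \<bar>of_int a / real n - of_int b / real n\<bar> = 1 / real n"
    if ab: "a = \<lfloor>real n * t\<rfloor>" "b = \<lfloor>real n * t'\<rfloor>" "\<bar>t - t'\<bar> \<le> 1 / real n" for a b :: int and t t' :: real
  proof -
    have "\<bar>real n * t - real n * t'\<bar> \<le> 1"
    proof -
      have "\<bar>real n * t - real n * t'\<bar> = real n * \<bar>t - t'\<bar>" by (simp add: abs_mult flip: right_diff_distrib)
      also have "\<dots> \<le> real n * (1 / real n)" using ab(3) by (intro mult_left_mono) auto
      also have "\<dots> = 1" using n_pos by simp
      finally show ?thesis .
    qed
    then have "\<bar>a - b\<bar> \<le> 1" unfolding ab(1,2) by linarith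
    then consider "a = b" | "a - b = 1" | "a - b = -1" by linarith
    then show ?thesis
    proof cases
      case 2
      then have "of_int a / real n - of_int b / real n = 1 / real n"
        by (simp flip: diff_divide_distrib of_int_diff)
      then show ?thesis by simp
    next
      case 3
      then have "of_int a / real n - of_int b / real n = -1 / real n"
        by (simp flip: diff_divide_distrib of_int_diff)
      then show ?thesis by simp
    qed simp
  qed
  have d: "\<bar>Re z - Re z'\<bar> \<le> 1 / real n" "\<bar>Im z - Im z'\<bar> \<le> 1 / real n"
    using zz' abs_Re_le_cmod[of "z - z'"] abs_Im_le_cmod[of "z - z'"] by (auto simp: dist_norm)
  have c: "\<bar>Re (rd n z) - Re z\<bar> \<le> 1 / real n" "\<bar>Im (rd n z) - Im z\<bar> \<le> 1 / real n"
    "\<bar>Re (rd n z') - Re z'\<bar> \<le> 1 / real n" "\<bar>Im (rd n z') - Im z'\<bar> \<le> 1 / real n"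
    using rd_close[OF n] by blast+
  have three: "3 / real n = 1 / real n + 1 / real n + 1 / real n" by simp
  have in_grid: "rd n z \<in> grid n" "q \<in> grid n" "rd n z' \<in> grid n"
    using rd_in_grid unfolding q_def by (simp_all add: rd_def gridI)
  have near: "dist z (rd n z) \<le> 3 / real n" "dist z q \<le> 3 / real n"
    "dist z' q \<le> 3 / real n" "dist z' (rd n z') \<le> 3 / real n"
  proof -
    have p: "0 \<le> 1 / real n" by simp
    have "dist z (rd n z) \<le> 1 / real n + 1 / real n" by (rule norm_le_Re_Im) (use c in auto)
    then show "dist z (rd n z) \<le> 3 / real n" unfolding three using p by linarith
    have "dist z q \<le> (1 / real n + 1 / real n) + 1 / real n"
      by (rule norm_le_Re_Im) (use c d in \<open>auto simp: q_def\<close>)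
    then show "dist z q \<le> 3 / real n" unfolding three by linarith
    have "dist z' q \<le> 1 / real n + (1 / real n + 1 / real n)"
      by (rule norm_le_Re_Im) (use c d in \<open>auto simp: q_def\<close>)
    then show "dist z' q \<le> 3 / real n" unfolding three by linarith
    have "dist z' (rd n z') \<le> 1 / real n + 1 / real n" by (rule norm_le_Re_Im) (use c in auto)
    then show "dist z' (rd n z') \<le> 3 / real n" unfolding three using p by linarith
  qed
  have dist_axis: "dist p p' = \<bar>Re p - Re p'\<bar>" if "Im p = Im p'" for p p'
    using that by (simp add: dist_norm cmod_def)
  have dist_axis': "dist p p' = \<bar>Im p - Im p'\<bar>" if "Re p = Re p'" for p p'
    using that by (simp add: dist_norm cmod_def)
  have e1: "rd n z = q \<or> dist (rd n z) q = 1 / real n"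
    using step[OF refl refl d(1)] dist_axis[of "rd n z" q] by (auto simp: q_def rd_def)
  have e2: "q = rd n z' \<or> dist q (rd n z') = 1 / real n"
    using step[OF refl refl d(2)] dist_axis'[of q "rd n z'"] by (auto simp: q_def rd_def)
  have "reach (edges U n) {v \<in> verts U n. \<bar>\<rho> v - s\<bar> \<le> b + 3 * L} (1 + 1) (rd n z) (rd n z')"
    using reach_near_safe[OF z in_grid(1) near(1) in_grid(2) near(2) e1]
      reach_near_safe[OF z' in_grid(2) near(3) in_grid(3) near(4) e2] by (rule reach_trans)
  then show ?thesis by (simp add: numeral_2_eq_2)
qed

definition f_inv :: "complex \<Rightarrow> complex" where "f_inv = inv_into (ball x r) f"

lemma f_inv: "w \<in> ball (f x) (r / L) \<Longrightarrow> f_inv w \<in> ball x r \<and> f (f_inv w) = w"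
  using chart inv_into_into[of w f "ball x r"] f_inv_into_f[of w f "ball x r"]
  unfolding chart_def f_inv_def by blast

lemma inj_f: "inj_on f (ball x r)"
proof (rule inj_onI)
  fix z w assume zw: "z \<in> ball x r" "w \<in> ball x r" "f z = f w"
  then have "cmod (z - w) \<le> L * cmod (f z - f w)" using r by (intro bilip) auto
  then show "z = w" using zw(3) by simp
qed

lemma f_inv_f: "v \<in> ball x r \<Longrightarrow> f_inv (f v) = v"
  unfolding f_inv_def by (rule inv_into_f_f[OF inj_f])

text \<open>A curve in the chart sampled at spacing \<open>1 / (L * real n)\<close> pulls back to
  points at most \<open>1 / real n\<close> apart, which \<open>reach_rd\<close> joins.\<close>

lemma reach_sequence:
  assumes "\<And>i. i \<le> N \<Longrightarrow> w i \<in> safe \<and> \<bar>real n * cmod (w i - f x) - s\<bar> \<le> b"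
    and "\<And>i. i < N \<Longrightarrow> cmod (w i - w (Suc i)) \<le> 1 / (L * real n)"
  shows "reach (edges U n) {v \<in> verts U n. \<bar>\<rho> v - s\<bar> \<le> b + 3 * L} (2 * N) (rd n (f_inv (w 0))) (rd n (f_inv (w N)))"
  using assms
proof (induction N)
  case 0
  show ?case by (simp add: reach_refl)
next
  case (Suc N)
  have w: "f_inv (w i) \<in> ball x r \<and> f (f_inv (w i)) = w i" if "i \<le> Suc N" for i
    using f_inv[of "w i"] Suc.prems(1)[OF that] unfolding safe_def by blast
  have 1: "reach (edges U n) {v \<in> verts U n. \<bar>\<rho> v - s\<bar> \<le> b + 3 * L} (2 * N) (rd n (f_inv (w 0))) (rd n (f_inv (w N)))"
    using Suc.prems by (intro Suc.IH) auto
  have "dist (f_inv (w N)) (f_inv (w (Suc N))) \<le> L * cmod (w N - w (Suc N))"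
    using bilip(1)[of "f_inv (w N)" "f_inv (w (Suc N))"] w[of N] w[of "Suc N"] r by (simp add: dist_norm)
  also have "\<dots> \<le> L * (1 / (L * real n))" using Suc.prems(2)[of N] L by (intro mult_left_mono) auto
  also have "\<dots> = 1 / real n" using L by simp
  finally have "dist (f_inv (w N)) (f_inv (w (Suc N))) \<le> 1 / real n" .
  then have 2: "reach (edges U n) {v \<in> verts U n. \<bar>\<rho> v - s\<bar> \<le> b + 3 * L} 2 (rd n (f_inv (w N))) (rd n (f_inv (w (Suc N))))"
    using w[of N] w[of "Suc N"] Suc.prems(1)[of N] Suc.prems(1)[of "Suc N"] by (intro reach_rd) auto
  show ?case using reach_trans[OF 1 2] by simp
qed

lemma safe_iff: "w \<in> safe \<longleftrightarrow> cmod (w - f x) < r / L \<and> cmod w \<le> 1 - 4 * L / real n"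
  unfolding safe_def by (simp add: dist_norm norm_minus_commute)

lemma convex_safe: "convex safe"
proof -
  have "safe = ball (f x) (r / L) \<inter> cball 0 (1 - 4 * L / real n)" unfolding safe_def by auto
  then show ?thesis by (simp add: convex_Int)
qed

lemma two_R_less: "2 * R < real n * (r / L)"
proof -
  have "4 * R \<le> r * real n / L" using R(2) L by (simp add: field_simps)
  then show ?thesis using R_pos by (simp add: mult.commute)
qed

text \<open>The inward direction of the chart is followed for \<open>K1\<close> lattice steps; the
  gain \<open>\<kappa> * real K1 / real n\<close> is at least the margin
  \<open>4 * L / real n\<close> of \<open>safe\<close>. Since the chart condition covers all real
  \<open>t\<close>, whole edges lie in \<open>U\<close> and not only their ends.\<close>

lemma push:
  assumes v: "v \<in> verts U n" "\<rho> v + L * real K1 \<le> 2 * R"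
  obtains v' where "reach (edges U n) {y \<in> verts U n. \<bar>\<rho> y - \<rho> v\<bar> \<le> L * real K1} K1 v v'"
    "v' \<in> verts U n" "v' \<in> ball x r" "f v' \<in> safe" "\<bar>\<rho> v' - \<rho> v\<bar> \<le> L * real K1"
proof -
  have L0: "0 \<le> L * real K1" using L by simp
  have vx: "dist x v \<le> r / 2" using rho_small(3)[OF _ order_refl, of v] v(2) L0 by linarith
  then have "v \<in> U \<inter> ball x r" using v(1) r unfolding verts_def by auto
  then obtain d where d: "d \<in> {1, -1, \<i>, -\<i>}"
    "\<And>t. 0 \<le> t \<Longrightarrow> t \<le> r \<Longrightarrow> v + of_real t * d \<in> U \<and> \<kappa> * t \<le> 1 - cmod (f (v + of_real t * d))"
    using chart unfolding chart_def by blast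
  have d1: "cmod d = 1" using d(1) by auto
  define y where "y m = v + of_real (real m / real n) * d" for m
  have y0: "y 0 = v" unfolding y_def by simp
  have mr: "real m / real n \<le> r / 4" if "m \<le> K1" for m
  proof -
    have "real m / real n \<le> real K1 / real n" using that by (intro divide_right_mono) auto
    then show ?thesis using K1_le(1) by linarith
  qed
  have dvy: "dist v (y m) = real m / real n" for m
    unfolding y_def using d1 by (simp add: dist_norm norm_mult norm_divide)
  have yv: "y m \<in> verts U n" if "m \<le> K1" for m
  proof -
    have "y m \<in> U" unfolding y_def using d(2)[of "real m / real n"] mr[OF that] r by force
    moreover have "y m \<in> grid n"
      unfolding y_def using v(1) d(1) n by (intro grid_translate) (auto simp: verts_def)
    ultimately show ?thesis unfolding verts_def by blast
  qed
  have yb: "y m \<in> ball x r" if "m \<le> K1" for m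
    using dist_triangle[of x "y m" v] vx dvy[of m] mr[OF that] r unfolding mem_ball by linarith
  have yrho: "\<bar>\<rho> (y m) - \<rho> v\<bar> \<le> L * real K1" if "m \<le> K1" for m
  proof -
    have "\<bar>\<rho> (y m) - \<rho> v\<bar> \<le> L * (real n * dist (y m) v)"
      using yb[OF that] yb[of 0] y0 r by (intro rho_lipschitz) auto
    also have "real n * dist (y m) v = real m" using dvy[of m] n_pos by (simp add: dist_commute)
    also have "L * real m \<le> L * real K1" using that L by (intro mult_left_mono) auto
    finally show ?thesis .
  qed
  let ?V = "{y \<in> verts U n. \<bar>\<rho> y - \<rho> v\<bar> \<le> L * real K1}"
  have "reach (edges U n) ?V m v (y m)" if "m \<le> K1" for m
    using that
  proof (induction m)
    case 0
    show ?case using y0 by (simp add: reach_refl)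
  next
    case (Suc m)
    have e: "y (Suc m) - y m = of_real (1 / real n) * d"
      unfolding y_def by (simp add: add_divide_distrib algebra_simps)
    have "closed_segment (y m) (y (Suc m)) \<subseteq> U"
    proof
      fix z assume "z \<in> closed_segment (y m) (y (Suc m))"
      then obtain a where a: "0 \<le> a" "a \<le> 1" "z = y m + a *\<^sub>R (y (Suc m) - y m)"
        unfolding closed_segment_def by (auto simp: algebra_simps)
      have z: "z = v + of_real (real m / real n + a / real n) * d"
        unfolding a(3) e unfolding y_def by (simp add: scaleR_conv_of_real algebra_simps)
      have "real m / real n + a / real n \<le> real (Suc m) / real n"
        using a(2) n_pos by (simp add: add_divide_distrib divide_right_mono)
      then have "real m / real n + a / real n \<le> r" using mr[OF Suc.prems] r by linarith
      then have "v + of_real (real m / real n + a / real n) * d \<in> U"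
        using d(2)[of "real m / real n + a / real n"] a(1) by simp
      then show "z \<in> U" by (simp only: z)
    qed
    moreover have "dist (y m) (y (Suc m)) = 1 / real n"
    proof -
      have "cmod (y (Suc m) - y m) = 1 / real n" unfolding e using d1 by (simp add: norm_mult norm_divide)
      then show ?thesis by (simp add: dist_norm norm_minus_commute)
    qed
    ultimately have "(y m, y (Suc m)) \<in> edges U n"
      using yv[of m] yv[of "Suc m"] Suc.prems unfolding edges_def adj_def by auto
    then have "reach (edges U n) ?V 1 (y m) (y (Suc m))"
      using yv[of m] yv[of "Suc m"] yrho[of m] yrho[of "Suc m"] Suc.prems by (intro reach_edge) auto
    then have "reach (edges U n) ?V (m + 1) v (y (Suc m))"
      using Suc by (intro reach_trans[OF Suc.IH]) auto
    then show ?case by simp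
  qed
  from this[OF order_refl] have reach: "reach (edges U n) ?V K1 v (y K1)" .
  have b2: "y K1 \<in> ball x (2 * r)" using yb[of K1] r by simp
  have "real n * cmod (f (y K1) - f x) \<le> 2 * R" using yrho[of K1] v(2) rho_in[OF b2] by simp
  then have "real n * cmod (f (y K1) - f x) < real n * (r / L)" using two_R_less by linarith
  then have 1: "cmod (f (y K1) - f x) < r / L" using n_pos by (simp only: mult_less_cancel_left_pos)
  have "4 * L / real n \<le> \<kappa> * real K1 / real n" using K1(2) by (intro divide_right_mono) auto
  also have "\<dots> \<le> 1 - cmod (f (y K1))"
  proof -
    have "real K1 / real n \<le> r" using mr[OF order_refl] r by linarith
    then show ?thesis using d(2)[of "real K1 / real n"] unfolding y_def by simp
  qed
  finally have "f (y K1) \<in> safe" unfolding safe_iff using 1 by simp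
  then show ?thesis
    by (rule that[OF reach yv[OF order_refl] yb[OF order_refl] _ yrho[OF order_refl]])
qed

definition inward :: complex where "inward = (if f x = 0 then 1 else - sgn (f x))"

lemma inward: "cmod inward = 1" "f x = - of_real (cmod (f x)) * inward"
proof -
  show "cmod inward = 1" by (simp add: inward_def norm_sgn)
  show "f x = - of_real (cmod (f x)) * inward" by (simp add: inward_def sgn_eq)
qed

text \<open>For \<open>s \<ge> 0\<close> this is a point of smallest modulus on the circle of radius
  \<open>s\<close> about \<open>f x\<close>; arcs of different radii are joined along these
  points.\<close>

definition axis :: "real \<Rightarrow> complex" where "axis s = f x + of_real s * inward"

lemma axis_dist: "0 \<le> s \<Longrightarrow> cmod (axis s - f x) = s"
  unfolding axis_def using inward(1) by (simp add: norm_mult)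

text \<open>The image of \<open>v\<close> is rotated about \<open>f x\<close> onto the axis. By
  \<open>norm_rotate_le\<close> the modulus never exceeds that of \<open>f v\<close>, so the arc
  stays in \<open>safe\<close>; its radius is constant, so only rounding widens the band.\<close>

lemma reach_axis:
  assumes v: "v \<in> grid n" "v \<in> ball x r" "f v \<in> safe"
  shows "axis (\<rho> v / real n) \<in> safe"
    "\<exists>N. real N \<le> 4 * L * \<rho> v + 2 \<and>
      reach (edges U n) {y \<in> verts U n. \<bar>\<rho> y - \<rho> v\<bar> \<le> 3 * L} (2 * N) v (rd n (f_inv (axis (\<rho> v / real n))))"
proof -
  define s where "s = \<rho> v / real n"
  have s: "0 \<le> s" unfolding s_def using rho_nonneg by simp
  have v2: "v \<in> ball x (2 * r)" using v(2) r by simp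
  have sn: "cmod (f v - f x) = s" unfolding s_def rho_in[OF v2] using n_pos by simp
  define a where "a = Arg ((f v - f x) / inward)"
  have inward0: "inward \<noteq> 0" using inward(1) by auto
  have fv: "f v = f x + of_real s * cis a * inward"
  proof (cases "f v = f x")
    case True
    then show ?thesis using sn by simp
  next
    case False
    then have "cis a = sgn ((f v - f x) / inward)" unfolding a_def using inward0 by (intro cis_Arg) simp
    also have "\<dots> = ((f v - f x) / inward) / of_real s"
      using sn inward(1) by (simp add: sgn_eq norm_divide)
    finally have c: "cis a = ((f v - f x) / inward) / of_real s" .
    have "s \<noteq> 0" using False sn by auto
    then have "of_real s * cis a * inward = f v - f x" unfolding c using inward0 by simp
    then show ?thesis by simp
  qed
  have api: "\<bar>a\<bar> \<le> pi" using Arg_bounded[of "(f v - f x) / inward"] unfolding a_def by linarith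
  \<comment> \<open>The arc, of length at most \<open>4 * s\<close>, is cut into pieces of length at
    most \<open>1 / (L * real n)\<close>. The summand 1 keeps \<open>N\<close> positive when
    \<open>\<rho> v = 0\<close>.\<close>
  define N where "N = nat \<lceil>4 * L * \<rho> v\<rceil> + 1"
  have N0: "real N > 0" unfolding N_def by simp
  have NL: "real N \<le> 4 * L * \<rho> v + 2"
    unfolding N_def using L rho_nonneg[of v] by (intro nat_ceiling_Suc_bounds) simp
  have NG: "4 * L * \<rho> v \<le> real N"
    unfolding N_def using L rho_nonneg[of v] by (intro nat_ceiling_Suc_bounds) simp
  define w where "w i = f x + of_real s * cis (a * (1 - real i / real N)) * inward" for i :: nat
  have w_dist: "cmod (w i - f x) = s" for i unfolding w_def using inward(1) s by (simp add: norm_mult)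
  have w_safe: "w i \<in> safe" if "i \<le> N" for i
  proof -
    have "\<bar>1 - real i / real N\<bar> \<le> 1" using that N0 by (simp add: field_simps)
    then have "\<bar>a * (1 - real i / real N)\<bar> \<le> \<bar>a\<bar>"
      by (simp only: abs_mult mult_left_le abs_ge_zero)
    then have "cmod (w i) \<le> cmod (f v)" unfolding w_def fv using api s inward by (intro norm_rotate_le)
    then show ?thesis using v(3) sn unfolding safe_iff by (simp add: w_dist)
  qed
  have w_step: "cmod (w i - w (Suc i)) \<le> 1 / (L * real n)" for i
  proof -
    have "w i - w (Suc i) = of_real s * (cis (a * (1 - real i / real N)) - cis (a * (1 - real (Suc i) / real N))) * inward"
      unfolding w_def by (simp add: algebra_simps)
    then have "cmod (w i - w (Suc i)) = s * cmod (cis (a * (1 - real i / real N)) - cis (a * (1 - real (Suc i) / real N)))"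
      using inward(1) s by (simp add: norm_mult)
    also have "\<dots> \<le> s * \<bar>a * (1 - real i / real N) - a * (1 - real (Suc i) / real N)\<bar>"
      using s by (intro mult_left_mono norm_cis_diff_le)
    also have "a * (1 - real i / real N) - a * (1 - real (Suc i) / real N) = a / real N"
      by (simp add: right_diff_distrib add_divide_distrib distrib_left)
    also have "s * \<bar>a / real N\<bar> \<le> s * (4 / real N)"
      using api pi_less_4 N0 s by (intro mult_left_mono) (auto simp: abs_div divide_right_mono)
    also have "\<dots> \<le> 1 / (L * real n)"
    proof -
      have "4 * L * (s * real n) \<le> real N" using NG unfolding s_def using n_pos by simp
      then show ?thesis using N0 L n_pos by (simp add: field_simps)
    qed
    finally show ?thesis .
  qed
  have w0: "w 0 = f v" unfolding w_def fv by simp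
  have wN: "w N = axis s" unfolding w_def axis_def using N0 by simp
  show "axis (\<rho> v / real n) \<in> safe" using w_safe[of N] wN unfolding s_def by simp
  have "reach (edges U n) {y \<in> verts U n. \<bar>\<rho> y - \<rho> v\<bar> \<le> 0 + 3 * L} (2 * N) (rd n (f_inv (w 0))) (rd n (f_inv (w N)))"
  proof (rule reach_sequence)
    show "w i \<in> safe \<and> \<bar>real n * cmod (w i - f x) - \<rho> v\<bar> \<le> 0" if "i \<le> N" for i
      using w_safe[OF that] w_dist[of i] n_pos unfolding s_def by simp
  qed (rule w_step)
  then have "reach (edges U n) {y \<in> verts U n. \<bar>\<rho> y - \<rho> v\<bar> \<le> 3 * L} (2 * N) v (rd n (f_inv (axis (\<rho> v / real n))))"
    unfolding w0 wN f_inv_f[OF v(2)] rd_grid[OF n v(1)] s_def by simp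
  then show "\<exists>N. real N \<le> 4 * L * \<rho> v + 2 \<and>
      reach (edges U n) {y \<in> verts U n. \<bar>\<rho> y - \<rho> v\<bar> \<le> 3 * L} (2 * N) v (rd n (f_inv (axis (\<rho> v / real n))))"
    using NL by blast
qed

text \<open>On the axis the distance to \<open>f x\<close> interpolates linearly, and
  \<open>safe\<close> is convex, so the segment between two safe axis points stays safe and inside
  the band.\<close>

lemma reach_radial:
  assumes t: "0 \<le> t" "axis (t / real n) \<in> safe" "\<bar>t - s\<bar> \<le> b"
    and t': "0 \<le> t'" "axis (t' / real n) \<in> safe" "\<bar>t' - s\<bar> \<le> b"
  shows "\<exists>N. real N \<le> 2 * b * L + 2 \<and>
      reach (edges U n) {y \<in> verts U n. \<bar>\<rho> y - s\<bar> \<le> b + 3 * L} (2 * N)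
        (rd n (f_inv (axis (t / real n)))) (rd n (f_inv (axis (t' / real n))))"
proof -
  define N where "N = nat \<lceil>2 * b * L\<rceil> + 1"
  have b: "0 \<le> b" using t(3) by linarith
  have N0: "real N > 0" unfolding N_def by simp
  have NL: "real N \<le> 2 * b * L + 2" unfolding N_def using b L by (intro nat_ceiling_Suc_bounds) simp
  have NG: "2 * b * L \<le> real N" unfolding N_def using b L by (intro nat_ceiling_Suc_bounds) simp
  define q where "q i = t + (t' - t) * (real i / real N)" for i
  define w where "w i = axis (q i / real n)" for i
  have conv: "w i = (1 - real i / real N) *\<^sub>R axis (t / real n) + (real i / real N) *\<^sub>R axis (t' / real n)" for i
    unfolding w_def q_def axis_def scaleR_conv_of_real
    by (simp add: algebra_simps add_divide_distrib diff_divide_distrib)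
  have frac: "0 \<le> real i / real N" "real i / real N \<le> 1" if "i \<le> N" for i
    using that N0 by (auto simp: field_simps)
  have q_conv: "q i = (1 - real i / real N) * t + (real i / real N) * t'" for i
  proof -
    have "t + (t' - t) * y = (1 - y) * t + y * t'" for y by (simp add: algebra_simps)
    then show ?thesis unfolding q_def .
  qed
  have q: "0 \<le> q i" "\<bar>q i - s\<bar> \<le> b" if "i \<le> N" for i
  proof -
    show "0 \<le> q i" unfolding q_conv using frac[OF that] t(1) t'(1) by simp
    have "q i - s = (1 - real i / real N) * (t - s) + (real i / real N) * (t' - s)"
    proof -
      have "(1 - y) * t + y * t' - s = (1 - y) * (t - s) + y * (t' - s)" for y by (simp add: algebra_simps)
      then show ?thesis unfolding q_conv .
    qed
    then have "\<bar>q i - s\<bar> \<le> \<bar>(1 - real i / real N) * (t - s)\<bar> + \<bar>(real i / real N) * (t' - s)\<bar>"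
      by (metis abs_triangle_ineq)
    also have "\<dots> \<le> (1 - real i / real N) * b + (real i / real N) * b"
      using frac[OF that] t(3) t'(3) unfolding abs_mult by (intro add_mono mult_mono) auto
    also have "\<dots> = b" by (simp add: algebra_simps)
    finally show "\<bar>q i - s\<bar> \<le> b" .
  qed
  have "reach (edges U n) {y \<in> verts U n. \<bar>\<rho> y - s\<bar> \<le> b + 3 * L} (2 * N) (rd n (f_inv (w 0))) (rd n (f_inv (w N)))"
  proof (rule reach_sequence)
    show "w i \<in> safe \<and> \<bar>real n * cmod (w i - f x) - s\<bar> \<le> b" if "i \<le> N" for i
    proof
      show "w i \<in> safe" unfolding conv using frac[OF that] t(2) t'(2)
        by (intro convexD[OF convex_safe]) auto
      have "cmod (w i - f x) = q i / real n" unfolding w_def using q(1)[OF that] by (intro axis_dist) simp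
      then show "\<bar>real n * cmod (w i - f x) - s\<bar> \<le> b" using q(2)[OF that] n_pos by simp
    qed
    show "cmod (w i - w (Suc i)) \<le> 1 / (L * real n)" if "i < N" for i
    proof -
      have "w i - w (Suc i) = of_real ((q i - q (Suc i)) / real n) * inward"
        unfolding w_def axis_def by (simp add: algebra_simps diff_divide_distrib)
      then have "cmod (w i - w (Suc i)) = \<bar>(q i - q (Suc i)) / real n\<bar>" 
        using inward(1) by (simp only: norm_mult norm_of_real mult_1_right)
      also have "q i - q (Suc i) = (t - t') / real N"
        unfolding q_def by (simp add: algebra_simps add_divide_distrib diff_divide_distrib)
      also have "\<bar>(t - t') / real N / real n\<bar> = \<bar>t - t'\<bar> / (real N * real n)" by (simp add: abs_div)
      also have "\<dots> \<le> 2 * b / (real N * real n)" using t(3) t'(3) by (intro divide_right_mono) auto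
      also have "\<dots> \<le> 1 / (L * real n)" using NG N0 L n_pos by (simp add: field_simps)
      finally show ?thesis .
    qed
  qed
  moreover have w0: "w 0 = axis (t / real n)" and wN: "w N = axis (t' / real n)"
    unfolding w_def q_def using N0 by simp_all
  ultimately show ?thesis unfolding w0 wN by (intro exI[of _ N] conjI NL)
qed

abbreviation KK :: real where "KK \<equiv> band_width L K1"

lemma B_ge: "2 * L + L * real K1 = B" "2 * L \<le> B" "3 * L \<le> 3 * B" "1 \<le> B"
proof -
  show "2 * L + L * real K1 = B" by (simp add: algebra_simps)
  have "L * 2 \<le> B" using L by (intro mult_left_mono) auto
  then show "2 * L \<le> B" "3 * L \<le> 3 * B" "1 \<le> B" using L by linarith+
qed

lemma KK_ge: "4 * B \<le> KK" "2 * L \<le> KK" "16 * L\<^sup>2 \<le> KK" "16 \<le> KK" "1 \<le> 2 * L"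
proof -
  have "1 * B \<le> L * B" using B_ge(4) by (intro mult_right_mono[OF L]) simp
  moreover have "0 \<le> L\<^sup>2" by simp
  moreover have "20 * L * B = 20 * (L * B)" by (simp only: mult.assoc)
  moreover have "0 \<le> real K1" by simp
  ultimately show "4 * B \<le> KK" "2 * L \<le> KK" "16 * L\<^sup>2 \<le> KK" "16 \<le> KK" "1 \<le> 2 * L"
    unfolding band_width_def using L B_ge(4) by linarith+
qed

text \<open>Both ends are pushed off the boundary and rotated onto the axis, where their radii
  differ by a bounded amount and are joined radially. Only the arcs have a length that grows with
  \<open>s\<close>.\<close>

lemma level_connected:
  assumes s: "1 \<le> s" "s \<le> R" and v: "v \<in> verts U n" "\<bar>\<rho> v - s\<bar> \<le> 2 * L"
    and w: "w \<in> verts U n" "\<bar>\<rho> w - s\<bar> \<le> 2 * L"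
  shows "\<exists>N. real N \<le> KK * s \<and> reach (edges U n) {y \<in> verts U n. \<bar>\<rho> y - s\<bar> \<le> KK} N v w"
proof -
  let ?V = "{y \<in> verts U n. \<bar>\<rho> y - s\<bar> \<le> KK}"
  have half: "\<exists>v' N. real N \<le> real K1 + 2 * (4 * L * (s + B) + 2) \<and>
      reach (edges U n) ?V N v (rd n (f_inv (axis (\<rho> v' / real n)))) \<and>
      axis (\<rho> v' / real n) \<in> safe \<and> \<bar>\<rho> v' - s\<bar> \<le> B"
    if v: "v \<in> verts U n" "\<bar>\<rho> v - s\<bar> \<le> 2 * L" for v
  proof -
    have "\<rho> v + L * real K1 \<le> s + B" using v(2) B_ge(1) by linarith
    also have "\<dots> \<le> 2 * R" using s(2) R(1) by linarith
    finally obtain v' where v': "reach (edges U n) {y \<in> verts U n. \<bar>\<rho> y - \<rho> v\<bar> \<le> L * real K1} K1 v v'"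
      "v' \<in> verts U n" "v' \<in> ball x r" "f v' \<in> safe" "\<bar>\<rho> v' - \<rho> v\<bar> \<le> L * real K1"
      using push[OF v(1)] by blast
    have rv': "\<bar>\<rho> v' - s\<bar> \<le> B" using v'(5) v(2) B_ge(1) by linarith
    have gv': "v' \<in> grid n" using v'(2) unfolding verts_def by blast
    obtain N where N: "real N \<le> 4 * L * \<rho> v' + 2"
      "reach (edges U n) {y \<in> verts U n. \<bar>\<rho> y - \<rho> v'\<bar> \<le> 3 * L} (2 * N) v' (rd n (f_inv (axis (\<rho> v' / real n))))"
      using reach_axis(2)[OF gv' v'(3,4)] by blast
    have 1: "reach (edges U n) ?V K1 v v'"
      by (rule reach_mono[OF v'(1)]) (use v(2) B_ge(1,4) KK_ge(1) in auto)
    have 2: "reach (edges U n) ?V (2 * N) v' (rd n (f_inv (axis (\<rho> v' / real n))))"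
      by (rule reach_mono[OF N(2)]) (use rv' B_ge(3) KK_ge(1) in auto)
    have "4 * L * \<rho> v' \<le> 4 * L * (s + B)" using rv' L by (intro mult_left_mono) auto
    then have "real (K1 + 2 * N) \<le> real K1 + 2 * (4 * L * (s + B) + 2)" using N(1) by simp
    moreover have "reach (edges U n) ?V (K1 + 2 * N) v (rd n (f_inv (axis (\<rho> v' / real n))))"
      using 1 2 by (rule reach_trans)
    ultimately show ?thesis using reach_axis(1)[OF gv' v'(3,4)] rv' by blast
  qed
  obtain v' N1 where 1: "real N1 \<le> real K1 + 2 * (4 * L * (s + B) + 2)"
    "reach (edges U n) ?V N1 v (rd n (f_inv (axis (\<rho> v' / real n))))"
    "axis (\<rho> v' / real n) \<in> safe" "\<bar>\<rho> v' - s\<bar> \<le> B"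
    using half[OF v] by blast
  obtain w' N2 where 2: "real N2 \<le> real K1 + 2 * (4 * L * (s + B) + 2)"
    "reach (edges U n) ?V N2 w (rd n (f_inv (axis (\<rho> w' / real n))))"
    "axis (\<rho> w' / real n) \<in> safe" "\<bar>\<rho> w' - s\<bar> \<le> B"
    using half[OF w] by blast
  obtain N where N: "real N \<le> 2 * B * L + 2"
    "reach (edges U n) {y \<in> verts U n. \<bar>\<rho> y - s\<bar> \<le> B + 3 * L} (2 * N)
        (rd n (f_inv (axis (\<rho> v' / real n)))) (rd n (f_inv (axis (\<rho> w' / real n))))"
    using reach_radial[OF rho_nonneg 1(3,4) rho_nonneg 2(3,4)] by blast
  have 3: "reach (edges U n) ?V (2 * N) (rd n (f_inv (axis (\<rho> v' / real n)))) (rd n (f_inv (axis (\<rho> w' / real n))))"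
    by (rule reach_mono[OF N(2)]) (use B_ge(3) KK_ge(1) in auto)
  have "reach (edges U n) ?V (N1 + 2 * N + N2) v w"
    by (rule reach_trans[OF reach_trans[OF 1(2) 3] reach_sym[OF sym_edges 2(2)]])
  moreover have "real (N1 + 2 * N + N2) \<le> KK * s"
  proof -
    have "real (N1 + 2 * N + N2) \<le> 2 * (real K1 + 2 * (4 * L * (s + B) + 2)) + 2 * (2 * B * L + 2)"
      using 1(1) 2(1) N(1) by simp
    also have "\<dots> = 16 * L * s + (2 * real K1 + 20 * L * B + 12)" by (simp add: algebra_simps)
    also have "\<dots> \<le> 16 * L * s + (2 * real K1 + 20 * L * B + 20 + 16 * L\<^sup>2) * s"
    proof -
      have p: "0 \<le> 2 * real K1 + 20 * L * B + 20 + 16 * L\<^sup>2" using L B_ge(4) by simp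
      have "2 * real K1 + 20 * L * B + 12 \<le> (2 * real K1 + 20 * L * B + 20 + 16 * L\<^sup>2) * 1" by simp
      also have "\<dots> \<le> (2 * real K1 + 20 * L * B + 20 + 16 * L\<^sup>2) * s"
        using s(1) p by (rule mult_left_mono)
      finally show ?thesis by simp
    qed
    also have "\<dots> = KK * s" unfolding band_width_def by (simp add: algebra_simps)
    finally show ?thesis .
  qed
  ultimately show ?thesis by blast
qed

lemma volume_le:
  assumes t: "1 \<le> t" "t \<le> R"
  shows "real (card {v \<in> verts U n. \<rho> v \<le> t}) \<le> KK * t\<^sup>2"
proof -
  have Lt: "1 \<le> L * t" using mult_mono[OF L t(1)] L by simp
  have "{v \<in> verts U n. \<rho> v \<le> t} \<subseteq> grid n \<inter> cball x (L * t / real n)"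
    using rho_small(2)[of _ t] t R_pos unfolding verts_def by auto
  then have "card {v \<in> verts U n. \<rho> v \<le> t} \<le> card (grid n \<inter> cball x (L * t / real n))"
    using card_grid_ball(1)[OF n, of "L * t" x] Lt by (intro card_mono) auto
  then have "real (card {v \<in> verts U n. \<rho> v \<le> t}) \<le> (2 * (L * t) + 2)\<^sup>2"
    using card_grid_ball(2)[OF n, of "L * t" x] Lt by linarith
  also have "\<dots> \<le> (4 * (L * t))\<^sup>2" using Lt by (intro power_mono) auto
  also have "\<dots> = 16 * L\<^sup>2 * t\<^sup>2" by (simp add: power_mult_distrib)
  also have "\<dots> \<le> KK * t\<^sup>2" using KK_ge(3) by (intro mult_right_mono) auto
  finally show ?thesis .
qed

end

section \<open>The hitting estimate\<close>

lemma star_adj_dist: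
  assumes "n > 0" "star_adj U n u v"
  shows "real n * dist u v \<le> 2"
proof -
  have adj: "dist p q = 1 / real n" if "adj U n p q" for p q using that unfolding adj_def by simp
  have "dist u v \<le> 2 / real n"
  proof (cases "adj U n u v")
    case True
    then show ?thesis using adj[OF True] by (simp add: divide_right_mono)
  next
    case False
    then obtain p where "adj U n u p" "adj U n p v"
      using assms(2) unfolding star_adj_def diag_def Let_def by blast
    then show ?thesis using dist_triangle[of u v p] adj by fastforce
  qed
  then show ?thesis using assms(1) by (simp add: field_simps)
qed

text \<open>A discrete intermediate value theorem along a chain in \<open>A\<close>.\<close>

lemma rtranclp_crossing:
  assumes "(\<lambda>u v. u \<in> A \<and> v \<in> A \<and> Q u v)\<^sup>*\<^sup>* a b" "k a < s" "s \<le> k b"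
  obtains u v where "u \<in> A" "v \<in> A" "Q u v" "k u < s" "s \<le> (k v :: real)"
proof (rule ccontr)
  assume none: "\<not> thesis"
  have "k b < s"
    using assms(1,2)
  proof (induction rule: rtranclp_induct)
    case (step y z)
    show ?case
    proof (rule ccontr)
      assume "\<not> k z < s"
      then show False using none that[of y z] step by simp
    qed
  qed
  then show False using assms(3) by simp
qed

text \<open>The neighbour of \<open>x\<close> in \<open>A\<close> has \<rho> at most
  \<open>L\<close>, and \<open>A\<close> also has a point beyond \<open>R\<close>. A step of the
  star graph changes \<rho> by at most \<open>2 * L\<close>, so \<open>A\<close> meets every level
  in between; this is where star-connectedness enters and what fixes
  \<open>b = 2 * L\<close>.\<close>

lemma (in lattice_chart) hit_before_prob_decay:
  assumes U: "bounded U" and x: "x \<in> outer_boundary U n A" and A: "star_connected U n A"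
    and R8: "8 * KK \<le> R" and far: "y \<in> A" "R < \<rho> y"
    and S: "A \<inter> S = {}" "\<And>v. v \<in> S \<Longrightarrow> R < \<rho> v"
  shows "hit_before_prob U n x S A \<le>
    ennreal (sqrt (16 * KK ^ 4 / decay_factor KK * (R / (8 * KK)) powr log 8 (decay_factor KK)))"
proof -
  let ?P = "edges U n"
  obtain a where a: "a \<in> A" "adj U n x a" and xv: "x \<in> verts U n"
    using x unfolding outer_boundary_def by blast
  have AV: "A \<subseteq> verts U n" using A unfolding star_connected_def by blast
  have fin: "finite (verts U n)" by (rule finite_verts[OF U n])
  obtain h where "\<forall>v. 0 \<le> h v" "\<forall>v. h v \<le> 1" "\<forall>v\<in>A. h v = 0"
    "\<forall>v. v \<notin> A \<longrightarrow> v \<notin> S \<longrightarrow> (\<Sum>w | adj U n v w. h v - h w) = 0"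
    "\<forall>v\<in>verts U n. hit_before_prob U n v S A \<le> ennreal (h v)"
    by (rule harmonic_majorant[OF n fin S(1)])
  then have h: "0 \<le> h v" "h v \<le> 1" "v \<in> A \<Longrightarrow> h v = 0"
    "v \<notin> A \<Longrightarrow> v \<notin> S \<Longrightarrow> (\<Sum>w | adj U n v w. h v - h w) = 0"
    "v \<in> verts U n \<Longrightarrow> hit_before_prob U n v S A \<le> ennreal (h v)" for v
    by simp_all
  \<comment> \<open>Cutting \<open>h\<close> to the component of \<open>x\<close> links every vertex
    with a nonzero value to \<open>A\<close>, as \<open>connected\<close> demands; no edge leaves
    the component, so harmonicity survives.\<close>
  define h' where "h' v = (if (x, v) \<in> ?P\<^sup>* then h v else 0)" for v
  have xa: "(x, a) \<in> ?P" using a(2) unfolding edges_def by simp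
  have rho_edge: "\<bar>\<rho> u - \<rho> v\<bar> \<le> L" if "(u, v) \<in> ?P" "\<rho> u \<le> R" for u v
  proof -
    have "real n * dist u v = 1" using edges_dist[OF that(1)] n_pos by simp
    then show ?thesis using rho_near(2)[of u v] that(2) R_pos by simp
  qed
  have ra: "\<rho> a \<le> L" using rho_edge[OF xa] rho_centre R_pos by simp
  have KK: "0 < KK" "L \<le> KK" using KK_ge(2,4) L by linarith+
  interpret harmonic_zero "verts U n" ?P \<rho> h' A KK "2 * L" R
  proof
    show "finite (verts U n)" by (rule fin)
    show "?P \<subseteq> verts U n \<times> verts U n" by (rule edges_verts)
    show "sym ?P" by (rule sym_edges)
    show "1 \<le> 2 * L" "2 * L \<le> KK" using KK_ge by blast+
    show "real (card (?P `` {v})) \<le> KK" for v using degree_le[OF n, of U v] KK_ge(4) by linarith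
    show "\<bar>\<rho> u - \<rho> v\<bar> \<le> 2 * L" if "(u, v) \<in> ?P" "\<rho> u \<le> R" for u v
      using rho_edge[OF that] L by linarith
    show "real (card {v \<in> verts U n. \<rho> v \<le> t}) \<le> KK * t\<^sup>2" if "1 \<le> t" "t \<le> R" for t
      by (rule volume_le[OF that])
    show "\<exists>N. real N \<le> KK * s \<and> reach ?P {v \<in> verts U n. \<bar>\<rho> v - s\<bar> \<le> KK} N u v"
      if "1 \<le> s" "s \<le> R" "u \<in> verts U n" "v \<in> verts U n" "\<bar>\<rho> u - s\<bar> \<le> 2 * L" "\<bar>\<rho> v - s\<bar> \<le> 2 * L" for s u v
      by (rule level_connected[OF that(1,2,3,5,4,6)])
    show "A \<subseteq> verts U n" by (rule AV)
    show "\<exists>a\<in>A. \<bar>\<rho> a - s\<bar> \<le> 2 * L" if s: "KK \<le> s" "s \<le> R" for s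
    proof (cases "\<rho> a < s")
      case False
      then have "\<bar>\<rho> a - s\<bar> \<le> 2 * L" using ra KK(2) s(1) L by linarith
      then show ?thesis using a(1) by blast
    next
      case True
      have path: "(\<lambda>u v. u \<in> A \<and> v \<in> A \<and> star_adj U n u v)\<^sup>*\<^sup>* a y"
        using A a(1) far(1) unfolding star_connected_def by blast
      have "s \<le> \<rho> y" using far(2) s(2) by linarith
      then obtain u v where uv: "u \<in> A" "v \<in> A" "star_adj U n u v" "\<rho> u < s" "s \<le> \<rho> v"
        by (rule rtranclp_crossing[where k=\<rho>, OF path True])
      have d: "real n * dist u v \<le> 2" by (rule star_adj_dist[OF n uv(3)])
      have "\<bar>\<rho> u - \<rho> v\<bar> \<le> L * (real n * dist u v)"
        using d uv(4) s(2) R_pos by (intro rho_near(2)) linarith+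
      also have "\<dots> \<le> L * 2" using d L by (intro mult_left_mono) auto
      finally show ?thesis using uv by (intro bexI[of _ v]) auto
    qed
    show "0 \<le> h' v" "h' v \<le> 1" for v unfolding h'_def using h(1,2) by auto
    show "h' v = 0" if "v \<in> A" for v unfolding h'_def using h(3)[OF that] by simp
    show "(\<Sum>w\<in>?P `` {v}. h' v - h' w) = 0" if v: "v \<in> verts U n" "v \<notin> A" "\<rho> v \<le> R" for v
    proof -
      have nb: "(x, w) \<in> ?P\<^sup>* \<longleftrightarrow> (x, v) \<in> ?P\<^sup>*" if "w \<in> ?P `` {v}" for w
      proof -
        have "(v, w) \<in> ?P" "(w, v) \<in> ?P" using that symD[OF sym_edges] by blast+
        then show ?thesis using rtrancl_into_rtrancl[of x v ?P w] rtrancl_into_rtrancl[of x w ?P v] by argo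
      qed
      have vS: "v \<notin> S" using S(2)[of v] v(3) by force
      have "(\<Sum>w\<in>?P `` {v}. h' v - h' w) = (\<Sum>w\<in>?P `` {v}. if (x, v) \<in> ?P\<^sup>* then h v - h w else 0)"
        by (rule sum.cong[OF refl]) (simp add: h'_def nb)
      moreover have "?P `` {v} = {w. adj U n v w}" unfolding edges_def by auto
      ultimately show ?thesis using h(4)[OF v(2) vS] by (cases "(x, v) \<in> ?P\<^sup>*") simp_all
    qed
    show "\<exists>a\<in>A. (v, a) \<in> ?P\<^sup>*" if "h' v \<noteq> 0" for v
    proof -
      have "(x, v) \<in> ?P\<^sup>*" using that unfolding h'_def by presburger
      then have "(v, x) \<in> ?P\<^sup>*" by (rule symD[OF sym_rtrancl[OF sym_edges]])
      then have "(v, a) \<in> ?P\<^sup>*" using xa by (rule rtrancl_into_rtrancl)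
      then show ?thesis using a(1) by (rule bexI)
    qed
  qed
  \<comment> \<open>Since \<open>h'\<close> vanishes at the neighbour \<open>a\<close>, the square
    is a single term of the energy in the smallest disc.\<close>
  have "(h x)\<^sup>2 = (h' x - h' a)\<^sup>2"
    using hA[OF a(1)] unfolding h'_def by simp
  also have "\<dots> \<le> energy ?P h' {v \<in> verts U n. \<rho> v \<le> 2 * KK}"
  proof -
    have "(x, a) \<in> ?P \<inter> {v \<in> verts U n. \<rho> v \<le> 2 * KK} \<times> {v \<in> verts U n. \<rho> v \<le> 2 * KK}"
      using xa xv a(1) AV rho_centre ra KK by auto
    then show ?thesis unfolding energy_def
      using member_le_sum[of "(x, a)" _ "\<lambda>(x, y). (h' x - h' y)\<^sup>2"] finP by fastforce
  qed
  also have "\<dots> \<le> 16 * KK ^ 4 / decay_factor KK * (R / (8 * KK)) powr log 8 (decay_factor KK)"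
    by (rule energy_decay[OF R8])
  finally have "h x \<le> sqrt (16 * KK ^ 4 / decay_factor KK * (R / (8 * KK)) powr log 8 (decay_factor KK))"
    by (rule real_le_rsqrt)
  then show ?thesis using h(5)[OF xv] by (meson ennreal_leI order_trans)
qed

theorem lemma5p1:
  fixes U :: "complex set" and c :: real
  assumes "smooth_domain U" and "c > 0"
  shows "\<exists>\<beta>>0. \<exists>C>0. \<forall>x1 \<delta> y1. blob_data U x1 \<delta> y1 \<longrightarrow>
           (\<forall>\<^sub>F n in sequentially. \<forall>z1. is_arg_min (dist y1) (\<lambda>z. z \<in> grid n) z1 \<longrightarrow>
             (\<forall>A. star_connected U n A \<and>
                  c \<le> min (diameter A) (setdist (ball y1 (\<delta> / 4)) A) \<longrightarrow>
                (SUP x\<in>outer_boundary U n A.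
                   hit_before_prob U n x (ball z1 (\<delta> / 4) \<inter> verts U n) A)
                \<le> ennreal (C / real n powr \<beta>)))"
proof -
  have bU: "bounded U" using assms(1) unfolding smooth_domain_def by blast
  obtain r L \<kappa> where ch: "0 < r" "1 \<le> L" "0 < \<kappa>" "\<forall>x\<in>U. \<exists>f. chart r L \<kappa> U x f"
    by (rule smooth_domain_charts[OF assms(1)])
  \<comment> \<open>Enough lattice steps at rate \<kappa> to gain the margin \<open>4 * L\<close> of
    \<open>safe\<close>; the summand 3 makes \<open>K1\<close> steps cover the rounding distance
    \<open>3 / n\<close>.\<close>
  define K1 where "K1 = nat \<lceil>4 * L / \<kappa>\<rceil> + 3"
  have K1: "3 \<le> K1" "4 * L \<le> \<kappa> * real K1"
  proof -
    show "3 \<le> K1" unfolding K1_def by simp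
    have "4 * L / \<kappa> \<le> real K1" unfolding K1_def by linarith
    then show "4 * L \<le> \<kappa> * real K1" using ch(3) by (simp add: field_simps)
  qed
  define K where "K = band_width L K1"
  define \<theta> where "\<theta> = decay_factor K"
  \<comment> \<open>The energy argument runs up to the lattice radius \<open>\<sigma> * n\<close>.
    The first bound keeps this disc in the chart; the second makes its Euclidean radius at most
    \<open>c / 8\<close>, too small to contain \<open>A\<close> or to reach the blob.\<close>
  define \<sigma> where "\<sigma> = min (r / (4 * L)) (c / (8 * L))"
  have \<sigma>: "\<sigma> > 0" "4 * L * \<sigma> \<le> r" "L * \<sigma> \<le> c / 8"
  proof -
    show "\<sigma> > 0" unfolding \<sigma>_def using ch assms(2) by simp
    have "\<sigma> \<le> r / (4 * L)" "\<sigma> \<le> c / (8 * L)" unfolding \<sigma>_def by auto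
    then show "4 * L * \<sigma> \<le> r" "L * \<sigma> \<le> c / 8" using ch(2) by (simp_all add: field_simps)
  qed
  have K: "K > 0"
  proof -
    have "0 \<le> 20 * L * (L * (real K1 + 2))" using ch(2) by simp
    moreover have "0 \<le> 16 * L\<^sup>2" by simp
    ultimately show ?thesis unfolding K_def band_width_def using ch(2) by linarith
  qed
  have \<theta>: "0 < \<theta>" "\<theta> < 1"
  proof -
    have "K ^ 6 > 0" using K by simp
    then show "0 < \<theta>" "\<theta> < 1" unfolding \<theta>_def decay_factor_def by (auto simp: add_pos_pos)
  qed
  define \<beta> where "\<beta> = - log 8 \<theta> / 2"
  have \<beta>: "\<beta> > 0" unfolding \<beta>_def using \<theta> by simp
  define D where "D = 16 * K ^ 4 / \<theta> * (\<sigma> / (8 * K)) powr log 8 \<theta>"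
  have D: "D > 0" unfolding D_def using K \<theta> \<sigma> by simp
  \<comment> \<open>With \<open>R = \<sigma> * n\<close> the summands ensure in turn
    \<open>n \<ge> 1\<close>, \<open>R \<ge> L * (K1 + 2)\<close>, \<open>R \<ge> 8 * K\<close> and
    \<open>1 / n \<le> c / 16\<close>.\<close>
  define T where "T = 1 + L * (real K1 + 2) / \<sigma> + 8 * K / \<sigma> + 16 / c"
  have sD: "sqrt D > 0" using D by simp
  show ?thesis
  proof (rule exI[of _ \<beta>], rule conjI[OF \<beta>], rule exI[of _ "sqrt D"], rule conjI[OF sD], intro allI impI)
    fix x1 \<delta> y1
    assume "blob_data U x1 \<delta> y1"
    have "\<forall>\<^sub>F n in sequentially. T \<le> real n"
      by (rule eventually_compose_filterlim[OF eventually_ge_at_top filterlim_real_sequentially])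
    then show "\<forall>\<^sub>F n in sequentially. \<forall>z1. is_arg_min (dist y1) (\<lambda>z. z \<in> grid n) z1 \<longrightarrow>
             (\<forall>A. star_connected U n A \<and>
                  c \<le> min (diameter A) (setdist (ball y1 (\<delta> / 4)) A) \<longrightarrow>
                (SUP x\<in>outer_boundary U n A.
                   hit_before_prob U n x (ball z1 (\<delta> / 4) \<inter> verts U n) A)
                \<le> ennreal (sqrt D / real n powr \<beta>))"
    proof (rule eventually_mono, intro allI impI)
      fix n z1 A
      assume Tn: "T \<le> real n" and z1: "is_arg_min (dist y1) (\<lambda>z. z \<in> grid n) z1"
      assume "star_connected U n A \<and> c \<le> min (diameter A) (setdist (ball y1 (\<delta> / 4)) A)"
      then have A: "star_connected U n A" "c \<le> diameter A" "c \<le> setdist (ball y1 (\<delta> / 4)) A" by auto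
      let ?S = "ball z1 (\<delta> / 4) \<inter> verts U n"
      have Tpos: "0 \<le> L * (real K1 + 2) / \<sigma>" "0 \<le> 8 * K / \<sigma>" "0 \<le> 16 / c"
        using ch(2) \<sigma>(1) K assms(2) by simp_all
      have nT: "1 \<le> real n" "L * (real K1 + 2) / \<sigma> \<le> real n" "8 * K / \<sigma> \<le> real n" "16 / c \<le> real n"
        using Tn Tpos unfolding T_def by linarith+
      then have n: "n > 0" by simp
      have RK: "L * (real K1 + 2) \<le> \<sigma> * real n" "8 * K \<le> \<sigma> * real n"
        using nT(2,3) \<sigma>(1) by (simp_all add: field_simps)
      have R4: "4 * L * (\<sigma> * real n) \<le> r * real n"
        using mult_right_mono[OF \<sigma>(2), of "real n"] by (simp add: mult_ac)
      have nc: "1 / real n \<le> c / 16" using nT(4) n assms(2) by (simp add: field_simps)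
      have yz: "dist y1 z1 \<le> 2 / real n"
      proof -
        have "\<not> dist y1 (rd n y1) < dist y1 z1"
          using z1 rd_in_grid unfolding is_arg_min_def by blast
        then show ?thesis using dist_rd[OF n, of y1] by (simp add: dist_commute)
      qed
      \<comment> \<open>The distance hypothesis concerns the ball about \<open>y1\<close>; shifting
        \<open>v\<close> by \<open>y1 - z1\<close> moves it into that ball at a cost of at most
        \<open>2 / n\<close>.\<close>
      have S_far: "c - 2 / real n \<le> dist v a" if "v \<in> ?S" "a \<in> A" for v a
      proof -
        have "y1 + (v - z1) \<in> ball y1 (\<delta> / 4)" using that(1) by (simp add: dist_norm norm_minus_commute)
        then have "c \<le> dist (y1 + (v - z1)) a" using A(3) setdist_le_dist[OF _ that(2)] by (meson order_trans)
        also have "\<dots> \<le> dist (y1 + (v - z1)) v + dist v a" by (rule dist_triangle)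
        also have "dist (y1 + (v - z1)) v = dist y1 z1" by (simp add: dist_norm)
        finally show ?thesis using yz by linarith
      qed
      have two: "2 / real n = 2 * (1 / real n)" by simp
      have AS: "A \<inter> ?S = {}"
      proof (rule ccontr)
        assume "A \<inter> ?S \<noteq> {}"
        then obtain v where "v \<in> ?S" "v \<in> A" by blast
        from S_far[OF this] show False using nc assms(2) unfolding two by simp
      qed
      show "(SUP x\<in>outer_boundary U n A. hit_before_prob U n x ?S A) \<le> ennreal (sqrt D / real n powr \<beta>)"
      proof (rule SUP_least)
        fix x assume x: "x \<in> outer_boundary U n A"
        then have "x \<in> U" unfolding outer_boundary_def verts_def by blast
        then obtain f where f: "chart r L \<kappa> U x f" using ch(4) by blast
        interpret lattice_chart U n r L \<kappa> x f K1 "\<sigma> * real n"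
          by unfold_locales (use n f ch K1 RK R4 in auto)
        have small: "dist x v \<le> c / 8" if "\<rho> v \<le> \<sigma> * real n" for v
        proof -
          have "dist x v \<le> L * (\<sigma> * real n) / real n"
            using rho_small(2)[OF that] R_pos by simp
          also have "\<dots> = L * \<sigma>" using n by simp
          finally show ?thesis using \<sigma>(3) by linarith
        qed
        have bA: "bounded A"
          using A(1) finite_verts[OF bU n] unfolding star_connected_def
          by (meson finite_imp_bounded finite_subset)
        \<comment> \<open>Two points of \<open>A\<close> more than \<open>c / 2\<close> apart cannot
          both be within \<open>c / 8\<close> of \<open>x\<close>, so one of them lies beyond the
          radius \<open>\<sigma> * n\<close>.\<close>
        have "\<exists>p\<in>A. \<exists>q\<in>A. c / 2 < dist p q"
          by (rule diameter_lower_bounded[OF bA]) (use A(2) assms(2) in auto)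
        then obtain p q where pq: "p \<in> A" "q \<in> A" "c / 2 < dist p q" by blast
        have "\<exists>y\<in>A. \<sigma> * real n < \<rho> y"
        proof (rule ccontr)
          assume "\<not> ?thesis"
          then have "dist x p \<le> c / 8" "dist x q \<le> c / 8" using pq small by force+
          then show False using pq(3) dist_triangle3[of p q x] assms(2) by linarith
        qed
        then obtain y where y: "y \<in> A" "\<sigma> * real n < \<rho> y" by blast
        \<comment> \<open>As \<open>x\<close> has a neighbour in \<open>A\<close>, a blob vertex
          within \<open>c / 8\<close> of \<open>x\<close> would be too close to
          \<open>A\<close>.\<close>
        have SR: "\<sigma> * real n < \<rho> v" if v: "v \<in> ?S" for v
        proof (rule ccontr)
          assume "\<not> ?thesis"
          then have xv: "dist x v \<le> c / 8" using small by simp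
          obtain a where a: "a \<in> A" "adj U n x a" using x unfolding outer_boundary_def by blast
          have "c - 2 / real n \<le> dist v a" by (rule S_far[OF v a(1)])
          also have "\<dots> \<le> dist x v + dist x a" using dist_triangle3[of v a x] .
          also have "dist x a = 1 / real n" using a(2) unfolding adj_def by simp
          finally show False using xv nc assms(2) unfolding two by linarith
        qed
        have "hit_before_prob U n x ?S A \<le>
          ennreal (sqrt (16 * K ^ 4 / \<theta> * (\<sigma> * real n / (8 * K)) powr log 8 \<theta>))"
          unfolding K_def \<theta>_def
          by (rule hit_before_prob_decay[OF bU x A(1) _ y AS SR]) (use RK(2) in \<open>unfold K_def\<close>)
        also have "16 * K ^ 4 / \<theta> * (\<sigma> * real n / (8 * K)) powr log 8 \<theta> = D * (real n powr - \<beta>)\<^sup>2"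
        proof -
          have "log 8 \<theta> = - \<beta> + - \<beta>" unfolding \<beta>_def by simp
          then have sq: "real n powr log 8 \<theta> = (real n powr - \<beta>)\<^sup>2"
            by (simp only: powr_add power2_eq_square)
          have "(\<sigma> * real n / (8 * K)) powr log 8 \<theta> =
              (\<sigma> / (8 * K)) powr log 8 \<theta> * real n powr log 8 \<theta>"
            using powr_mult[of "\<sigma> / (8 * K)" "real n" "log 8 \<theta>"] by simp
          then show ?thesis unfolding D_def sq by (simp only: mult.assoc)
        qed
        also have "sqrt (D * (real n powr - \<beta>)\<^sup>2) = sqrt D / real n powr \<beta>"
          by (simp add: real_sqrt_mult powr_minus_divide)
        finally show "hit_before_prob U n x ?S A \<le> ennreal (sqrt D / real n powr \<beta>)" .
      qed
    qed
  qed
qed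

end
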